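(* There exists a numerical constant $c>0$ such that the following holds for all integers $4\le q\le p$ and all continuous functions $f:\mathbb R_+\to\mathbb R$. Writing $I_0=[0,0.125(pq)^{1/4}]$ and $k^*=\lceil\log(4\lceil q/2\rceil)\rceil$, $$\inf_{\widehat T}\ \sup_{\mathbf A\in\mathbb R^{p\times q}:\ \|\mathbf A\|_\infty\le0.125(pq)^{1/4}}\mathbb E\big[\,|\widehat T-f_\sigma(\mathbf A)|\,\big]\ \ge\ c\,\Big[q\,E_{\mathcal P^{sym}_{2k^*}}[f;I_0]-q^{1/2}\|f\|_{\infty,I_0}\Big]_+ .$$
   Context: $\mathbf Y=\mathbf A+\mathbf E$, where $\mathbf A$ is a deterministic real $p\times q$ matrix and $\mathbf E$ is a $p\times q$ random matrix with independent standard normal entries. The infimum is over all estimators $\widehat T$, i.e. real-valued measurable functions of $\mathbf Y$, and the expectation is under the law of $\mathbf Y$ with parameter $\mathbf A$. $\sigma_1(\mathbf A)\ge\dots\ge\sigma_q(\mathbf A)\ge0$ are the singular values of $\mathbf A$, $\|\mathbf A\|_\infty=\sigma_1(\mathbf A)$ is the operator norm, and $f_\sigma(\mathbf A)=\sum_{i=1}^qf(\sigma_i(\mathbf A))$. $\mathcal P^{sym}_k$ is the space of symmetric (i.e. even, $P(-x)=P(x)$) real univariate polynomials of degree at most $k$. For an interval $I$, $\|g\|_{\infty,I}=\sup_{x\in I}|g(x)|$, and for a collection $\mathcal F$ of functions, $E_{\mathcal F}[g;I]=\inf_{h\in\mathcal F}\|h-g\|_{\infty,I}$. $x_+=\max(x,0)$;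 $\log$ is the natural logarithm. *)

theory Defs
  imports "HOL-Probability.Probability" "Jordan_Normal_Form.Char_Poly"
begin

section \<open>Singular values\<close>

text \<open>
  The singular values of a real \<open>p \<times> q\<close> matrix \<open>A\<close> are the square roots of the \<open>q\<close> eigenvalues of
  \<open>A\<^sup>T A\<close> (with multiplicity, as roots of the characteristic polynomial), in decreasing order.
  Lists are indexed from \<open>0\<close>, hence the shift by one in \<open>sing_val\<close>.
\<close>

definition sing_vals :: "real mat \<Rightarrow> real list" where
  "sing_vals A =
     rev (sorted_list_of_multiset (image_mset sqrt (proots (char_poly (transpose_mat A * A)))))"

definition sing_val :: "real mat \<Rightarrow> nat \<Rightarrow> real" where
  "sing_val A i = sing_vals A ! (i - 1)"

definition op_norm :: "real mat \<Rightarrow> real" where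
  "op_norm A = sing_val A 1"

definition spectral_sum :: "(real \<Rightarrow> real) \<Rightarrow> real mat \<Rightarrow> real" where
  "spectral_sum f A = (\<Sum>i = 1..dim_col A. f (sing_val A i))"


section \<open>The Gaussian matrix model\<close>

text \<open>
  \<open>gauss_noise p q\<close> is the joint law of the entries of \<open>E\<close>, as a measure on families indexed by the
  positions of a \<open>p \<times> q\<close> matrix; \<open>mat_borel p q\<close> is the space of \<open>p \<times> q\<close> matrices with the
  \<open>\<sigma>\<close>-algebra generated by the entries, i.e. the Borel \<open>\<sigma>\<close>-algebra; \<open>obs_law p q A\<close> is the law of
  \<open>Y = A + E\<close>.
\<close>

definition gauss_noise :: "nat \<Rightarrow> nat \<Rightarrow> (nat \<times> nat \<Rightarrow> real) measure" where
  "gauss_noise p q =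
     PiM ({..<p} \<times> {..<q}) (\<lambda>_. density lborel (\<lambda>x. ennreal (std_normal_density x)))"

definition mat_borel :: "nat \<Rightarrow> nat \<Rightarrow> real mat measure" where
  "mat_borel p q =
     vimage_algebra (carrier_mat p q) (\<lambda>M. \<lambda>ij\<in>{..<p} \<times> {..<q}. M $$ ij)
       (PiM ({..<p} \<times> {..<q}) (\<lambda>_. borel))"

definition obs_law :: "nat \<Rightarrow> nat \<Rightarrow> real mat \<Rightarrow> real mat measure" where
  "obs_law p q A = distr (gauss_noise p q) (mat_borel p q) (\<lambda>e. A + Matrix.mat p q e)"

lemma prob_space_gauss_noise: "prob_space (gauss_noise p q)"
  unfolding gauss_noise_def by (intro prob_space_PiM prob_space_normal_density) simp

lemma obs_measurable:
  assumes "A \<in> carrier_mat p q"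
  shows "(\<lambda>e. A + Matrix.mat p q e) \<in> gauss_noise p q \<rightarrow>\<^sub>M mat_borel p q"
  unfolding mat_borel_def
proof (rule measurable_vimage_algebra2)
  show "(\<lambda>e. A + Matrix.mat p q e) \<in> space (gauss_noise p q) \<rightarrow> carrier_mat p q"
    using assms by auto
  have "(\<lambda>e. \<lambda>ij\<in>{..<p} \<times> {..<q}. A $$ ij + e ij)
        \<in> gauss_noise p q \<rightarrow>\<^sub>M PiM ({..<p} \<times> {..<q}) (\<lambda>_. borel)"
    unfolding gauss_noise_def
  proof (rule measurable_restrict)
    fix ij assume ij: "ij \<in> {..<p} \<times> {..<q}"
    have "(\<lambda>e. e ij) \<in> PiM ({..<p} \<times> {..<q})
            (\<lambda>_. density lborel (\<lambda>x. ennreal (std_normal_density x))) \<rightarrow>\<^sub>M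
            density lborel (\<lambda>x. ennreal (std_normal_density x))"
      by (rule measurable_component_singleton[OF ij])
    then have "(\<lambda>e. e ij) \<in> borel_measurable (PiM ({..<p} \<times> {..<q})
            (\<lambda>_. density lborel (\<lambda>x. ennreal (std_normal_density x))))"
      by (simp cong: measurable_cong_sets)
    then show "(\<lambda>e. A $$ ij + e ij) \<in> borel_measurable (PiM ({..<p} \<times> {..<q})
            (\<lambda>_. density lborel (\<lambda>x. ennreal (std_normal_density x))))"
      by simp
  qed
  moreover have "(\<lambda>e. \<lambda>ij\<in>{..<p} \<times> {..<q}. (A + Matrix.mat p q e) $$ ij)
        = (\<lambda>e. \<lambda>ij\<in>{..<p} \<times> {..<q}. A $$ ij + e ij)"
    using assms by (intro ext) (auto simp: restrict_def)
  ultimately show "(\<lambda>e. \<lambda>ij\<in>{..<p} \<times> {..<q}. (A + Matrix.mat p q e) $$ ij)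
        \<in> gauss_noise p q \<rightarrow>\<^sub>M PiM ({..<p} \<times> {..<q}) (\<lambda>_. borel)"
    by simp
qed

lemma prob_space_obs_law: "A \<in> carrier_mat p q \<Longrightarrow> prob_space (obs_law p q A)"
  unfolding obs_law_def
  by (intro prob_space.prob_space_distr prob_space_gauss_noise obs_measurable)

text \<open>
  The expected absolute error, in \<open>[0, \<infinity>]\<close> so that non-integrable estimators have infinite risk.
\<close>

definition abs_risk :: "nat \<Rightarrow> nat \<Rightarrow> (real mat \<Rightarrow> real) \<Rightarrow> (real mat \<Rightarrow> real) \<Rightarrow> real mat \<Rightarrow> ennreal" where
  "abs_risk p q \<theta> T A = (\<integral>\<^sup>+ Y. ennreal \<bar>T Y - \<theta> A\<bar> \<partial>obs_law p q A)"

definition minimax_risk :: "nat \<Rightarrow> nat \<Rightarrow> (real mat \<Rightarrow> real) \<Rightarrow> real mat set \<Rightarrow> ennreal" where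
  "minimax_risk p q \<theta> \<Theta> =
     (INF T \<in> borel_measurable (mat_borel p q). SUP A \<in> \<Theta>. abs_risk p q \<theta> T A)"


section \<open>Uniform approximation\<close>

text \<open>
  The supremum is taken in the reals, so \<open>sup_norm\<close> is meaningful for functions bounded on a nonempty
  set; it is only used for continuous functions on a nonempty compact interval.
\<close>

definition sup_norm :: "(real \<Rightarrow> real) \<Rightarrow> real set \<Rightarrow> real" where
  "sup_norm g I = (SUP x\<in>I. \<bar>g x\<bar>)"

definition approx_err :: "(real \<Rightarrow> real) set \<Rightarrow> (real \<Rightarrow> real) \<Rightarrow> real set \<Rightarrow> real" where
  "approx_err F g I = (INF h\<in>F. sup_norm (\<lambda>x. h x - g x) I)"

definition sym_polys :: "nat \<Rightarrow> (real \<Rightarrow> real) set" where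
  "sym_polys k = {poly P | P. degree P \<le> k \<and> (\<forall>x. poly P (- x) = poly P x)}"

end

theory Submission
  imports Defs
begin

text \<open>
  Write \<open>r\<close> for the radius of the class, \<open>\<parallel>f\<parallel>\<close> for the supremum of \<open>f\<close> on \<open>[0, r]\<close>, \<open>E\<close> for the
  approximation error and \<open>n = q div 2\<close>. An estimator whose absolute risk is at most \<open>R\<close> on the whole
  class has bias at most \<open>R\<close> at every matrix of the class, and this remains true after it is clipped
  to \<open>[- q\<parallel>f\<parallel>, q\<parallel>f\<parallel>]\<close>, where the target lies. So \<open>2 R\<close> bounds the
  difference between the shift of the mean of the target and the shift of the mean of the clipped
  estimator when one prior on the class is exchanged for another one. The proof exhibits two priors
  for which the first shift is at least \<open>n E\<close> and the second one is tiny.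

  The priors come from duality. There are weights \<open>w\<close> on a finite subset of \<open>[0, r]\<close> of total absolute
  mass \<open>2\<close> that annihilate all even polynomials of degree at most \<open>2 k\<close> and satisfy
  \<open>\<Sum> w f \<ge> E\<close> (\<open>even_dual_weights\<close>). Their positive and negative parts are probability
  distributions with the same even moments up to order \<open>2 k\<close>. Under each prior the matrix has \<open>n\<close>
  independent singular values drawn from one of these two distributions, its other singular values
  are \<open>0\<close>, and the singular vectors are the columns of two independent random orthogonal matrices
  with a law invariant under rotations of the columns. Such a law is obtained by orthonormalising the rows of a
  Gaussian matrix (\<open>frame_law\<close>). By \<open>spectral_sum_svd\<close> the spectral sum depends on the drawn
  singular values only.

  The two priors are compared by exchanging one singular value at a time (\<open>hybrid_gap\<close>). For this
  comparison the other \<open>n - 1\<close> singular values and their singular vectors are frozen, but the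
  \<open>i\<close>-th left singular vector still has room to move: rotation invariance allows one to replace it by
  \<open>(p - n)\<^sup>-\<^sup>1\<^sup>/\<^sup>2 \<Sum> \<epsilon>\<^sub>j u\<^sub>j\<close>, the sum running over the \<open>p - n\<close> unused columns with independent random
  signs (\<open>frame_law_spread\<close>), and similarly on the right. The squared \<open>L\<^sup>2\<close> distance between the two
  Gaussian mixtures is then \<open>\<Sum> w(x) w(y) \<^bold>E exp (x y S S')\<close>, where \<open>S\<close> and \<open>S'\<close> are independent
  averages of \<open>p - n\<close> and \<open>q - n\<close> random signs (\<open>gaussian_mixture_bound\<close>). In the power series of the
  exponential the odd terms vanish by symmetry, the even terms up to order \<open>2 k\<close> vanish because the
  moments match, and the term of order \<open>2 l\<close> is at most \<open>4 \<rho>\<^sup>l\<close> with \<open>\<rho> = e\<^sup>2 / 1024\<close>, because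
  \<open>r\<^sup>4 = p q / 4096\<close> while \<open>p - n\<close> and \<open>q - n\<close> are at least \<open>p / 2\<close> and \<open>q / 2\<close>
  (\<open>exp_overlap_bound\<close>). As \<open>k \<ge> ln (2 q)\<close>, one exchange moves the mean of the clipped estimator by at
  most \<open>\<parallel>f\<parallel> / (4 q)\<close>. This gives \<open>n (E - \<parallel>f\<parallel> / (4 q)) \<le> 2 R\<close>, and \<open>n \<ge> q / 3\<close> yields the
  theorem with \<open>c = 1 / 6\<close>.
\<close>

section \<open>Dual weights for best uniform approximation\<close>

text \<open>
  The unit sphere of the maximum norm on the coefficient sequences of length \<open>Suc K\<close>, padded with
  zeros. Sequences of a fixed type keep the number of coefficients a variable, and in their
  product topology this sphere is compact.
\<close>

definition coeff_sphere :: "nat \<Rightarrow> (nat \<Rightarrow> real) set" where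
  "coeff_sphere K = {a. (\<forall>m. \<bar>a m\<bar> \<le> 1) \<and> (\<forall>m>K. a m = 0) \<and> (\<exists>m\<le>K. \<bar>a m\<bar> = 1)}"

lemma continuous_on_coord [continuous_intros]: "continuous_on S (\<lambda>a::nat \<Rightarrow> real. a m)"
  by (rule continuous_on_subset[OF continuous_on_product_coordinates]) simp

lemma compact_coeff_box:
  fixes c :: "nat \<Rightarrow> real"
  shows "compact {a::nat \<Rightarrow> real. \<forall>m. \<bar>a m\<bar> \<le> c m}"
proof -
  have "compactin (product_topology (\<lambda>_::nat. euclidean::real topology) UNIV) (PiE UNIV (\<lambda>m. {- c m..c m}))"
    by (subst compactin_PiE) auto
  moreover have "PiE UNIV (\<lambda>m. {- c m..c m}) = {a. \<forall>m. \<bar>a m\<bar> \<le> c m}"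
    by (auto simp: PiE_def Pi_def abs_le_iff minus_le_iff)
  ultimately show ?thesis
    by (simp add: euclidean_product_topology)
qed

lemma compact_coeff_sphere: "compact (coeff_sphere K)"
proof -
  have "coeff_sphere K = {a. \<forall>m. \<bar>a m\<bar> \<le> 1} \<inter> ((\<Inter>m\<in>{K<..}. {a. a m = 0}) \<inter> (\<Union>m\<in>{..K}. {a. \<bar>a m\<bar> = 1}))"
    by (auto simp: coeff_sphere_def)
  moreover have "closed ((\<Inter>m\<in>{K<..}. {a::nat\<Rightarrow>real. a m = 0}) \<inter> (\<Union>m\<in>{..K}. {a. \<bar>a m\<bar> = 1}))"
    by (intro closed_Int closed_INT closed_UN ballI finite_atMost closed_Collect_eq continuous_intros)
  ultimately show ?thesis
    using compact_coeff_box[of "\<lambda>_. 1"] by (simp add: compact_Int_closed)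
qed

text \<open>
  The combinations for which a given point of \<open>I\<close> is a witness form an open set, so by compactness of the
  sphere finitely many witnesses suffice.
\<close>

lemma finite_norming_set:
  fixes b :: "nat \<Rightarrow> 'x \<Rightarrow> real"
  assumes ex: "\<And>a. a \<in> coeff_sphere K \<Longrightarrow> \<exists>x\<in>I. \<bar>\<Sum>m\<le>K. a m * b m x\<bar> > E * \<bar>a K\<bar>"
  shows "\<exists>X. finite X \<and> X \<subseteq> I \<and> (\<forall>a \<in> coeff_sphere K. \<exists>x\<in>X. \<bar>\<Sum>m\<le>K. a m * b m x\<bar> > E * \<bar>a K\<bar>)"
proof -
  define U where "U x = {a. E * \<bar>a K\<bar> < \<bar>\<Sum>m\<le>K. a m * b m x\<bar>}" for x
  have op: "open (U x)" for x
    unfolding U_def by (intro open_Collect_less continuous_intros)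
  have "coeff_sphere K \<subseteq> (\<Union>x\<in>I. U x)"
    using ex by (auto simp: U_def)
  from compactE_image[OF compact_coeff_sphere op this]
  obtain X where "X \<subseteq> I" "finite X" "coeff_sphere K \<subseteq> (\<Union>x\<in>X. U x)"
    by metis
  then show ?thesis
    by (intro exI[of _ X]) (auto simp: U_def)
qed

lemma scale_to_coeff_sphere:
  fixes a :: "nat \<Rightarrow> real"
  assumes "\<And>m. m > K \<Longrightarrow> a m = 0" "m0 \<le> K" "a m0 \<noteq> 0"
  obtains l where "l > 0" "\<And>m. \<bar>a m\<bar> \<le> l" "(\<lambda>m. a m / l) \<in> coeff_sphere K"
proof -
  define l where "l = Max ((\<lambda>m. \<bar>a m\<bar>) ` {..K})"
  have le: "\<bar>a m\<bar> \<le> l" if "m \<le> K" for m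
    unfolding l_def using that by (intro Max_ge) auto
  have pos: "l > 0" using le[of m0] assms by auto
  have "l \<in> (\<lambda>m. \<bar>a m\<bar>) ` {..K}"
    unfolding l_def by (intro Max_in) auto
  then obtain m where m: "m \<le> K" "\<bar>a m\<bar> = l" by auto
  have le': "\<bar>a m\<bar> \<le> l" for m
    using le[of m] assms(1)[of m] pos by (cases "m \<le> K") auto
  have "(\<lambda>m. a m / l) \<in> coeff_sphere K"
    unfolding coeff_sphere_def using pos m le' assms(1) by (auto intro!: exI[of _ m])
  then show ?thesis using that pos le' by blast
qed

text \<open>
  The stationarity condition of a least \<open>2 s\<close>-th power approximation: at a minimiser of
  \<open>\<Sum> (f - P)\<^sup>2\<^sup>s\<close> over the span of the \<open>b m\<close>, the function \<open>(f - P)\<^sup>2\<^sup>s\<^sup>-\<^sup>1\<close> is orthogonal to the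
  span. This turns smooth minimisation into a source of annihilating weights. A minimiser exists because
  the functions are linearly independent on \<open>X\<close>, which makes the objective coercive.
\<close>

lemma even_power_minimiser:
  fixes b :: "nat \<Rightarrow> 'x \<Rightarrow> real" and f :: "'x \<Rightarrow> real"
  assumes X: "finite X" and s: "s > 0"
    and indep: "\<And>a. a \<in> coeff_sphere K \<Longrightarrow> \<exists>x\<in>X. (\<Sum>m\<le>K. a m * b m x) \<noteq> 0"
  shows "\<exists>a. \<forall>m\<le>K. (\<Sum>x\<in>X. (f x - (\<Sum>m\<le>K. a m * b m x)) ^ (2 * s - 1) * b m x) = 0"
proof -
  define P where "P a x = (\<Sum>m\<le>K. a m * b m x)" for a x
  define J where "J a = (\<Sum>x\<in>X. (f x - P a x) ^ (2 * s))" for a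
  have contJ: "continuous_on S J" for S
    unfolding J_def P_def by (intro continuous_intros)
  have contP: "continuous_on S (\<lambda>a. P a x)" for S x
    unfolding P_def by (intro continuous_intros)
  have sphere_ne: "coeff_sphere K \<noteq> {}"
    by (auto simp: coeff_sphere_def intro!: exI[of _ "\<lambda>m. if m = K then 1 else 0"])
  \<comment> \<open>By homogeneity the minimum \<open>d\<close> of the \<open>l\<^sup>1\<close> norm over the sphere controls all coefficients, so
    coefficients of size above \<open>L\<close> cannot compete with the zero polynomial.\<close>
  obtain a0 where a0: "a0 \<in> coeff_sphere K"
      "\<And>a. a \<in> coeff_sphere K \<Longrightarrow> (\<Sum>x\<in>X. \<bar>P a0 x\<bar>) \<le> (\<Sum>x\<in>X. \<bar>P a x\<bar>)"
  proof -
    have "continuous_on (coeff_sphere K) (\<lambda>a. \<Sum>x\<in>X. \<bar>P a x\<bar>)"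
      by (intro continuous_intros contP)
    from continuous_attains_inf[OF compact_coeff_sphere sphere_ne this] show ?thesis
      using that by blast
  qed
  define d where "d = (\<Sum>x\<in>X. \<bar>P a0 x\<bar>)"
  have d: "d > 0"
  proof -
    obtain x where "x \<in> X" "P a0 x \<noteq> 0" using indep[OF a0(1)] by (auto simp: P_def)
    then show ?thesis unfolding d_def using X by (intro sum_pos2[of _ x]) auto
  qed
  define Z :: "nat \<Rightarrow> real" where "Z = (\<lambda>_. 0)"
  define L where "L = (\<Sum>x\<in>X. \<bar>f x\<bar> + (1 + J Z)) / d"
  have J0: "J a \<ge> 0" for a unfolding J_def by (intro sum_nonneg) (simp add: power_mult)
  have bnd: "\<bar>a m\<bar> \<le> L" if aK: "\<And>m. m > K \<Longrightarrow> a m = 0" and JZ: "J a \<le> J Z" for a m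
  proof (cases "\<exists>m\<le>K. a m \<noteq> 0")
    case False
    then have "a m = 0" using aK[of m] by (cases "m \<le> K") auto
    moreover have "L \<ge> 0" unfolding L_def using d J0 by (auto intro!: divide_nonneg_pos sum_nonneg add_nonneg_nonneg)
    ultimately show ?thesis by simp
  next
    case True
    then obtain m0 where "m0 \<le> K" "a m0 \<noteq> 0" by blast
    from scale_to_coeff_sphere[of K a m0, OF aK this] obtain l where l: "l > 0" "\<And>m. \<bar>a m\<bar> \<le> l"
      "(\<lambda>m. a m / l) \<in> coeff_sphere K" by metis
    have "P (\<lambda>m. a m / l) x = P a x / l" for x
      unfolding P_def by (simp add: sum_divide_distrib)
    then have "d \<le> (\<Sum>x\<in>X. \<bar>P a x\<bar> / l)"
      using a0(2)[OF l(3)] l(1) by (simp add: d_def)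
    then have "d * l \<le> (\<Sum>x\<in>X. \<bar>P a x\<bar>)"
      using l(1) by (simp add: sum_divide_distrib[symmetric] field_simps)
    also have "\<dots> \<le> (\<Sum>x\<in>X. \<bar>f x\<bar> + (1 + J Z))"
    proof (intro sum_mono)
      fix x assume x: "x \<in> X"
      have "\<bar>f x - P a x\<bar> \<le> 1 + J Z"
      proof (cases "\<bar>f x - P a x\<bar> \<le> 1")
        case True then show ?thesis using J0[of Z] by simp
      next
        case False
        then have "\<bar>f x - P a x\<bar> ^ 1 \<le> \<bar>f x - P a x\<bar> ^ (2 * s)"
          using s by (intro power_increasing) auto
        also have "\<dots> = (f x - P a x) ^ (2 * s)" by (simp add: power_even_abs)
        also have "\<dots> \<le> J a"
          unfolding J_def using x X by (intro member_le_sum) (auto simp: power_mult)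
        finally show ?thesis using JZ by simp
      qed
      then show "\<bar>P a x\<bar> \<le> \<bar>f x\<bar> + (1 + J Z)" by linarith
    qed
    finally have "l \<le> L" unfolding L_def using d by (simp add: field_simps)
    then show ?thesis using l(2)[of m] by linarith
  qed
  define C where "C = {a. \<forall>m. \<bar>a m\<bar> \<le> (if m \<le> K then L else 0)}"
  have ZC: "Z \<in> C" using bnd[of Z] by (auto simp: C_def Z_def)
  obtain a where a: "a \<in> C" "\<And>a'. a' \<in> C \<Longrightarrow> J a \<le> J a'"
    using continuous_attains_inf[OF compact_coeff_box, of "\<lambda>m. if m \<le> K then L else 0" J] ZC contJ
    unfolding C_def by blast
  have min: "J a \<le> J a'" if "\<And>m. m > K \<Longrightarrow> a' m = 0" for a'
  proof (cases "J a' \<le> J Z")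
    case True
    then have "a' \<in> C" using bnd[OF that] that by (auto simp: C_def)
    then show ?thesis by (rule a(2))
  next
    case False then show ?thesis using a(2)[OF ZC] by simp
  qed
  have aK: "a m = 0" if "m > K" for m
    using a(1) that unfolding C_def by (auto dest: spec[of _ m])
  have "(\<Sum>x\<in>X. (f x - P a x) ^ (2 * s - 1) * b m x) = 0" if m: "m \<le> K" for m
  proof -
    define g where "g t = (\<Sum>x\<in>X. (f x - P a x - t * b m x) ^ (2 * s))" for t
    have P: "P (a(m := a m + t)) x = P a x + t * b m x" for t x
    proof -
      have "P (a(m := a m + t)) x = (\<Sum>j\<le>K. a j * b j x + (if j = m then t * b j x else 0))"
        unfolding P_def by (intro sum.cong) (auto simp: algebra_simps)
      also have "\<dots> = P a x + t * b m x"
        using m by (simp add: sum.distrib P_def)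
      finally show ?thesis .
    qed
    have g: "g t = J (a(m := a m + t))" for t
      unfolding g_def J_def P by (simp add: algebra_simps)
    have "g 0 \<le> g t" for t
    proof -
      have "J a \<le> J (a(m := a m + t))" using m aK by (intro min) auto
      then show ?thesis using g[of t] g[of 0] by simp
    qed
    moreover have "(g has_real_derivative
        (\<Sum>x\<in>X. real (2 * s) * (f x - P a x - 0 * b m x) ^ (2 * s - 1) * (- b m x))) (at 0)"
      unfolding g_def by (auto intro!: derivative_eq_intros sum.cong)
    ultimately have "(\<Sum>x\<in>X. real (2 * s) * (f x - P a x - 0 * b m x) ^ (2 * s - 1) * (- b m x)) = 0"
      using DERIV_local_min[of g _ 0 1] by auto
    then have "real (2 * s) * (\<Sum>x\<in>X. (f x - P a x) ^ (2 * s - 1) * b m x) = 0"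
      by (simp add: sum_distrib_left sum_negf mult.assoc)
    then show ?thesis using s by simp
  qed
  then show ?thesis unfolding P_def by blast
qed

text \<open>
  For a large exponent the ratio of consecutive power sums of \<open>c\<close> is close to the maximum of \<open>c\<close>: only
  entries below \<open>2 M / 3\<close> could spoil this, and even \<open>card X\<close> of them do not outweigh the single
  entry \<open>c x0\<close>.
\<close>

lemma power_ratio_bound:
  fixes c :: "'x \<Rightarrow> real"
  assumes X: "finite X" and x0: "x0 \<in> X" "c x0 \<ge> M" and c0: "\<And>x. x \<in> X \<Longrightarrow> c x \<ge> 0" and M: "M > 0" and s: "s > 0"
    and big: "real (card X) * (2 / 3) ^ (2 * s) \<le> 1 / 3"
  shows "(2 / 3 * M) * (\<Sum>x\<in>X. c x ^ (2 * s - 1)) \<le> (\<Sum>x\<in>X. c x ^ (2 * s))"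
proof -
  define \<kappa> where "\<kappa> = 2 / 3 * M"
  have k: "\<kappa> > 0" "\<kappa> \<le> M" using M by (auto simp: \<kappa>_def)
  have e: "y ^ (2 * s) = y ^ (2 * s - 1) * y" for y :: real
    using s by (metis One_nat_def Suc_leI Suc_pred mult_pos_pos power_Suc2 zero_less_numeral)
  have t: "c x ^ (2 * s - 1) * (c x - \<kappa>) \<ge> - (\<kappa> ^ (2 * s))" if x: "x \<in> X" for x
  proof (cases "c x \<ge> \<kappa>")
    case True
    then have "c x ^ (2 * s - 1) * (c x - \<kappa>) \<ge> 0" using k by simp
    moreover have "\<kappa> ^ (2 * s) \<ge> 0" using k by simp
    ultimately show ?thesis by linarith
  next
    case False
    have "c x ^ (2 * s - 1) * (\<kappa> - c x) \<le> \<kappa> ^ (2 * s - 1) * \<kappa>"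
      using False c0[OF x] k by (intro mult_mono power_mono) auto
    then show ?thesis unfolding e[of \<kappa>] by (simp add: algebra_simps)
  qed
  have "M ^ (2 * s) / 3 \<le> c x0 ^ (2 * s - 1) * (c x0 - \<kappa>)"
  proof -
    have "M ^ (2 * s) / 3 = M ^ (2 * s - 1) * (M - \<kappa>)"
      unfolding e[of M] \<kappa>_def by (simp add: field_simps)
    also have "\<dots> \<le> c x0 ^ (2 * s - 1) * (c x0 - \<kappa>)"
      using x0 k M by (intro mult_mono power_mono) auto
    finally show ?thesis .
  qed
  moreover have "(\<Sum>x\<in>X - {x0}. c x ^ (2 * s - 1) * (c x - \<kappa>)) \<ge> (\<Sum>x\<in>X - {x0}. - (\<kappa> ^ (2 * s)))"
    using t by (intro sum_mono) auto
  moreover have "(\<Sum>x\<in>X - {x0}. \<kappa> ^ (2 * s)) \<le> real (card X) * \<kappa> ^ (2 * s)"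
    using k X by (simp add: mult_right_mono card_Diff1_le)
  moreover have "real (card X) * \<kappa> ^ (2 * s) \<le> M ^ (2 * s) / 3"
  proof -
    have "real (card X) * \<kappa> ^ (2 * s) = (real (card X) * (2 / 3) ^ (2 * s)) * M ^ (2 * s)"
      by (simp only: \<kappa>_def power_mult_distrib mult.assoc)
    also have "\<dots> \<le> 1 / 3 * M ^ (2 * s)" using big M by (intro mult_right_mono) auto
    finally show ?thesis by simp
  qed
  ultimately have "(\<Sum>x\<in>X. c x ^ (2 * s - 1) * (c x - \<kappa>)) \<ge> 0"
    using X x0(1) by (simp add: sum.remove[of X x0] sum_negf)
  also have "(\<Sum>x\<in>X. c x ^ (2 * s - 1) * (c x - \<kappa>)) = (\<Sum>x\<in>X. c x ^ (2 * s)) - \<kappa> * (\<Sum>x\<in>X. c x ^ (2 * s - 1))"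
    unfolding e right_diff_distrib sum_subtractf sum_distrib_left by (simp only: mult.commute)
  finally show ?thesis by (simp add: \<kappa>_def)
qed

text \<open>
  Duality for best uniform approximation. The weights are proportional to \<open>(f - P)\<^sup>2\<^sup>s\<^sup>-\<^sup>1\<close> for a least
  \<open>2 s\<close>-th power approximation \<open>P\<close> on a finite set \<open>X\<close>: they annihilate the approximating space, so
  \<open>\<Sum> w f = \<Sum> w (f - P)\<close> is a ratio of consecutive power sums of \<open>\<bar>f - P\<bar>\<close>, and for large \<open>s\<close> this
  ratio is close to the maximum of \<open>\<bar>f - P\<bar>\<close> on \<open>X\<close>. The loss is a factor \<open>3/4\<close> for passing
  to a finite set and a factor \<open>2/3\<close> for passing to power sums; the normalisation to mass \<open>2\<close>
  absorbs their product \<open>1/2\<close>.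
\<close>

lemma dual_weights:
  fixes b :: "nat \<Rightarrow> 'x \<Rightarrow> real" and f :: "'x \<Rightarrow> real"
  assumes E: "E > 0" and ex: "\<And>a. \<exists>x\<in>I. \<bar>f x - (\<Sum>m\<le>K. a m * b m x)\<bar> \<ge> E"
    and indep: "\<And>a. (\<exists>m\<le>K. a m \<noteq> 0) \<Longrightarrow> \<exists>x\<in>I. (\<Sum>m\<le>K. a m * b m x) \<noteq> 0"
  obtains X w where "finite X" "X \<subseteq> I" "(\<Sum>x\<in>X. \<bar>w x\<bar>) = 2"
    "\<And>m. m \<le> K \<Longrightarrow> (\<Sum>x\<in>X. w x * b m x) = 0" "(\<Sum>x\<in>X. w x * f x) \<ge> E"
proof -
  \<comment> \<open>Treating \<open>f\<close> as one more basis function makes the finite set norming for \<open>f\<close> and for the basis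
    at the same time.\<close>
  define b' where "b' m = (if m \<le> K then b m else f)" for m
  have b': "(\<Sum>m\<le>Suc K. a m * b' m x) = (\<Sum>m\<le>K. a m * b m x) + a (Suc K) * f x" for a x
    unfolding sum.atMost_Suc by (simp add: b'_def)
  have "\<exists>x\<in>I. \<bar>\<Sum>m\<le>Suc K. a m * b' m x\<bar> > (3 / 4 * E) * \<bar>a (Suc K)\<bar>" if a: "a \<in> coeff_sphere (Suc K)" for a
  proof (cases "a (Suc K) = 0")
    case True
    with a obtain m where "m \<le> K" "a m \<noteq> 0"
      unfolding coeff_sphere_def by (auto simp: le_Suc_eq)
    then show ?thesis unfolding b' using indep[of a] True by auto
  next
    case False
    obtain x where x: "x \<in> I" "\<bar>f x - (\<Sum>m\<le>K. (- a m / a (Suc K)) * b m x)\<bar> \<ge> E"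
      using ex[of "\<lambda>m. - a m / a (Suc K)"] by (rule bexE)
    have "(\<Sum>m\<le>Suc K. a m * b' m x) = a (Suc K) * (f x - (\<Sum>m\<le>K. (- a m / a (Suc K)) * b m x))"
    proof -
      have "a (Suc K) * (\<Sum>m\<le>K. (- a m / a (Suc K)) * b m x) = (\<Sum>m\<le>K. - (a m * b m x))"
        unfolding sum_distrib_left using False by (intro sum.cong) auto
      then show ?thesis unfolding b' right_diff_distrib by (simp add: sum_negf)
    qed
    then have "\<bar>\<Sum>m\<le>Suc K. a m * b' m x\<bar> \<ge> \<bar>a (Suc K)\<bar> * E"
      using x(2) by (simp add: abs_mult mult_left_mono)
    moreover have "\<bar>a (Suc K)\<bar> * E > 3 / 4 * E * \<bar>a (Suc K)\<bar>" using False E by simp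
    ultimately show ?thesis using x(1) by (intro bexI[of _ x]) linarith+
  qed
  from finite_norming_set[OF this] obtain X where X: "finite X" "X \<subseteq> I"
    and norming: "\<And>a. a \<in> coeff_sphere (Suc K) \<Longrightarrow> \<exists>x\<in>X. \<bar>\<Sum>m\<le>Suc K. a m * b' m x\<bar> > (3 / 4 * E) * \<bar>a (Suc K)\<bar>"
    by blast
  have indepX: "\<exists>x\<in>X. (\<Sum>m\<le>K. a m * b m x) \<noteq> 0" if "a \<in> coeff_sphere K" for a
  proof -
    have "a \<in> coeff_sphere (Suc K)" "a (Suc K) = 0"
      using that unfolding coeff_sphere_def by (auto intro: le_SucI)
    then show ?thesis using norming[of a] unfolding b' by auto
  qed
  have ex34: "\<exists>x\<in>X. \<bar>f x - (\<Sum>m\<le>K. a m * b m x)\<bar> > 3 / 4 * E" for a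
  proof -
    define a' where "a' m = (if m \<le> K then - a m else if m = Suc K then 1 else 0)" for m
    obtain l where l: "l > 0" "(\<lambda>m. a' m / l) \<in> coeff_sphere (Suc K)"
      using scale_to_coeff_sphere[of "Suc K" a' "Suc K"] by (auto simp: a'_def)
    from norming[OF l(2)] obtain x where x: "x \<in> X"
      "\<bar>\<Sum>m\<le>Suc K. (a' m / l) * b' m x\<bar> > (3 / 4 * E) * \<bar>a' (Suc K) / l\<bar>" by blast
    have "(\<Sum>m\<le>Suc K. (a' m / l) * b' m x) = (\<Sum>m\<le>Suc K. a' m * b' m x) / l"
      by (simp only: times_divide_eq_left sum_divide_distrib)
    also have "(\<Sum>m\<le>Suc K. a' m * b' m x) = f x - (\<Sum>m\<le>K. a m * b m x)"
      unfolding b' by (simp add: a'_def sum_negf)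
    finally have eq: "(\<Sum>m\<le>Suc K. (a' m / l) * b' m x) = (f x - (\<Sum>m\<le>K. a m * b m x)) / l" .
    have "\<bar>f x - (\<Sum>m\<le>K. a m * b m x)\<bar> / l > (3 / 4 * E) / l"
      using x(2) l(1) unfolding eq by (simp add: a'_def)
    then have "\<bar>f x - (\<Sum>m\<le>K. a m * b m x)\<bar> > 3 / 4 * E"
      using l(1) unfolding divide_less_cancel by auto
    then show ?thesis using x(1) by blast
  qed
  have "(\<lambda>s. (2 / 3 :: real) ^ s) \<longlonglongrightarrow> 0" by (rule LIMSEQ_realpow_zero) auto
  then have "(\<lambda>s. real (card X) * (2 / 3 :: real) ^ s) \<longlonglongrightarrow> real (card X) * 0"
    by (intro tendsto_mult tendsto_const)
  then have "eventually (\<lambda>s. real (card X) * (2 / 3 :: real) ^ s < 1 / 3) sequentially"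
    by (rule order_tendstoD) simp
  then obtain s0 where s0: "\<And>s. s \<ge> s0 \<Longrightarrow> real (card X) * (2 / 3 :: real) ^ s < 1 / 3"
    unfolding eventually_sequentially by blast
  define s where "s = Suc s0"
  have s: "s > 0" and big: "real (card X) * (2 / 3) ^ (2 * s) \<le> 1 / 3"
    using s0[of "2 * s"] by (auto simp: s_def)
  obtain a where a: "\<And>m. m \<le> K \<Longrightarrow> (\<Sum>x\<in>X. (f x - (\<Sum>m\<le>K. a m * b m x)) ^ (2 * s - 1) * b m x) = 0"
    using even_power_minimiser[OF X(1) s indepX] by blast
  define h where "h x = f x - (\<Sum>m\<le>K. a m * b m x)" for x
  obtain x0 where x0: "x0 \<in> X" "\<bar>h x0\<bar> > 3 / 4 * E" using ex34[of a] by (auto simp: h_def)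
  define N where "N = (\<Sum>x\<in>X. \<bar>h x\<bar> ^ (2 * s - 1))"
  have ratio: "(2 / 3 * (3 / 4 * E)) * N \<le> (\<Sum>x\<in>X. \<bar>h x\<bar> ^ (2 * s))"
    unfolding N_def using X(1) x0 E s big by (intro power_ratio_bound[of _ x0]) auto
  have N: "N > 0"
    unfolding N_def using X(1) x0 E by (intro sum_pos2[of _ x0]) auto
  define w where "w x = 2 * h x ^ (2 * s - 1) / N" for x
  have "(\<Sum>x\<in>X. \<bar>w x\<bar>) = 2 * N / N"
    using N by (simp add: w_def abs_mult power_abs sum_divide_distrib N_def sum_distrib_left)
  then have 1: "(\<Sum>x\<in>X. \<bar>w x\<bar>) = 2" using N by simp
  have 2: "(\<Sum>x\<in>X. w x * b m x) = 0" if "m \<le> K" for m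
  proof -
    have "(\<Sum>x\<in>X. w x * b m x) = 2 / N * (\<Sum>x\<in>X. h x ^ (2 * s - 1) * b m x)"
      unfolding w_def sum_distrib_left by (intro sum.cong) auto
    then show ?thesis using a[OF that] by (simp add: h_def)
  qed
  have "(\<Sum>x\<in>X. w x * f x) = (\<Sum>x\<in>X. w x * h x) + (\<Sum>x\<in>X. w x * (\<Sum>m\<le>K. a m * b m x))"
    by (simp add: h_def sum.distrib[symmetric] algebra_simps)
  also have "(\<Sum>x\<in>X. w x * (\<Sum>m\<le>K. a m * b m x)) = (\<Sum>m\<le>K. a m * (\<Sum>x\<in>X. w x * b m x))"
    unfolding sum_distrib_left by (subst sum.swap) (simp add: mult_ac)
  also have "\<dots> = 0" using 2 by simp
  also have "(\<Sum>x\<in>X. w x * h x) = 2 / N * (\<Sum>x\<in>X. \<bar>h x\<bar> ^ (2 * s))"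
  proof -
    have "h x ^ (2 * s - 1) * h x = \<bar>h x\<bar> ^ (2 * s)" for x
      using s by (metis One_nat_def Suc_leI Suc_pred mult_pos_pos power_Suc2 zero_less_numeral power_even_abs dvd_triv_left)
    then show ?thesis unfolding w_def sum_distrib_left by (intro sum.cong) (auto simp: mult_ac)
  qed
  finally have "(\<Sum>x\<in>X. w x * f x) = 2 / N * (\<Sum>x\<in>X. \<bar>h x\<bar> ^ (2 * s))" by simp
  also have "\<dots> \<ge> 2 / N * ((2 / 3 * (3 / 4 * E)) * N)"
    using ratio N by (intro mult_left_mono) auto
  finally have 3: "(\<Sum>x\<in>X. w x * f x) \<ge> E" using N by simp
  show ?thesis using that[of X w] X 1 2 3 by blast
qed

section \<open>Random signs and the overlap of spread-out rank-one perturbations\<close>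

text \<open>
  The power series can be compared term by term, since \<open>2\<^sup>n n! \<le> (2 n)!\<close>.
\<close>

lemma cosh_le_exp_half_square: "cosh (t::real) \<le> exp (t\<^sup>2 / 2)"
proof -
  have "(\<lambda>n. if even n then t ^ n /\<^sub>R fact n else 0) sums cosh t" by (rule cosh_converges)
  then have c: "(\<lambda>n. t ^ (2 * n) /\<^sub>R fact (2 * n)) sums cosh t"
    by (subst (asm) sums_mono_reindex[of "\<lambda>n. 2 * n", symmetric]) (auto simp: strict_mono_def)
  have e: "(\<lambda>n. (t\<^sup>2 / 2) ^ n /\<^sub>R fact n) sums exp (t\<^sup>2 / 2)" by (rule exp_converges)
  have f: "(2::real) ^ n * fact n \<le> fact (2 * n)" for n
  proof (induction n)
    case (Suc n)
    have "(2::real) ^ Suc n * fact (Suc n) = (2 * (1 + real n)) * (2 ^ n * fact n)" by simp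
    also have "\<dots> \<le> (real (2 * n + 2) * real (2 * n + 1)) * fact (2 * n)"
      using Suc by (intro mult_mono) (auto simp: algebra_simps)
    also have "\<dots> = fact (2 * Suc n)" by (simp add: algebra_simps)
    finally show ?case .
  qed simp
  show ?thesis
  proof (rule sums_le[OF _ c e])
    fix n
    have "t ^ (2 * n) /\<^sub>R fact (2 * n) = (t\<^sup>2) ^ n * (1 / fact (2 * n))"
      by (simp add: power_mult divide_inverse)
    also have "\<dots> \<le> (t\<^sup>2) ^ n * (1 / (2 ^ n * fact n))"
      using f[of n] by (intro mult_left_mono divide_left_mono mult_pos_pos) auto
    also have "\<dots> = (t\<^sup>2 / 2) ^ n /\<^sub>R fact n"
      unfolding power_divide real_scaleR_def inverse_eq_divide by (simp only: times_divide_eq_right times_divide_eq_left divide_divide_eq_left mult_1_right mult_1_left mult.commute)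
    finally show "t ^ (2 * n) /\<^sub>R fact (2 * n) \<le> (t\<^sup>2 / 2) ^ n /\<^sub>R fact n" .
  qed
qed

lemma even_term_le_cosh: "x ^ (2 * l) / fact (2 * l) \<le> cosh (x::real)"
proof -
  have c: "(\<lambda>n. if even n then x ^ n /\<^sub>R fact n else 0) sums cosh x" by (rule cosh_converges)
  have "(\<Sum>n\<in>{2 * l}. if even n then x ^ n /\<^sub>R fact n else 0) \<le> (\<Sum>n. if even n then x ^ n /\<^sub>R fact n else 0)"
    using c by (intro sum_le_suminf sums_summable) (auto simp: zero_le_even_power)
  then show ?thesis using sums_unique[OF c] by (simp add: divide_inverse mult.commute)
qed

definition signs :: "'j set \<Rightarrow> ('j \<Rightarrow> real) set" where
  "signs J = PiE J (\<lambda>_. {- 1, 1})"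

text \<open>
  The inner product of the unit vectors \<open>(card J)\<^sup>-\<^sup>1\<^sup>/\<^sup>2 \<epsilon>\<close> and \<open>(card J)\<^sup>-\<^sup>1\<^sup>/\<^sup>2 \<delta>\<close>.
\<close>

definition sign_corr :: "'j set \<Rightarrow> ('j \<Rightarrow> real) \<Rightarrow> ('j \<Rightarrow> real) \<Rightarrow> real" where
  "sign_corr J \<epsilon> \<delta> = (\<Sum>j\<in>J. \<epsilon> j * \<delta> j) / real (card J)"

lemma finite_signs [simp]: "finite J \<Longrightarrow> finite (signs J)"
  unfolding signs_def by (intro finite_PiE) auto

lemma card_signs: "finite J \<Longrightarrow> card (signs J) = 2 ^ card J"
  unfolding signs_def by (simp add: card_PiE numeral_2_eq_2)

lemma signs_abs: "\<epsilon> \<in> signs J \<Longrightarrow> j \<in> J \<Longrightarrow> \<epsilon> j = 1 \<or> \<epsilon> j = - 1"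
  unfolding signs_def by (auto simp: PiE_def Pi_def)

lemma sum_exp_sign_corr:
  assumes J: "finite J" and \<delta>: "\<delta> \<in> signs J"
  shows "(\<Sum>\<epsilon>\<in>signs J. exp (t * sign_corr J \<epsilon> \<delta>)) = (2 * cosh (t / real (card J))) ^ card J"
proof -
  have "(\<Sum>\<epsilon>\<in>signs J. exp (t * sign_corr J \<epsilon> \<delta>)) =
      (\<Sum>\<epsilon>\<in>PiE J (\<lambda>_. {- 1, 1}). \<Prod>j\<in>J. exp (t / real (card J) * (\<epsilon> j * \<delta> j)))"
    unfolding signs_def sign_corr_def using J
    by (simp add: exp_sum[symmetric] sum_distrib_left sum_divide_distrib)
  also have "\<dots> = (\<Prod>j\<in>J. \<Sum>e\<in>{- 1, 1}. exp (t / real (card J) * (e * \<delta> j)))"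
    using J by (subst prod_sum_PiE) auto
  also have "\<dots> = (\<Prod>j\<in>J. 2 * cosh (t / real (card J)))"
  proof (intro prod.cong refl)
    fix j assume "j \<in> J"
    then consider "\<delta> j = 1" | "\<delta> j = - 1" using signs_abs[OF \<delta>] by blast
    then show "(\<Sum>e\<in>{- 1, 1}. exp (t / real (card J) * (e * \<delta> j))) = 2 * cosh (t / real (card J))"
      by cases (auto simp: cosh_def)
  qed
  finally show ?thesis by simp
qed

text \<open>
  The \<open>m\<close>-th moment of the inner product of two independent uniformly distributed sign vectors,
  normalised to length \<open>1\<close>.
\<close>

definition sign_moment :: "'j set \<Rightarrow> nat \<Rightarrow> real" where
  "sign_moment J m = (\<Sum>\<epsilon>\<in>signs J. \<Sum>\<delta>\<in>signs J. sign_corr J \<epsilon> \<delta> ^ m) / 4 ^ card J"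

lemma sign_moment_odd:
  assumes "odd m" shows "sign_moment J m = 0"
proof -
  define neg where "neg \<epsilon> = (\<lambda>j\<in>J. - \<epsilon> j)" for \<epsilon> :: "'a \<Rightarrow> real"
  have "bij_betw neg (signs J) (signs J)"
    by (rule bij_betw_byWitness[of _ neg])
       (auto simp: neg_def signs_def PiE_def Pi_def extensional_def fun_eq_iff restrict_def minus_equation_iff)
  then have "(\<Sum>\<epsilon>\<in>signs J. \<Sum>\<delta>\<in>signs J. sign_corr J \<epsilon> \<delta> ^ m) =
      (\<Sum>\<epsilon>\<in>signs J. \<Sum>\<delta>\<in>signs J. sign_corr J (neg \<epsilon>) \<delta> ^ m)"
    by (rule sum.reindex_bij_betw[symmetric])
  also have "\<dots> = (\<Sum>\<epsilon>\<in>signs J. \<Sum>\<delta>\<in>signs J. - (sign_corr J \<epsilon> \<delta> ^ m))"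
    using assms by (intro sum.cong refl) (simp add: sign_corr_def neg_def sum_negf)
  finally show ?thesis by (simp add: sign_moment_def sum_negf)
qed

lemma sign_moment_even_nonneg: "even m \<Longrightarrow> sign_moment J m \<ge> 0"
  unfolding sign_moment_def by (simp add: sum_nonneg zero_le_even_power)

text \<open>
  The exponential moments of a sum of random signs are products of hyperbolic cosines and hence
  sub-Gaussian. Bounding \<open>t\<^sup>2\<^sup>l S\<^sup>2\<^sup>l / (2 l)!\<close> by \<open>cosh (t S)\<close> turns this into a bound on the moment of
  order \<open>2 l\<close>; the choice \<open>t\<^sup>2 = 2 l card J\<close> optimises it.
\<close>

lemma sign_moment_even:
  assumes J: "finite J" "J \<noteq> {}" and l: "l > 0"
  shows "sign_moment J (2 * l) \<le> fact (2 * l) * (exp 1 / (2 * real (card J) * real l)) ^ l"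
proof -
  define d where "d = real (card J)"
  have d: "d > 0" using J by (simp add: d_def card_gt_0_iff)
  \<comment> \<open>The minimiser of \<open>exp (t\<^sup>2 / (2 d)) / t\<^sup>2\<^sup>l\<close>.\<close>
  define t where "t = sqrt (2 * d * real l)"
  have t2: "t\<^sup>2 = 2 * d * real l" using d by (simp add: t_def)
  have t: "t > 0" using d l by (simp add: t_def)
  have one: "(\<Sum>\<epsilon>\<in>signs J. sign_corr J \<epsilon> \<delta> ^ (2 * l)) \<le> 2 ^ card J * (fact (2 * l) * (exp 1 / (2 * d * real l)) ^ l)"
    if \<delta>: "\<delta> \<in> signs J" for \<delta>
  proof -
    have "(\<Sum>\<epsilon>\<in>signs J. sign_corr J \<epsilon> \<delta> ^ (2 * l)) * (t ^ (2 * l) / fact (2 * l)) =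
        (\<Sum>\<epsilon>\<in>signs J. (t * sign_corr J \<epsilon> \<delta>) ^ (2 * l) / fact (2 * l))"
      unfolding sum_distrib_right power_mult_distrib by (intro sum.cong refl) simp
    also have "\<dots> \<le> (\<Sum>\<epsilon>\<in>signs J. cosh (t * sign_corr J \<epsilon> \<delta>))"
      by (intro sum_mono even_term_le_cosh)
    also have "\<dots> = ((\<Sum>\<epsilon>\<in>signs J. exp (t * sign_corr J \<epsilon> \<delta>)) + (\<Sum>\<epsilon>\<in>signs J. exp ((- t) * sign_corr J \<epsilon> \<delta>))) / 2"
      by (simp add: cosh_def sum.distrib[symmetric] sum_divide_distrib)
    also have "\<dots> = (2 * cosh (t / d)) ^ card J"
      unfolding sum_exp_sign_corr[OF J(1) \<delta>] by (simp add: d_def)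
    also have "\<dots> = 2 ^ card J * cosh (t / d) ^ card J" by (simp add: power_mult_distrib)
    also have "\<dots> \<le> 2 ^ card J * exp ((t / d)\<^sup>2 / 2) ^ card J"
      by (intro mult_left_mono power_mono cosh_le_exp_half_square) (auto simp: cosh_real_nonneg)
    also have "exp ((t / d)\<^sup>2 / 2) ^ card J = exp (d * ((t / d)\<^sup>2 / 2))"
      by (simp only: exp_of_nat_mult d_def)
    also have "d * ((t / d)\<^sup>2 / 2) = real l"
      unfolding power_divide t2 using d by (simp add: field_simps power2_eq_square)
    also have "exp (real l) = exp 1 ^ l" by (simp add: exp_of_nat_mult[symmetric])
    finally have "(\<Sum>\<epsilon>\<in>signs J. sign_corr J \<epsilon> \<delta> ^ (2 * l)) \<le> 2 ^ card J * exp 1 ^ l * fact (2 * l) / t ^ (2 * l)"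
      using t by (simp add: field_simps)
    also have "t ^ (2 * l) = (2 * d * real l) ^ l" by (simp add: power_mult t2)
    finally show ?thesis by (simp add: power_divide mult_ac)
  qed
  have "(\<Sum>\<epsilon>\<in>signs J. \<Sum>\<delta>\<in>signs J. sign_corr J \<epsilon> \<delta> ^ (2 * l)) =
      (\<Sum>\<delta>\<in>signs J. \<Sum>\<epsilon>\<in>signs J. sign_corr J \<epsilon> \<delta> ^ (2 * l))" by (rule sum.swap)
  also have "\<dots> \<le> (\<Sum>\<delta>\<in>signs J. 2 ^ card J * (fact (2 * l) * (exp 1 / (2 * d * real l)) ^ l))"
    by (intro sum_mono one)
  also have "\<dots> = 4 ^ card J * (fact (2 * l) * (exp 1 / (2 * d * real l)) ^ l)"
  proof -
    have "(4::real) ^ card J = 2 ^ card J * 2 ^ card J" by (simp add: power_mult_distrib[symmetric])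
    then show ?thesis using J by (simp add: card_signs mult_ac)
  qed
  finally show ?thesis
    unfolding sign_moment_def d_def by (simp add: field_simps)
qed

lemma sum_triple_factor:
  fixes F :: "'a \<Rightarrow> real"
  shows "(\<Sum>z\<in>X \<times> E \<times> E'. F (fst z) * G (fst (snd z)) * H (snd (snd z))) = sum F X * sum G E * sum H E'"
proof -
  have "(\<Sum>z\<in>X \<times> E \<times> E'. F (fst z) * G (fst (snd z)) * H (snd (snd z))) =
      (\<Sum>x\<in>X. \<Sum>e\<in>E. \<Sum>e'\<in>E'. F x * G e * H e')"
    by (simp add: sum.cartesian_product case_prod_unfold)
  also have "\<dots> = (\<Sum>x\<in>X. \<Sum>e\<in>E. F x * G e * sum H E')" unfolding sum_distrib_left ..
  also have "\<dots> = (\<Sum>x\<in>X. F x * sum G E * sum H E')"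
  proof (intro sum.cong refl)
    fix x
    have "(\<Sum>e\<in>E. F x * G e * S) = F x * sum G E * S" for S
      unfolding sum_distrib_right[symmetric] sum_distrib_left[symmetric] ..
    then show "(\<Sum>e\<in>E. F x * G e * sum H E') = F x * sum G E * sum H E'" .
  qed
  finally show ?thesis unfolding sum_distrib_right .
qed

text \<open>
  The double sum is the squared \<open>L\<^sup>2\<close> norm, relative to the noise distribution, of the signed mixture
  of Gaussian distributions with weights \<open>w\<close> on the singular value and random signs for the singular vectors.
  Expanding the exponential makes every term a product of a squared moment of \<open>w\<close> and two moments of
  random sign sums. The odd terms vanish by symmetry and the even ones of order at most \<open>2 k\<close> by assumption
  on \<open>w\<close>. In the term of order \<open>2 l\<close> the sign moments contribute \<open>((2 l)!)\<^sup>2\<close> against the \<open>(2 l)!\<close> of the series;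
  the remaining \<open>(2 l)! \<le> (2 l)\<^sup>2\<^sup>l\<close> cancels the powers of \<open>l\<close> in the denominators.
\<close>

lemma exp_overlap_bound:
  fixes w :: "real \<Rightarrow> real" and X :: "real set" and J :: "'j set" and J' :: "'k set"
  defines "A \<equiv> X \<times> signs J \<times> signs J'"
  defines "c \<equiv> \<lambda>a. w (fst a) / (2 ^ card J * 2 ^ card J')"
  assumes J: "finite J" "J \<noteq> {}" and J': "finite J'" "J' \<noteq> {}"
    and X: "finite X" "X \<subseteq> {0..r}" and w: "(\<Sum>x\<in>X. \<bar>w x\<bar>) = 2"
    and orth: "\<And>m. m \<le> k \<Longrightarrow> (\<Sum>x\<in>X. w x * x ^ (2 * m)) = 0"
    and r: "r ^ 4 * (exp 1)\<^sup>2 \<le> \<rho> * (real (card J) * real (card J'))" and \<rho>: "\<rho> < 1"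
  shows "(\<Sum>a\<in>A. \<Sum>b\<in>A. c a * c b * exp (fst a * fst b *
       (sign_corr J (fst (snd a)) (fst (snd b)) * sign_corr J' (snd (snd a)) (snd (snd b)))))
     \<le> 4 * \<rho> ^ Suc k / (1 - \<rho>)" (is "?Q \<le> _")
proof -
  define D D' where "D = real (card J)" and "D' = real (card J')"
  have D: "D > 0" "D' > 0" using J J' by (auto simp: D_def D'_def card_gt_0_iff)
  have r0: "r \<ge> 0 \<or> X = {}" using X by force
  then have r0: "r \<ge> 0" using w by auto
  have \<rho>0: "\<rho> \<ge> 0"
  proof -
    have "0 \<le> r ^ 4 * (exp 1)\<^sup>2" by simp
    then have "0 \<le> \<rho> * (D * D')" using r unfolding D_def D'_def by linarith
    moreover have "D * D' > 0" using D by simp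
    ultimately show ?thesis by (simp add: zero_le_mult_iff)
  qed
  let ?h = "\<lambda>a b. fst a * fst b *
       (sign_corr J (fst (snd a)) (fst (snd b)) * sign_corr J' (snd (snd a)) (snd (snd b)))"
  define M where "M m = (\<Sum>x\<in>X. w x * x ^ m)" for m
  define T where "T m = (M m)\<^sup>2 / fact m * (sign_moment J m * sign_moment J' m)" for m
  have T: "(\<Sum>a\<in>A. \<Sum>b\<in>A. c a * c b * (?h a b ^ m /\<^sub>R fact m)) = T m" for m
  proof -
    let ?P = "(2::real) ^ card J * 2 ^ card J'"
    have in1: "(\<Sum>b\<in>A. c a * c b * (?h a b ^ m /\<^sub>R fact m)) =
       (w (fst a) * fst a ^ m / (?P * ?P * fact m) * M m) *
       (\<Sum>\<delta>\<in>signs J. sign_corr J (fst (snd a)) \<delta> ^ m) * (\<Sum>\<delta>'\<in>signs J'. sign_corr J' (snd (snd a)) \<delta>' ^ m)" for a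
    proof -
      let ?q = "w (fst a) * fst a ^ m / (?P * ?P * fact m)"
      have "(\<Sum>b\<in>A. c a * c b * (?h a b ^ m /\<^sub>R fact m)) =
        (\<Sum>b\<in>A. (?q * (w (fst b) * fst b ^ m)) * sign_corr J (fst (snd a)) (fst (snd b)) ^ m * sign_corr J' (snd (snd a)) (snd (snd b)) ^ m)"
        by (intro sum.cong refl) (simp add: c_def power_mult_distrib divide_inverse)
      also have "\<dots> = (\<Sum>x\<in>X. ?q * (w x * x ^ m)) *
       (\<Sum>\<delta>\<in>signs J. sign_corr J (fst (snd a)) \<delta> ^ m) * (\<Sum>\<delta>'\<in>signs J'. sign_corr J' (snd (snd a)) \<delta>' ^ m)"
        unfolding A_def by (rule sum_triple_factor)
      finally show ?thesis unfolding M_def sum_distrib_left[of ?q] .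
    qed
    have "(\<Sum>a\<in>A. \<Sum>b\<in>A. c a * c b * (?h a b ^ m /\<^sub>R fact m)) =
       (\<Sum>x\<in>X. w x * x ^ m / (?P * ?P * fact m) * M m) * (\<Sum>\<epsilon>\<in>signs J. \<Sum>\<delta>\<in>signs J. sign_corr J \<epsilon> \<delta> ^ m) *
         (\<Sum>\<epsilon>\<in>signs J'. \<Sum>\<delta>\<in>signs J'. sign_corr J' \<epsilon> \<delta> ^ m)"
      unfolding in1 unfolding A_def by (rule sum_triple_factor)
    also have "(\<Sum>x\<in>X. w x * x ^ m / (?P * ?P * fact m) * M m) = (M m)\<^sup>2 / (?P * ?P * fact m)"
      by (simp add: M_def sum_divide_distrib[symmetric] sum_distrib_right[symmetric] power2_eq_square)
    also have "?P * ?P = 4 ^ card J * 4 ^ card J'"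
    proof -
      have "(4::real) ^ n = 2 ^ n * 2 ^ n" for n by (simp add: power_mult_distrib[symmetric])
      then show ?thesis by simp
    qed
    finally have fin: "(\<Sum>a\<in>A. \<Sum>b\<in>A. c a * c b * (?h a b ^ m /\<^sub>R fact m)) = (M m)\<^sup>2 / (4 ^ card J * 4 ^ card J' * fact m) *
        (\<Sum>\<epsilon>\<in>signs J. \<Sum>\<delta>\<in>signs J. sign_corr J \<epsilon> \<delta> ^ m) * (\<Sum>\<epsilon>\<in>signs J'. \<Sum>\<delta>\<in>signs J'. sign_corr J' \<epsilon> \<delta> ^ m)" .
    show ?thesis unfolding fin T_def sign_moment_def by (simp only: times_divide_eq_left times_divide_eq_right divide_divide_eq_left mult_ac)
  qed
  have sums: "T sums ?Q"
  proof -
    have "(\<lambda>m. \<Sum>a\<in>A. \<Sum>b\<in>A. c a * c b * (?h a b ^ m /\<^sub>R fact m)) sums ?Q"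
      by (intro sums_sum sums_mult exp_converges)
    then show ?thesis unfolding T .
  qed
  have odd: "T m = 0" if "odd m" for m
    unfolding T_def sign_moment_odd[OF that] by simp
  have "(\<lambda>l. T (2 * l)) sums ?Q"
  proof -
    have "T n = 0" if "n \<notin> range (\<lambda>l::nat. 2 * l)" for n
      using odd[of n] that by (metis evenE rangeI)
    moreover have "strict_mono (\<lambda>l::nat. 2 * l)" by (simp add: strict_mono_def)
    ultimately show ?thesis using sums sums_mono_reindex[of "\<lambda>l. 2 * l" T] by blast
  qed
  moreover have low: "T (2 * l) = 0" if "l < Suc k" for l
  proof -
    have "M (2 * l) = 0" unfolding M_def using orth[of l] that by simp
    then show ?thesis unfolding T_def by simp
  qed
  ultimately have sums2: "(\<lambda>l. T (2 * (l + Suc k))) sums ?Q"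
    unfolding sums_iff_shift[of "\<lambda>l. T (2 * l)" "Suc k" ?Q] by (simp add: low)
  have bound: "T (2 * l) \<le> 4 * \<rho> ^ l" if l: "l > 0" for l
  proof -
    have "\<bar>M (2 * l)\<bar> \<le> (\<Sum>x\<in>X. \<bar>w x\<bar> * r ^ (2 * l))"
      unfolding M_def
    proof (intro order_trans[OF sum_abs] sum_mono)
      fix x assume "x \<in> X"
      then have "0 \<le> x" "x \<le> r" using X by auto
      then show "\<bar>w x * x ^ (2 * l)\<bar> \<le> \<bar>w x\<bar> * r ^ (2 * l)"
        by (auto simp: abs_mult intro!: mult_left_mono power_mono)
    qed
    also have "\<dots> = 2 * r ^ (2 * l)" by (simp add: sum_distrib_right[symmetric] w)
    finally have "\<bar>M (2 * l)\<bar>\<^sup>2 \<le> (2 * r ^ (2 * l))\<^sup>2" by (intro power_mono) auto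
    then have M: "(M (2 * l))\<^sup>2 \<le> 4 * (r ^ 4) ^ l"
      by (simp add: power_mult_distrib power_mult[symmetric] mult.commute)
    have mJ: "sign_moment J (2 * l) \<le> fact (2 * l) * (exp 1 / (2 * D * real l)) ^ l"
      and mJ': "sign_moment J' (2 * l) \<le> fact (2 * l) * (exp 1 / (2 * D' * real l)) ^ l"
      using sign_moment_even[OF J l] sign_moment_even[OF J' l] by (auto simp: D_def D'_def)
    have "T (2 * l) \<le> (4 * (r ^ 4) ^ l) / fact (2 * l) *
        ((fact (2 * l) * (exp 1 / (2 * D * real l)) ^ l) * (fact (2 * l) * (exp 1 / (2 * D' * real l)) ^ l))"
      unfolding T_def using M mJ mJ' D r0
      by (intro mult_mono divide_right_mono mult_nonneg_nonneg sign_moment_even_nonneg) auto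
    also have "\<dots> = 4 * (fact (2 * l) * (r ^ 4 * (exp 1)\<^sup>2 / (4 * (D * D') * (real l)\<^sup>2)) ^ l)"
      using D by (simp add: power_mult_distrib[symmetric] power2_eq_square power_divide mult_ac)
    also have "\<dots> \<le> 4 * (real (2 * l) ^ (2 * l) * (\<rho> / (2 * real l)\<^sup>2) ^ l)"
    proof -
      have "fact (2 * l) \<le> (real (2 * l)) ^ (2 * l)"
        using fact_le_power[of "2 * l", where 'a = real] by simp
      moreover have "r ^ 4 * (exp 1)\<^sup>2 / (4 * (D * D') * (real l)\<^sup>2) \<le> \<rho> * (D * D') / (4 * (D * D') * (real l)\<^sup>2)"
        using r D by (intro divide_right_mono) (auto simp: D_def D'_def)
      moreover have "\<rho> * (D * D') / (4 * (D * D') * (real l)\<^sup>2) = \<rho> / (2 * real l)\<^sup>2"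
        using D by (simp add: power2_eq_square)
      ultimately show ?thesis
        using D r0 by (intro mult_left_mono mult_mono power_mono) auto
    qed
    also have "\<dots> = 4 * \<rho> ^ l"
    proof -
      have e: "real (2 * l) ^ (2 * l) = ((2 * real l)\<^sup>2) ^ l" by (simp add: power_mult)
      have c: "y ^ l * (\<rho> / y) ^ l = \<rho> ^ l" if "y > 0" for y
        using that unfolding power_mult_distrib[symmetric] by simp
      have "(2 * real l)\<^sup>2 > 0" using l by simp
      then show ?thesis unfolding e by (simp only: c)
    qed
    finally show ?thesis .
  qed
  have geo: "(\<lambda>l. 4 * \<rho> ^ (l + Suc k)) sums (4 * (\<rho> ^ Suc k * (1 / (1 - \<rho>))))"
    using \<rho> \<rho>0 unfolding power_add by (subst mult.commute[of "_ ^ _" "\<rho> ^ Suc k"]) (intro sums_mult geometric_sums, auto)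
  have "?Q \<le> 4 * (\<rho> ^ Suc k * (1 / (1 - \<rho>)))"
    by (rule sums_le[OF _ sums2 geo]) (rule bound, simp)
  then show ?thesis by simp
qed

section \<open>Exchanging the factors of a product prior one at a time\<close>

text \<open>
  The expectation of \<open>B\<close> when the first \<open>n\<close> coordinates are independent with mass function \<open>\<nu>\<close> on
  \<open>X\<close> and the others are those of \<open>s\<close>. The recursion integrates the last coordinate first, which is
  the form that an induction exchanging one coordinate at a time consumes.
\<close>

fun prod_expect :: "real set \<Rightarrow> (real \<Rightarrow> real) \<Rightarrow> nat \<Rightarrow> ((nat \<Rightarrow> real) \<Rightarrow> real) \<Rightarrow> (nat \<Rightarrow> real) \<Rightarrow> real" where
  "prod_expect X \<nu> 0 B s = B s"
| "prod_expect X \<nu> (Suc n) B s = prod_expect X \<nu> n (\<lambda>s. \<Sum>x\<in>X. \<nu> x * B (s(n := x))) s"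

lemma prod_expect_mono:
  assumes \<nu>: "\<And>x. x \<in> X \<Longrightarrow> \<nu> x \<ge> 0"
    and le: "\<And>s. \<forall>j<N. s j \<in> X \<Longrightarrow> B s \<le> B' s" and s: "\<forall>j<N. s j \<in> X"
  shows "prod_expect X \<nu> n B s \<le> prod_expect X \<nu> n B' s"
  using le
proof (induction n arbitrary: B B')
  case (Suc n)
  show ?case unfolding prod_expect.simps
    by (intro Suc.IH sum_mono mult_left_mono \<nu> Suc.prems) auto
qed (use s in simp)

lemma prod_expect_add_const:
  assumes "(\<Sum>x\<in>X. \<nu> x) = 1"
  shows "prod_expect X \<nu> n (\<lambda>s. B s + \<kappa>) s = prod_expect X \<nu> n B s + \<kappa>"
proof (induction n arbitrary: B)
  case (Suc n)
  have "(\<Sum>x\<in>X. \<nu> x * (B (s(n := x)) + \<kappa>)) = (\<Sum>x\<in>X. \<nu> x * B (s(n := x))) + \<kappa>" for s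
    using assms by (simp add: distrib_left sum.distrib sum_distrib_right[symmetric])
  then show ?case using Suc.IH by simp
qed simp

lemma prod_expect_const: 
  assumes "(\<Sum>x\<in>X. \<nu> x) = 1" shows "prod_expect X \<nu> n (\<lambda>s. \<kappa>) s = \<kappa>"
  by (induction n) (use assms in \<open>simp_all add: sum_distrib_right[symmetric]\<close>)

text \<open>
  By induction the first \<open>n\<close> coordinates are exchanged for the function already averaged over the last one,
  which inherits the gap condition; then the last coordinate is exchanged.
\<close>

lemma prod_expect_diff:
  assumes \<nu>: "\<And>x. x \<in> X \<Longrightarrow> \<nu> x \<ge> 0" "\<And>x. x \<in> X \<Longrightarrow> \<mu> x \<ge> 0" "(\<Sum>x\<in>X. \<nu> x) = 1" "(\<Sum>x\<in>X. \<mu> x) = 1"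
    and gap: "\<And>i s. i < n \<Longrightarrow> \<forall>j<N. s j \<in> X \<Longrightarrow> (\<Sum>x\<in>X. (\<nu> x - \<mu> x) * B (s(i := x))) \<ge> \<kappa>"
    and s: "\<forall>j<N. s j \<in> X" and n: "n \<le> N"
  shows "prod_expect X \<nu> n B s - prod_expect X \<mu> n B s \<ge> real n * \<kappa>"
  using gap n
proof (induction n arbitrary: B)
  case (Suc n)
  define B1 where "B1 s = (\<Sum>x\<in>X. \<nu> x * B (s(n := x)))" for s
  define B0 where "B0 s = (\<Sum>x\<in>X. \<mu> x * B (s(n := x)))" for s
  have "prod_expect X \<nu> n B1 s - prod_expect X \<mu> n B1 s \<ge> real n * \<kappa>"
  proof (rule Suc.IH)
    fix i s assume i: "i < n" and s: "\<forall>j<N. s j \<in> X"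
    have "(\<Sum>x\<in>X. (\<nu> x - \<mu> x) * B1 (s(i := x))) = (\<Sum>y\<in>X. \<nu> y * (\<Sum>x\<in>X. (\<nu> x - \<mu> x) * B ((s(n := y))(i := x))))"
      unfolding B1_def sum_distrib_left using i
      by (subst sum.swap) (simp add: mult_ac fun_upd_twist[of n i])
    also have "\<dots> \<ge> (\<Sum>y\<in>X. \<nu> y * \<kappa>)"
      using i s Suc.prems(2) by (intro sum_mono mult_left_mono Suc.prems(1) \<nu>) auto
    finally show "(\<Sum>x\<in>X. (\<nu> x - \<mu> x) * B1 (s(i := x))) \<ge> \<kappa>"
      using \<nu>(3) by (simp add: sum_distrib_right[symmetric])
  qed (use Suc.prems in simp)
  moreover have "prod_expect X \<mu> n (\<lambda>s. B0 s + \<kappa>) s \<le> prod_expect X \<mu> n B1 s"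
  proof (rule prod_expect_mono[where N = N])
    fix s assume "\<forall>j<N. s j \<in> X"
    from Suc.prems(1)[OF lessI this] show "B0 s + \<kappa> \<le> B1 s"
      unfolding B0_def B1_def left_diff_distrib sum_subtractf by linarith
  qed (use \<nu> s in auto)
  moreover have "prod_expect X \<mu> n (\<lambda>s. B0 s + \<kappa>) s = prod_expect X \<mu> n B0 s + \<kappa>"
    by (rule prod_expect_add_const) (rule \<nu>(4))
  moreover have "real (Suc n) * \<kappa> = real n * \<kappa> + \<kappa>" by (simp add: distrib_right)
  ultimately show ?case
    unfolding prod_expect.simps B1_def[symmetric] B0_def[symmetric] by linarith
qed simp

text \<open>
  The positive and negative parts of \<open>w\<close> are probability weights. If \<open>B\<close> is constant up to \<open>R\<close>, its
  averages under the two product measures differ by at most \<open>2 R\<close>, whereas by \<open>prod_expect_diff\<close> they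
  differ by at least \<open>n \<kappa>\<close>.
\<close>

lemma hybrid_gap:
  fixes w :: "real \<Rightarrow> real"
  assumes X: "finite X" and w: "(\<Sum>x\<in>X. \<bar>w x\<bar>) = 2" "(\<Sum>x\<in>X. w x) = 0"
    and gap: "\<And>i s. i < n \<Longrightarrow> \<forall>j<n. s j \<in> X \<Longrightarrow> (\<Sum>x\<in>X. w x * B (s(i := x))) \<ge> \<kappa>"
    and R: "\<And>s. \<forall>j<n. s j \<in> X \<Longrightarrow> \<bar>B s - C\<bar> \<le> R"
  shows "real n * \<kappa> \<le> 2 * R"
proof -
  define \<nu> where "\<nu> x = max (w x) 0" for x
  define \<mu> where "\<mu> x = max (- w x) 0" for x
  have d: "\<nu> x - \<mu> x = w x" "\<nu> x + \<mu> x = \<bar>w x\<bar>" for x by (auto simp: \<nu>_def \<mu>_def)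
  have "sum \<nu> X - sum \<mu> X = 0" "sum \<nu> X + sum \<mu> X = 2"
    using w by (simp_all add: sum_subtractf[symmetric] sum.distrib[symmetric] d)
  then have s1: "sum \<nu> X = 1" "sum \<mu> X = 1" by auto
  have nn: "\<nu> x \<ge> 0" "\<mu> x \<ge> 0" for x by (auto simp: \<nu>_def \<mu>_def)
  have "X \<noteq> {}" using w(1) by auto
  then obtain x0 where "x0 \<in> X" by blast
  then have s: "\<forall>j<n. (\<lambda>_. x0) j \<in> X" by simp
  have "real n * \<kappa> \<le> prod_expect X \<nu> n B (\<lambda>_. x0) - prod_expect X \<mu> n B (\<lambda>_. x0)"
    using gap by (intro prod_expect_diff[OF nn s1, where N = n] s) (auto simp: d)
  moreover have "prod_expect X \<nu> n B (\<lambda>_. x0) \<le> prod_expect X \<nu> n (\<lambda>_. C + R) (\<lambda>_. x0)"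
    using R by (intro prod_expect_mono[where N = n] nn s) (fastforce simp: abs_le_iff)
  moreover have "prod_expect X \<mu> n B (\<lambda>_. x0) \<ge> prod_expect X \<mu> n (\<lambda>_. C - R) (\<lambda>_. x0)"
    using R by (intro prod_expect_mono[where N = n] nn s) (fastforce simp: abs_le_iff)
  ultimately show ?thesis by (simp add: prod_expect_const s1)
qed

section \<open>Rotation invariance of Gaussian vectors\<close>

abbreviation std_normal :: "real measure" where
  "std_normal \<equiv> density lborel (\<lambda>x. ennreal (std_normal_density x))"

lemma nn_integral_affine_subst:
  fixes f :: "real \<Rightarrow> ennreal"
  assumes [measurable]: "f \<in> borel_measurable borel" and c: "c \<noteq> 0"
  shows "(\<integral>\<^sup>+x. f (t + c * x) \<partial>lborel) = ennreal (1 / \<bar>c\<bar>) * (\<integral>\<^sup>+x. f x \<partial>lborel)"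
proof -
  have "ennreal (1 / \<bar>c\<bar>) * (\<integral>\<^sup>+x. f x \<partial>lborel) = ennreal (1 / \<bar>c\<bar>) * (ennreal \<bar>c\<bar> * (\<integral>\<^sup>+x. f (t + c * x) \<partial>lborel))"
    using nn_integral_real_affine[OF assms, of t] by simp
  also have "\<dots> = (ennreal (1 / \<bar>c\<bar>) * ennreal \<bar>c\<bar>) * (\<integral>\<^sup>+x. f (t + c * x) \<partial>lborel)"
    by (simp only: mult.assoc)
  also have "ennreal (1 / \<bar>c\<bar>) * ennreal \<bar>c\<bar> = 1"
    using c by (subst ennreal_mult[symmetric]) auto
  finally show ?thesis by simp
qed

lemma lborel_swap:
  fixes f :: "real \<Rightarrow> real \<Rightarrow> ennreal"
  assumes [measurable]: "case_prod f \<in> borel_measurable (borel \<Otimes>\<^sub>M borel)"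
  shows "(\<integral>\<^sup>+y. \<integral>\<^sup>+x. f x y \<partial>lborel \<partial>lborel) = (\<integral>\<^sup>+x. \<integral>\<^sup>+y. f x y \<partial>lborel \<partial>lborel)"
proof -
  have "case_prod f \<in> borel_measurable (lborel \<Otimes>\<^sub>M lborel)" by measurable
  from lborel_pair.Fubini'[OF this] show ?thesis by simp
qed

text \<open>
  For \<open>c \<noteq> 0\<close> a rotation factors into two one-dimensional affine substitutions, one in each variable,
  with Jacobians \<open>c\<close> and \<open>1 / c\<close>. A quarter turn is an exchange of the variables up to a sign.
\<close>

lemma lborel_rotate:
  fixes f :: "real \<Rightarrow> real \<Rightarrow> ennreal"
  assumes f[measurable]: "case_prod f \<in> borel_measurable (borel \<Otimes>\<^sub>M borel)" and cs: "c\<^sup>2 + s\<^sup>2 = 1"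
  shows "(\<integral>\<^sup>+y. \<integral>\<^sup>+x. f (c * x + s * y) (- s * x + c * y) \<partial>lborel \<partial>lborel) = (\<integral>\<^sup>+y. \<integral>\<^sup>+x. f x y \<partial>lborel \<partial>lborel)"
proof (cases "c = 0")
  case False
  define g where "g t y = f t (- (s / c) * t + (1 / c) * y)" for t y
  have g[measurable]: "case_prod g \<in> borel_measurable (borel \<Otimes>\<^sub>M borel)" unfolding g_def by measurable
  have 1: "f (c * x + s * y) (- s * x + c * y) = g (s * y + c * x) y" for x y
  proof -
    have "c * c + s * s = 1" using cs by (simp add: power2_eq_square)
    then have e: "c * y = - (s / c) * (s * y) + (1 / c) * y"
      using False by (simp add: field_simps) (metis distrib_right add.commute mult_1 mult.assoc mult.commute)
    have "- s * x + c * y = - (s / c) * (s * y + c * x) + (1 / c) * y"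
      unfolding e using False by (simp add: field_simps)
    then show ?thesis unfolding g_def by (simp add: add.commute)
  qed
  have "(\<integral>\<^sup>+y. \<integral>\<^sup>+x. f (c * x + s * y) (- s * x + c * y) \<partial>lborel \<partial>lborel)
      = (\<integral>\<^sup>+y. ennreal (1 / \<bar>c\<bar>) * (\<integral>\<^sup>+x. g x y \<partial>lborel) \<partial>lborel)"
    unfolding 1 using False by (intro nn_integral_cong nn_integral_affine_subst) measurable
  also have "\<dots> = ennreal (1 / \<bar>c\<bar>) * (\<integral>\<^sup>+y. \<integral>\<^sup>+x. g x y \<partial>lborel \<partial>lborel)"
    by (rule nn_integral_cmult) measurable
  also have "\<dots> = ennreal (1 / \<bar>c\<bar>) * (\<integral>\<^sup>+x. \<integral>\<^sup>+y. g x y \<partial>lborel \<partial>lborel)"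
    by (simp only: lborel_swap[OF g])
  also have "(\<integral>\<^sup>+x. \<integral>\<^sup>+y. g x y \<partial>lborel \<partial>lborel) = (\<integral>\<^sup>+x. ennreal \<bar>c\<bar> * (\<integral>\<^sup>+y. f x y \<partial>lborel) \<partial>lborel)"
    unfolding g_def
    by (intro nn_integral_cong, subst nn_integral_affine_subst) (use False in auto)
  also have "\<dots> = ennreal \<bar>c\<bar> * (\<integral>\<^sup>+x. \<integral>\<^sup>+y. f x y \<partial>lborel \<partial>lborel)"
    by (rule nn_integral_cmult) measurable
  also have "ennreal (1 / \<bar>c\<bar>) * \<dots> = (ennreal (1 / \<bar>c\<bar>) * ennreal \<bar>c\<bar>) * (\<integral>\<^sup>+x. \<integral>\<^sup>+y. f x y \<partial>lborel \<partial>lborel)"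
    by (simp only: mult.assoc)
  also have "ennreal (1 / \<bar>c\<bar>) * ennreal \<bar>c\<bar> = 1"
    using False by (subst ennreal_mult[symmetric]) auto
  finally show ?thesis by (simp only: lborel_swap[OF f] mult_1)
next
  case True
  then have s: "s \<noteq> 0" "\<bar>s\<bar> = 1" using cs by (auto simp: power2_eq_1_iff)
  have aff: "(\<integral>\<^sup>+x. h (s * x) \<partial>lborel) = (\<integral>\<^sup>+x. h x \<partial>lborel)"
    "(\<integral>\<^sup>+x. h (- s * x) \<partial>lborel) = (\<integral>\<^sup>+x. h x \<partial>lborel)"
    if [measurable]: "h \<in> borel_measurable borel" for h :: "real \<Rightarrow> ennreal"
    using nn_integral_affine_subst[of h s 0] nn_integral_affine_subst[of h "- s" 0] s by auto
  have "(\<integral>\<^sup>+y. \<integral>\<^sup>+x. f (c * x + s * y) (- s * x + c * y) \<partial>lborel \<partial>lborel) =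
     (\<integral>\<^sup>+y. \<integral>\<^sup>+x. f (s * y) x \<partial>lborel \<partial>lborel)"
  proof (rule nn_integral_cong)
    fix y
    have "(\<integral>\<^sup>+x. f (s * y) (- s * x) \<partial>lborel) = (\<integral>\<^sup>+x. f (s * y) x \<partial>lborel)"
      by (rule aff(2)) measurable
    then show "(\<integral>\<^sup>+x. f (c * x + s * y) (- s * x + c * y) \<partial>lborel) = (\<integral>\<^sup>+x. f (s * y) x \<partial>lborel)"
      using True by simp
  qed
  also have "\<dots> = (\<integral>\<^sup>+y. \<integral>\<^sup>+x. f y x \<partial>lborel \<partial>lborel)"
    by (rule aff(1)) measurable
  finally show ?thesis using lborel_swap[OF f] by simp
qed

lemma std_normal_rotate:
  fixes f :: "real \<Rightarrow> real \<Rightarrow> ennreal"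
  assumes f[measurable]: "case_prod f \<in> borel_measurable (borel \<Otimes>\<^sub>M borel)" and cs: "c\<^sup>2 + s\<^sup>2 = 1"
  shows "(\<integral>\<^sup>+y. \<integral>\<^sup>+x. f (c * x + s * y) (- s * x + c * y) \<partial>std_normal \<partial>std_normal) = (\<integral>\<^sup>+y. \<integral>\<^sup>+x. f x y \<partial>std_normal \<partial>std_normal)"
proof -
  have w: "(\<integral>\<^sup>+y. \<integral>\<^sup>+x. h x y \<partial>std_normal \<partial>std_normal) =
     (\<integral>\<^sup>+y. \<integral>\<^sup>+x. ennreal (std_normal_density x * std_normal_density y) * h x y \<partial>lborel \<partial>lborel)"
    if [measurable]: "case_prod h \<in> borel_measurable (borel \<Otimes>\<^sub>M borel)" for h :: "real \<Rightarrow> real \<Rightarrow> ennreal"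
  proof -
    have "(\<integral>\<^sup>+y. \<integral>\<^sup>+x. h x y \<partial>std_normal \<partial>std_normal) =
       (\<integral>\<^sup>+y. ennreal (std_normal_density y) * (\<integral>\<^sup>+x. ennreal (std_normal_density x) * h x y \<partial>lborel) \<partial>lborel)"
      by (simp add: nn_integral_density)
    also have "\<dots> = (\<integral>\<^sup>+y. \<integral>\<^sup>+x. ennreal (std_normal_density y) * (ennreal (std_normal_density x) * h x y) \<partial>lborel \<partial>lborel)"
      by (intro nn_integral_cong nn_integral_cmult[symmetric]) measurable
    also have "\<dots> = (\<integral>\<^sup>+y. \<integral>\<^sup>+x. ennreal (std_normal_density x * std_normal_density y) * h x y \<partial>lborel \<partial>lborel)"
      by (intro nn_integral_cong) (simp add: ennreal_mult mult.commute mult.left_commute)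
    finally show ?thesis .
  qed
  have d: "std_normal_density x * std_normal_density y =
      std_normal_density (c * x + s * y) * std_normal_density (- s * x + c * y)" for x y
  proof -
    have "(c * x + s * y)\<^sup>2 + (- s * x + c * y)\<^sup>2 = (c\<^sup>2 + s\<^sup>2) * (x\<^sup>2 + y\<^sup>2)"
      by (simp add: power2_eq_square algebra_simps)
    then have "- x\<^sup>2 / 2 + - y\<^sup>2 / 2 = - (c * x + s * y)\<^sup>2 / 2 + - (- s * x + c * y)\<^sup>2 / 2" using cs by simp
    then have "exp (- x\<^sup>2 / 2) * exp (- y\<^sup>2 / 2) = exp (- (c * x + s * y)\<^sup>2 / 2) * exp (- (- s * x + c * y)\<^sup>2 / 2)"
      by (simp only: exp_add[symmetric])
    then show ?thesis unfolding std_normal_density_def by simp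
  qed
  have m: "case_prod (\<lambda>x y. f (c * x + s * y) (- s * x + c * y)) \<in> borel_measurable (borel \<Otimes>\<^sub>M borel)" by measurable
  have "(\<integral>\<^sup>+y. \<integral>\<^sup>+x. ennreal (std_normal_density x * std_normal_density y) * f (c * x + s * y) (- s * x + c * y) \<partial>lborel \<partial>lborel) =
     (\<integral>\<^sup>+y. \<integral>\<^sup>+x. ennreal (std_normal_density (c * x + s * y) * std_normal_density (- s * x + c * y)) *
        f (c * x + s * y) (- s * x + c * y) \<partial>lborel \<partial>lborel)"
    by (intro nn_integral_cong) (subst d, rule refl)
  also have "\<dots> = (\<integral>\<^sup>+y. \<integral>\<^sup>+x. ennreal (std_normal_density x * std_normal_density y) * f x y \<partial>lborel \<partial>lborel)"
    by (rule lborel_rotate[OF _ cs, of "\<lambda>x y. ennreal (std_normal_density x * std_normal_density y) * f x y"]) measurable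
  finally show ?thesis unfolding w[OF f] w[OF m] .
qed

lemma product_sigma_finite_std_normal: "product_sigma_finite (\<lambda>_. std_normal)"
  unfolding product_sigma_finite_def
  by (intro allI prob_space_imp_sigma_finite prob_space_normal_density) simp

lemma indicator_PiE_eq_prod:
  assumes I: "finite I" and x: "x \<in> extensional I"
  shows "indicator (PiE I A) x = (\<Prod>i\<in>I. indicator (A i) (x i) :: ennreal)"
proof (cases "x \<in> PiE I A")
  case True
  then have "(\<Prod>i\<in>I. indicator (A i) (x i) :: ennreal) = 1"
    by (intro prod.neutral) (auto simp: indicator_def dest: PiE_mem)
  then show ?thesis using True by simp
next
  case False
  then obtain i where i: "i \<in> I" "x i \<notin> A i"
    using x by (auto simp: PiE_def Pi_def)
  then have "indicator (A i) (x i) = (0 :: ennreal)" by simp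
  then have "(\<Prod>i\<in>I. indicator (A i) (x i) :: ennreal) = 0" using I i(1) by (intro prod_zero bexI)
  then show ?thesis using False by simp
qed

lemma measurable_PiM_rotate:
  fixes c s :: real
  assumes "a \<in> I" "b \<in> I"
  shows "(\<lambda>x. x(a := c * x a + s * x b, b := - s * x a + c * x b)) \<in> PiM I (\<lambda>_. std_normal) \<rightarrow>\<^sub>M PiM I (\<lambda>_. std_normal)"
  using assms
  by (intro measurable_fun_upd[where J = I] measurable_fun_upd[where J = I] measurable_ident_sets) (auto simp: insert_absorb)

text \<open>
  Rotating two coordinates of a standard Gaussian vector preserves its distribution. On a box
  everything factorises except the two rotated coordinates, which are handled by \<open>std_normal_rotate\<close>.
\<close>

lemma PiM_std_normal_rotate:
  fixes c s :: real
  assumes I: "finite I" and ab: "a \<in> I" "b \<in> I" "a \<noteq> b" and cs: "c\<^sup>2 + s\<^sup>2 = 1"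
  shows "distr (PiM I (\<lambda>_. std_normal)) (PiM I (\<lambda>_. std_normal)) (\<lambda>x. x(a := c * x a + s * x b, b := - s * x a + c * x b))
     = PiM I (\<lambda>_. std_normal)" (is "distr ?M ?M ?R = ?M")
proof (rule product_sigma_finite.PiM_eqI[OF product_sigma_finite_std_normal I])
  interpret product_sigma_finite "\<lambda>_. std_normal" by (rule product_sigma_finite_std_normal)
  define J where "J = I - {a, b}"
  have I_eq: "I = insert a (insert b J)" and J: "finite J" "a \<notin> insert b J" "b \<notin> J"
    using I ab by (auto simp: J_def)
  have R[measurable]: "?R \<in> measurable ?M ?M"
    using ab by (intro measurable_PiM_rotate)
  show "sets (distr ?M ?M ?R) = sets ?M" by simp
  fix A :: "'a \<Rightarrow> real set" assume A: "\<And>i. i \<in> I \<Longrightarrow> A i \<in> sets std_normal"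
  then have A': "\<And>i. i \<in> I \<Longrightarrow> A i \<in> sets borel" by simp
  have [measurable]: "A a \<in> sets borel" "A b \<in> sets borel" using A' ab by auto
  define f where "f x = (\<Prod>i\<in>I. indicator (A i) (x i) :: ennreal)" for x
  define p where "p x = (\<Prod>i\<in>J. indicator (A i) (x i) :: ennreal)" for x
  have f: "f (x(b := y, a := z)) = p x * (indicator (A a) z * indicator (A b) y)" for x y z
  proof -
    have "(\<Prod>i\<in>J. indicator (A i) ((x(b := y, a := z)) i) :: ennreal) = p x"
      unfolding p_def using J by (intro prod.cong) auto
    then show ?thesis unfolding f_def I_eq using J ab by (simp add: mult_ac)
  qed
  have fm[measurable]: "f \<in> borel_measurable ?M"
    unfolding f_def using A' by (intro borel_measurable_prod_ennreal measurable_compose[OF measurable_component_singleton]) auto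
  have pm[measurable]: "p \<in> borel_measurable (PiM J (\<lambda>_. std_normal))"
    unfolding p_def using A' I_eq by (intro borel_measurable_prod_ennreal measurable_compose[OF measurable_component_singleton]) auto
  have ind: "indicator (PiE I A) x = f x" if "x \<in> space ?M" for x
    unfolding f_def using that by (intro indicator_PiE_eq_prod I) (simp add: space_PiM PiE_def)
  have "emeasure (distr ?M ?M ?R) (PiE I A) = (\<integral>\<^sup>+x. indicator (PiE I A) x \<partial>distr ?M ?M ?R)"
    using A I by (subst nn_integral_indicator) (auto intro!: sets_PiM_I_finite)
  also have "\<dots> = (\<integral>\<^sup>+x. f x \<partial>distr ?M ?M ?R)"
    by (intro nn_integral_cong ind) simp
  also have "\<dots> = (\<integral>\<^sup>+x. f (?R x) \<partial>?M)" by (rule nn_integral_distr[OF R]) (simp add: fm)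
  also have "\<dots> = (\<integral>\<^sup>+x. \<integral>\<^sup>+y. \<integral>\<^sup>+z. f (?R (x(b := y, a := z))) \<partial>std_normal \<partial>std_normal \<partial>PiM J (\<lambda>_. std_normal))"
  proof -
    define g where "g = (\<lambda>x. f (?R x))" 
    have g[measurable]: "g \<in> borel_measurable (PiM (insert a (insert b J)) (\<lambda>_. std_normal))"
      unfolding g_def I_eq[symmetric] by (rule measurable_compose[OF R fm])
    have "(\<lambda>(x, z). g (x(a := z))) \<in> borel_measurable (PiM (insert b J) (\<lambda>_. std_normal) \<Otimes>\<^sub>M std_normal)"
      using measurable_compose[OF measurable_add_dim g] by (simp add: case_prod_unfold)
    then have h: "(\<lambda>x. \<integral>\<^sup>+z. g (x(a := z)) \<partial>std_normal) \<in> borel_measurable (PiM (insert b J) (\<lambda>_. std_normal))"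
      by (rule sigma_finite_measure.borel_measurable_nn_integral[OF sigma_finite_measures])
    have "(\<integral>\<^sup>+x. g x \<partial>PiM (insert a (insert b J)) (\<lambda>_. std_normal)) =
        (\<integral>\<^sup>+x. \<integral>\<^sup>+z. g (x(a := z)) \<partial>std_normal \<partial>PiM (insert b J) (\<lambda>_. std_normal))"
      using J by (intro product_nn_integral_insert g) auto
    also have "\<dots> = (\<integral>\<^sup>+x. \<integral>\<^sup>+y. \<integral>\<^sup>+z. g (x(b := y, a := z)) \<partial>std_normal \<partial>std_normal \<partial>PiM J (\<lambda>_. std_normal))"
      using J by (intro product_nn_integral_insert h) auto
    finally show ?thesis unfolding g_def I_eq[symmetric] .
  qed
  also have "\<dots> = (\<integral>\<^sup>+x. p x * (\<integral>\<^sup>+y. \<integral>\<^sup>+z. indicator (A a) (c * z + s * y) * indicator (A b) (- s * z + c * y) \<partial>std_normal \<partial>std_normal) \<partial>PiM J (\<lambda>_. std_normal))"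
  proof (intro nn_integral_cong)
    fix x
    have "?R (x(b := y, a := z)) = x(b := - s * z + c * y, a := c * z + s * y)" for y z
      using ab by auto
    then have "f (?R (x(b := y, a := z))) = p x * (indicator (A a) (c * z + s * y) * indicator (A b) (- s * z + c * y))" for y z
      by (simp only: f)
    then show "(\<integral>\<^sup>+y. \<integral>\<^sup>+z. f (?R (x(b := y, a := z))) \<partial>std_normal \<partial>std_normal) =
      p x * (\<integral>\<^sup>+y. \<integral>\<^sup>+z. indicator (A a) (c * z + s * y) * indicator (A b) (- s * z + c * y) \<partial>std_normal \<partial>std_normal)"
      by (simp add: nn_integral_cmult)
  qed
  also have "(\<integral>\<^sup>+y. \<integral>\<^sup>+z. indicator (A a) (c * z + s * y) * indicator (A b) (- s * z + c * y) \<partial>std_normal \<partial>std_normal)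
     = (\<integral>\<^sup>+y. \<integral>\<^sup>+z. indicator (A a) z * indicator (A b) y \<partial>std_normal \<partial>std_normal)"
    by (rule std_normal_rotate[OF _ cs]) measurable
  also have "\<dots> = emeasure std_normal (A a) * emeasure std_normal (A b)"
    by (simp add: nn_integral_multc nn_integral_cmult)
  also have "(\<integral>\<^sup>+x. p x * (emeasure std_normal (A a) * emeasure std_normal (A b)) \<partial>PiM J (\<lambda>_. std_normal)) =
      (\<integral>\<^sup>+x. p x \<partial>PiM J (\<lambda>_. std_normal)) * (emeasure std_normal (A a) * emeasure std_normal (A b))"
    by (rule nn_integral_multc) measurable
  also have "(\<integral>\<^sup>+x. p x \<partial>PiM J (\<lambda>_. std_normal)) = (\<Prod>i\<in>J. emeasure std_normal (A i))"
    unfolding p_def using J A' I_eq by (subst product_nn_integral_prod) (auto intro!: prod.cong)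
  finally have e: "emeasure (distr ?M ?M ?R) (PiE I A) =
    (\<Prod>i\<in>J. emeasure std_normal (A i)) * (emeasure std_normal (A a) * emeasure std_normal (A b))" .
  have "(\<Prod>i\<in>I. emeasure std_normal (A i)) = emeasure std_normal (A a) * (emeasure std_normal (A b) * (\<Prod>i\<in>J. emeasure std_normal (A i)))"
    using J by (simp add: I_eq)
  then show "emeasure (distr ?M ?M ?R) (PiE I A) = (\<Prod>i\<in>I. emeasure std_normal (A i))"
    unfolding e by (simp only: mult.commute mult.left_commute)
qed

section \<open>A rotation-invariant law on orthogonal matrices\<close>

definition ip :: "nat \<Rightarrow> (nat \<Rightarrow> real) \<Rightarrow> (nat \<Rightarrow> real) \<Rightarrow> real" where
  "ip N x y = (\<Sum>l<N. x l * y l)"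

lemma ip_commute: "ip N x y = ip N y x"
  by (simp add: ip_def mult.commute)

lemma ip_diff_left: "ip N (\<lambda>l. x l - y l) z = ip N x z - ip N y z"
  by (simp add: ip_def left_diff_distrib sum_subtractf)

lemma ip_sum_left: "ip N (\<lambda>l. \<Sum>j\<in>A. t j * x j l) z = (\<Sum>j\<in>A. t j * ip N (x j) z)"
proof -
  have "ip N (\<lambda>l. \<Sum>j\<in>A. t j * x j l) z = (\<Sum>l<N. \<Sum>j\<in>A. t j * (x j l * z l))"
    unfolding ip_def sum_distrib_right by (simp only: mult.assoc)
  also have "\<dots> = (\<Sum>j\<in>A. \<Sum>l<N. t j * (x j l * z l))" by (rule sum.swap)
  finally show ?thesis unfolding ip_def sum_distrib_left .
qed

lemma ip_divide_left: "ip N (\<lambda>l. x l / c) z = ip N x z / c"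
  by (simp add: ip_def sum_divide_distrib)

lemma ip_self_nonneg: "ip N x x \<ge> 0"
  by (simp add: ip_def sum_nonneg)

lemma ip_self_eq_0: "ip N x x = 0 \<Longrightarrow> l < N \<Longrightarrow> x l = 0"
  unfolding ip_def by (subst (asm) sum_nonneg_eq_0_iff) auto

text \<open>
  Row \<open>k\<close> of the Gram-Schmidt orthonormalisation of the rows of \<open>M\<close>. Orthonormalising the rows
  commutes with orthogonal transformations of the columns, and this is what makes the resulting law
  rotation invariant.
\<close>

function ortho_row :: "nat \<Rightarrow> (nat \<times> nat \<Rightarrow> real) \<Rightarrow> nat \<Rightarrow> nat \<Rightarrow> real" where
  "ortho_row N M k =
     (let r = (\<lambda>l. M (k, l) - (\<Sum>j\<in>{..<k}. ip N (\<lambda>m. M (k, m)) (ortho_row N M j) * ortho_row N M j l))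
      in (\<lambda>l. r l / sqrt (ip N r r)))"
  by pat_completeness auto
termination
  by (relation "inv_image less_than (\<lambda>(N, M, k). k)") auto

declare ortho_row.simps [simp del]

definition resid_row :: "nat \<Rightarrow> (nat \<times> nat \<Rightarrow> real) \<Rightarrow> nat \<Rightarrow> nat \<Rightarrow> real" where
  "resid_row N M k = (\<lambda>l. M (k, l) - (\<Sum>j<k. ip N (\<lambda>m. M (k, m)) (ortho_row N M j) * ortho_row N M j l))"

text \<open>
  The Gram-Schmidt process never divides by zero. This event is invariant under rotations of
  the columns, so conditioning on it preserves the invariance.
\<close>

definition nondegenerate :: "nat \<Rightarrow> (nat \<times> nat \<Rightarrow> real) \<Rightarrow> bool" where
  "nondegenerate N M \<longleftrightarrow> (\<forall>k<N. ip N (resid_row N M k) (resid_row N M k) \<noteq> 0)"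

lemma ortho_row_resid: "ortho_row N M k = (\<lambda>l. resid_row N M k l / sqrt (ip N (resid_row N M k) (resid_row N M k)))"
  by (subst ortho_row.simps) (simp add: Let_def resid_row_def)

lemma ortho_row_orthonormal:
  assumes nd: "nondegenerate N M" and "k < N" "j \<le> k"
  shows "ip N (ortho_row N M k) (ortho_row N M j) = (if j = k then 1 else 0)"
  using assms(2,3)
proof (induction k arbitrary: j rule: less_induct)
  case (less k)
  let ?e = "ortho_row N M"
  have nz: "ip N (resid_row N M k) (resid_row N M k) > 0"
    using nd less.prems ip_self_nonneg[of N "resid_row N M k"] unfolding nondegenerate_def by (auto simp: less_le)
  show ?case
  proof (cases "j = k")
    case True
    have "ip N (?e k) (?e k) = ip N (resid_row N M k) (resid_row N M k) / (sqrt (ip N (resid_row N M k) (resid_row N M k)))\<^sup>2"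
      unfolding ortho_row_resid[of N M k]
      by (simp add: ip_divide_left ip_commute[of N "resid_row N M k" "\<lambda>l. resid_row N M k l / _"] power2_eq_square)
    then show ?thesis using True nz by simp
  next
    case False
    then have j: "j < k" using less.prems by simp
    have ee: "ip N (?e i) (?e j) = (if i = j then 1 else 0)" if "i < k" for i
    proof (cases "j \<le> i")
      case True then show ?thesis using less.IH[of i j] that less.prems by auto
    next
      case False then show ?thesis using less.IH[of j i] j less.prems ip_commute[of N "?e i" "?e j"] by auto
    qed
    have "ip N (resid_row N M k) (?e j) = ip N (\<lambda>m. M (k, m)) (?e j) -
        (\<Sum>i<k. ip N (\<lambda>m. M (k, m)) (?e i) * ip N (?e i) (?e j))"
      unfolding resid_row_def by (simp only: ip_diff_left ip_sum_left)
    also have "(\<Sum>i<k. ip N (\<lambda>m. M (k, m)) (?e i) * ip N (?e i) (?e j)) = (\<Sum>i<k. if i = j then ip N (\<lambda>m. M (k, m)) (?e i) else 0)"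
      by (intro sum.cong refl) (simp add: ee)
    also have "\<dots> = ip N (\<lambda>m. M (k, m)) (?e j)" using j by (simp add: sum.delta)
    finally have "ip N (resid_row N M k) (?e j) = 0" by simp
    then show ?thesis using False by (simp add: ortho_row_resid[of N M k] ip_divide_left)
  qed
qed

lemma orthonormal_rows_imp_columns:
  fixes e :: "nat \<Rightarrow> nat \<Rightarrow> real"
  assumes rows: "\<And>k j. k < N \<Longrightarrow> j < N \<Longrightarrow> ip N (e k) (e j) = (if j = k then 1 else 0)" and l: "l < N" "l' < N"
  shows "(\<Sum>k<N. e k l * e k l') = (if l = l' then 1 else 0)"
proof -
  define E where "E = Matrix.mat N N (\<lambda>(k, l). e k l)"
  have E: "E \<in> carrier_mat N N" "transpose_mat E \<in> carrier_mat N N" by (auto simp: E_def)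
  have "E * transpose_mat E = 1\<^sub>m N"
  proof (rule eq_matI)
    fix i j assume "i < dim_row (1\<^sub>m N)" "j < dim_col (1\<^sub>m N)"
    then show "(E * transpose_mat E) $$ (i, j) = 1\<^sub>m N $$ (i, j)"
      using rows[of i j] by (auto simp: E_def scalar_prod_def ip_def lessThan_atLeast0)
  qed (auto simp: E_def)
  from mat_mult_left_right_inverse[OF E this] have "(transpose_mat E * E) $$ (l, l') = 1\<^sub>m N $$ (l, l')" by simp
  then show ?thesis using l by (simp add: E_def scalar_prod_def lessThan_atLeast0)
qed

definition vec_rot :: "nat \<Rightarrow> nat \<Rightarrow> real \<Rightarrow> real \<Rightarrow> (nat \<Rightarrow> real) \<Rightarrow> nat \<Rightarrow> real" where
  "vec_rot i j c s x = (\<lambda>l. if l = i then c * x i + s * x j else if l = j then - s * x i + c * x j else x l)"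

definition col_rot :: "nat \<Rightarrow> nat \<Rightarrow> nat \<Rightarrow> real \<Rightarrow> real \<Rightarrow> (nat \<times> nat \<Rightarrow> real) \<Rightarrow> nat \<times> nat \<Rightarrow> real" where
  "col_rot K i j c s M = (\<lambda>(k, l). if k < K then vec_rot i j c s (\<lambda>m. M (k, m)) l else M (k, l))"

lemma ip_vec_rot:
  assumes ij: "i < N" "j < N" "i \<noteq> j" and cs: "c\<^sup>2 + s\<^sup>2 = 1"
  shows "ip N (vec_rot i j c s x) (vec_rot i j c s y) = ip N x y"
proof -
  have split: "(\<Sum>l<N. h l) = h i + (h j + sum h ({..<N} - {i} - {j}))" for h :: "nat \<Rightarrow> real"
    using ij by (subst sum.remove[of _ i], simp, simp, subst sum.remove[of _ j], auto)
  have "(c * x i + s * x j) * (c * y i + s * y j) + (- s * x i + c * x j) * (- s * y i + c * y j)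
      = (c\<^sup>2 + s\<^sup>2) * (x i * y i) + (c\<^sup>2 + s\<^sup>2) * (x j * y j)"
    by (simp add: power2_eq_square algebra_simps)
  then have e: "(c * x i + s * x j) * (c * y i + s * y j) + (- s * x i + c * x j) * (- s * y i + c * y j) = x i * y i + x j * y j"
    using cs by simp
  have "(\<Sum>l\<in>{..<N} - {i} - {j}. vec_rot i j c s x l * vec_rot i j c s y l) = (\<Sum>l\<in>{..<N} - {i} - {j}. x l * y l)"
    by (intro sum.cong) (auto simp: vec_rot_def)
  then show ?thesis
    unfolding ip_def split using e ij(3) by (simp add: vec_rot_def)
qed

text \<open>
  Rotating columns acts on every row by the same isometry, and the Gram-Schmidt process only uses linear
  operations and inner products of rows.
\<close>

lemma ortho_row_col_rot:
  assumes ij: "i < N" "j < N" "i \<noteq> j" and cs: "c\<^sup>2 + s\<^sup>2 = 1" and "k < N"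
  shows "ortho_row N (col_rot N i j c s M) k = vec_rot i j c s (ortho_row N M k)"
    and "resid_row N (col_rot N i j c s M) k = vec_rot i j c s (resid_row N M k)"
proof -
  let ?M = "col_rot N i j c s M"
  have res: "resid_row N ?M k = vec_rot i j c s (resid_row N M k)"
    if k: "k < N" and IH: "\<And>m. m < k \<Longrightarrow> ortho_row N ?M m = vec_rot i j c s (ortho_row N M m)" for k
  proof -
    have row: "(\<lambda>m. ?M (k, m)) = vec_rot i j c s (\<lambda>m. M (k, m))"
      using k by (simp add: col_rot_def)
    have row': "?M (k, l) = vec_rot i j c s (\<lambda>m. M (k, m)) l" for l
      using k by (simp add: col_rot_def)
    define t where "t m = ip N (\<lambda>l. M (k, l)) (ortho_row N M m)" for m
    have t: "ip N (\<lambda>l. ?M (k, l)) (ortho_row N ?M m) = t m" if "m < k" for m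
      unfolding row IH[OF that] t_def by (rule ip_vec_rot[OF ij cs])
    have "(\<Sum>m<k. ip N (\<lambda>l. ?M (k, l)) (ortho_row N ?M m) * ortho_row N ?M m l) =
        (\<Sum>m<k. t m * vec_rot i j c s (ortho_row N M m) l)" for l
    proof (intro sum.cong refl)
      fix m assume "m \<in> {..<k}"
      then have m: "m < k" by simp
      show "ip N (\<lambda>l. ?M (k, l)) (ortho_row N ?M m) * ortho_row N ?M m l = t m * vec_rot i j c s (ortho_row N M m) l"
        unfolding t[OF m] unfolding IH[OF m] ..
    qed
    then have "resid_row N ?M k = (\<lambda>l. vec_rot i j c s (\<lambda>m. M (k, m)) l - (\<Sum>m<k. t m * vec_rot i j c s (ortho_row N M m) l))"
      unfolding resid_row_def row' by simp
    also have "\<dots> = vec_rot i j c s (\<lambda>l. M (k, l) - (\<Sum>m<k. t m * ortho_row N M m l))"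
      by (rule ext) (simp add: vec_rot_def algebra_simps sum.distrib sum_distrib_left sum_subtractf sum_negf)
    finally show ?thesis by (simp add: resid_row_def t_def)
  qed
  have "ortho_row N ?M k = vec_rot i j c s (ortho_row N M k)" if "k < N" for k
    using that
  proof (induction k rule: less_induct)
    case (less k)
    have r: "resid_row N ?M k = vec_rot i j c s (resid_row N M k)"
      using less by (intro res) auto
    show ?case
      unfolding ortho_row_resid[of N _ k] r ip_vec_rot[OF ij cs]
      by (rule ext) (simp add: vec_rot_def add_divide_distrib diff_divide_distrib)
  qed
  then show "ortho_row N ?M k = vec_rot i j c s (ortho_row N M k)" "resid_row N ?M k = vec_rot i j c s (resid_row N M k)"
    using res assms(5) by auto
qed

lemma nondegenerate_col_rot:
  assumes "i < N" "j < N" "i \<noteq> j" "c\<^sup>2 + s\<^sup>2 = 1"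
  shows "nondegenerate N (col_rot N i j c s M) \<longleftrightarrow> nondegenerate N M"
  unfolding nondegenerate_def using assms by (simp add: ortho_row_col_rot ip_vec_rot)

definition row_span :: "(nat \<times> nat \<Rightarrow> real) \<Rightarrow> nat \<Rightarrow> (nat \<Rightarrow> real) set" where
  "row_span M K = {x. \<exists>b. \<forall>l. x l = (\<Sum>i<K. b i * M (i, l))}"

lemma row_span_diff: "x \<in> row_span M K \<Longrightarrow> y \<in> row_span M K \<Longrightarrow> (\<lambda>l. x l - y l) \<in> row_span M K"
proof -
  assume "x \<in> row_span M K" "y \<in> row_span M K"
  then obtain b b' where "\<And>l. x l = (\<Sum>i<K. b i * M (i, l))" "\<And>l. y l = (\<Sum>i<K. b' i * M (i, l))"
    unfolding row_span_def by blast
  then have "\<forall>l. x l - y l = (\<Sum>i<K. (b i - b' i) * M (i, l))"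
    by (simp add: left_diff_distrib sum_subtractf)
  then show ?thesis unfolding row_span_def by (intro CollectI exI[of _ "\<lambda>i. b i - b' i"])
qed

lemma row_span_scale: "x \<in> row_span M K \<Longrightarrow> (\<lambda>l. c * x l) \<in> row_span M K"
proof -
  assume "x \<in> row_span M K"
  then obtain b where "\<And>l. x l = (\<Sum>i<K. b i * M (i, l))" unfolding row_span_def by blast
  then have "\<forall>l. c * x l = (\<Sum>i<K. (c * b i) * M (i, l))" by (simp add: sum_distrib_left mult.assoc)
  then show ?thesis unfolding row_span_def by (intro CollectI exI[of _ "\<lambda>i. c * b i"])
qed

lemma row_span_mono: "K \<le> K' \<Longrightarrow> row_span M K \<subseteq> row_span M K'"
proof
  fix x assume K: "K \<le> K'" and "x \<in> row_span M K"
  then obtain b where b: "\<And>l. x l = (\<Sum>i<K. b i * M (i, l))" unfolding row_span_def by blast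
  have "(\<Sum>i<K'. (if i < K then b i else 0) * M (i, l)) = (\<Sum>i<K. b i * M (i, l))" for l
    using K by (intro sum.mono_neutral_cong_right) auto
  then show "x \<in> row_span M K'"
    unfolding row_span_def using b by (intro CollectI exI[of _ "\<lambda>i. if i < K then b i else 0"]) simp
qed

lemma row_span_zero: "(\<lambda>l. 0) \<in> row_span M K"
  unfolding row_span_def by (intro CollectI exI[of _ "\<lambda>_. 0"]) simp

lemma row_span_sum:
  assumes "finite A" "\<And>j. j \<in> A \<Longrightarrow> x j \<in> row_span M K"
  shows "(\<lambda>l. \<Sum>j\<in>A. t j * x j l) \<in> row_span M K"
  using assms
proof (induction A rule: finite_induct)
  case (insert a A)
  have "(\<lambda>l. t a * x a l - (- 1) * (\<Sum>j\<in>A. t j * x j l)) \<in> row_span M K"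
    using insert by (intro row_span_diff row_span_scale) auto
  then show ?case using insert by simp
qed (simp add: row_span_zero)

lemma row_in_row_span: "k < K \<Longrightarrow> (\<lambda>l. M (k, l)) \<in> row_span M K"
  unfolding row_span_def by (intro CollectI exI[of _ "\<lambda>i. if i = k then 1 else 0"]) (simp add: if_distrib[of "\<lambda>x. x * _"] sum.delta cong: if_cong)

lemma ortho_row_in_row_span: "ortho_row N M k \<in> row_span M (Suc k)"
proof (induction k rule: less_induct)
  case (less k)
  have "(\<lambda>l. \<Sum>j<k. ip N (\<lambda>m. M (k, m)) (ortho_row N M j) * ortho_row N M j l) \<in> row_span M (Suc k)"
    using less row_span_mono by (intro row_span_sum) (auto, meson Suc_le_mono less_imp_le_nat subsetD)
  then have "resid_row N M k \<in> row_span M (Suc k)"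
    unfolding resid_row_def by (intro row_span_diff row_in_row_span) auto
  then have "(\<lambda>l. (1 / sqrt (ip N (resid_row N M k) (resid_row N M k))) * resid_row N M k l) \<in> row_span M (Suc k)"
    by (rule row_span_scale)
  then show ?case by (simp add: ortho_row_resid[of N M k])
qed

text \<open>
  If the process broke down at row \<open>k\<close>, this row would be a linear combination of the earlier ones. In
  a linear relation between rows of a diagonally dominant matrix, the column belonging to a
  coefficient of maximal modulus gives a contradiction.
\<close>

lemma near_identity_nondegenerate:
  assumes near: "\<And>k l. k < N \<Longrightarrow> l < N \<Longrightarrow> \<bar>M (k, l) - (if k = l then 1 else 0)\<bar> < 1 / (2 * real N)"
  shows "nondegenerate N M"
  unfolding nondegenerate_def
proof (intro allI impI notI)
  fix k assume k: "k < N" and "ip N (resid_row N M k) (resid_row N M k) = 0"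
  then have z: "resid_row N M k l = 0" if "l < N" for l using ip_self_eq_0 that by blast
  have "(\<lambda>l. \<Sum>j<k. ip N (\<lambda>m. M (k, m)) (ortho_row N M j) * ortho_row N M j l) \<in> row_span M k"
    by (intro row_span_sum) (auto intro: subsetD[OF row_span_mono ortho_row_in_row_span])
  then obtain b where b: "\<And>l. (\<Sum>j<k. ip N (\<lambda>m. M (k, m)) (ortho_row N M j) * ortho_row N M j l) = (\<Sum>i<k. b i * M (i, l))"
    unfolding row_span_def by blast
  define a where "a i = (if i = k then - 1 else b i)" for i
  have a: "(\<Sum>i\<le>k. a i * M (i, l)) = 0" if "l < N" for l
  proof -
    have "(\<Sum>i\<le>k. a i * M (i, l)) = (\<Sum>i<k. a i * M (i, l)) + a k * M (k, l)"
      by (simp add: lessThan_Suc_atMost[symmetric])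
    also have "(\<Sum>i<k. a i * M (i, l)) = (\<Sum>i<k. b i * M (i, l))" by (simp add: a_def)
    also have "\<dots> = M (k, l)" using z[OF that] b[of l] by (simp add: resid_row_def)
    finally show ?thesis by (simp add: a_def)
  qed
  \<comment> \<open>The relation \<open>a\<close> between the rows is evaluated in a column \<open>i\<close> where \<open>\<bar>a i\<bar>\<close> is maximal.\<close>
  define m where "m = Max ((\<lambda>i. \<bar>a i\<bar>) ` {..k})"
  have le: "\<bar>a i\<bar> \<le> m" if "i \<le> k" for i unfolding m_def using that by (intro Max_ge) auto
  have "m \<in> (\<lambda>i. \<bar>a i\<bar>) ` {..k}" unfolding m_def by (intro Max_in) auto
  then obtain i where i: "i \<le> k" "\<bar>a i\<bar> = m" by auto
  have m: "m \<ge> 1" using le[of k] by (simp add: a_def)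
  have N: "real N \<ge> 1" using k by simp
  have "\<bar>\<Sum>j\<in>{..k} - {i}. a j * M (j, i)\<bar> \<le> (\<Sum>j\<in>{..k} - {i}. m * (1 / (2 * real N)))"
  proof (intro order_trans[OF sum_abs] sum_mono)
    fix j assume j: "j \<in> {..k} - {i}"
    then have "\<bar>M (j, i)\<bar> \<le> 1 / (2 * real N)" using near[of j i] i k by auto
    then show "\<bar>a j * M (j, i)\<bar> \<le> m * (1 / (2 * real N))"
      unfolding abs_mult using le[of j] j m by (intro mult_mono) auto
  qed
  also have "\<dots> = real k * (m * (1 / (2 * real N)))" using i by simp
  also have "\<dots> = m * (real k / (2 * real N))" by simp
  finally have off: "\<bar>\<Sum>j\<in>{..k} - {i}. a j * M (j, i)\<bar> \<le> m * (real k / (2 * real N))" .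
  have "(\<Sum>j\<le>k. a j * M (j, i)) = a i * M (i, i) + (\<Sum>j\<in>{..k} - {i}. a j * M (j, i))"
    using i by (intro sum.remove) auto
  then have "\<bar>a i * M (i, i)\<bar> \<le> m * (real k / (2 * real N))"
    using off a[of i] i k by simp
  then have "m * \<bar>M (i, i)\<bar> \<le> m * (real k / (2 * real N))" using i by (simp add: abs_mult)
  then have "\<bar>M (i, i)\<bar> \<le> real k / (2 * real N)" using m by (subst (asm) mult_le_cancel_left_pos) auto
  moreover have "\<bar>M (i, i)\<bar> > 1 - 1 / (2 * real N)" using near[of i i] i k by auto
  moreover have "real k / (2 * real N) + 1 / (2 * real N) \<le> 1 / 2"
    using k N by (simp add: field_simps)
  ultimately show False by linarith
qed

lemma measurable_ortho_row:
  assumes "k < N" "l < N"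
  shows "(\<lambda>M. ortho_row N M k l) \<in> borel_measurable (PiM ({..<N} \<times> {..<N}) (\<lambda>_. borel))"
    and "(\<lambda>M. resid_row N M k l) \<in> borel_measurable (PiM ({..<N} \<times> {..<N}) (\<lambda>_. borel))"
proof -
  let ?P = "PiM ({..<N} \<times> {..<N}) (\<lambda>_. borel :: real measure)"
  have comp: "(\<lambda>M. M (k, l)) \<in> borel_measurable ?P" if "k < N" "l < N" for k l
    using that by (intro measurable_component_singleton) auto
  have res: "(\<lambda>M. resid_row N M k l) \<in> borel_measurable ?P"
    if "k < N" "l < N" "\<And>j l. j < k \<Longrightarrow> l < N \<Longrightarrow> (\<lambda>M. ortho_row N M j l) \<in> borel_measurable ?P" for k l
    unfolding resid_row_def ip_def using that
    by (intro borel_measurable_diff borel_measurable_sum borel_measurable_times comp) auto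
  have "(\<lambda>M. ortho_row N M k l) \<in> borel_measurable ?P" if "k < N" "l < N" for k l
    using that
  proof (induction k arbitrary: l rule: less_induct)
    case (less k)
    have r: "(\<lambda>M. resid_row N M k l) \<in> borel_measurable ?P" if "l < N" for l
      using less that by (intro res) auto
    show ?case
      unfolding ortho_row_resid[of N _ k] ip_def using less.prems
      by (intro borel_measurable_divide r measurable_compose[OF _ borel_measurable_sqrt] borel_measurable_sum borel_measurable_times) auto
  qed
  then show "(\<lambda>M. ortho_row N M k l) \<in> borel_measurable ?P" "(\<lambda>M. resid_row N M k l) \<in> borel_measurable ?P"
    using assms res by auto
qed

abbreviation mat_space :: "nat \<Rightarrow> (nat \<times> nat \<Rightarrow> real) measure" where
  "mat_space N \<equiv> PiM ({..<N} \<times> {..<N}) (\<lambda>_. borel)"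

lemma sets_gauss_noise: "sets (gauss_noise p q) = sets (PiM ({..<p} \<times> {..<q}) (\<lambda>_. borel))"
  unfolding gauss_noise_def by (intro sets_PiM_cong) auto

lemma space_gauss_noise: "space (gauss_noise p q) = space (PiM ({..<p} \<times> {..<q}) (\<lambda>_. borel))"
  by (rule sets_eq_imp_space_eq[OF sets_gauss_noise])

text \<open>
  The same two columns are rotated in one row after the other; each step rotates two entries of the
  Gaussian vector of all entries.
\<close>

lemma gauss_noise_col_rot:
  assumes ij: "i < N" "j < N" "i \<noteq> j" and cs: "c\<^sup>2 + s\<^sup>2 = 1" and K: "K \<le> N"
  shows "col_rot K i j c s \<in> gauss_noise N N \<rightarrow>\<^sub>M gauss_noise N N \<and>
    distr (gauss_noise N N) (gauss_noise N N) (col_rot K i j c s) = gauss_noise N N"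
  using K
proof (induction K)
  case 0
  have "col_rot 0 i j c s = (\<lambda>M. M)" by (intro ext) (simp add: col_rot_def split: prod.splits)
  then show ?case by (simp add: distr_id2)
next
  case (Suc K)
  let ?R = "\<lambda>x::nat \<times> nat \<Rightarrow> real. x((K, i) := c * x (K, i) + s * x (K, j), (K, j) := - s * x (K, i) + c * x (K, j))"
  have comp: "col_rot (Suc K) i j c s = ?R \<circ> col_rot K i j c s"
  proof (rule ext, rule ext)
    fix x :: "nat \<times> nat \<Rightarrow> real" and kl :: "nat \<times> nat"
    obtain k l where kl: "kl = (k, l)" by (cases kl)
    consider "k < K" | "k = K" | "k > K" by linarith
    then show "col_rot (Suc K) i j c s x kl = (?R \<circ> col_rot K i j c s) x kl"
      using ij(3) by cases (simp_all add: kl col_rot_def vec_rot_def)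
  qed
  have K: "K < N" using Suc.prems by simp
  have R: "?R \<in> gauss_noise N N \<rightarrow>\<^sub>M gauss_noise N N"
    unfolding gauss_noise_def using ij K by (intro measurable_PiM_rotate) auto
  have Rd: "distr (gauss_noise N N) (gauss_noise N N) ?R = gauss_noise N N"
    unfolding gauss_noise_def using ij K cs by (intro PiM_std_normal_rotate) auto
  have IH: "col_rot K i j c s \<in> gauss_noise N N \<rightarrow>\<^sub>M gauss_noise N N"
    "distr (gauss_noise N N) (gauss_noise N N) (col_rot K i j c s) = gauss_noise N N"
    using Suc.IH K by auto
  have "distr (gauss_noise N N) (gauss_noise N N) (?R \<circ> col_rot K i j c s) =
     distr (distr (gauss_noise N N) (gauss_noise N N) (col_rot K i j c s)) (gauss_noise N N) ?R"
    by (rule distr_distr[OF R IH(1), symmetric])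
  then show ?case unfolding comp IH(2) Rd using measurable_comp[OF IH(1) R] by blast
qed

definition nondeg_set :: "nat \<Rightarrow> (nat \<times> nat \<Rightarrow> real) set" where
  "nondeg_set N = {M \<in> space (gauss_noise N N). nondegenerate N M}"

definition ortho_mat :: "nat \<Rightarrow> (nat \<times> nat \<Rightarrow> real) \<Rightarrow> nat \<times> nat \<Rightarrow> real" where
  "ortho_mat N M = (\<lambda>kl\<in>{..<N} \<times> {..<N}. ortho_row N M (fst kl) (snd kl))"

text \<open>
  The law of the orthogonal matrix obtained from a Gaussian matrix by orthonormalising its rows. By
  \<open>frame_law_col_rot\<close> it is invariant under rotations of the columns: it is the Haar measure of the
  orthogonal group.
\<close>

definition frame_law :: "nat \<Rightarrow> (nat \<times> nat \<Rightarrow> real) measure" where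
  "frame_law N = distr (uniform_measure (gauss_noise N N) (nondeg_set N)) (mat_space N) (ortho_mat N)"

lemma measurable_ortho_mat [measurable]: "ortho_mat N \<in> mat_space N \<rightarrow>\<^sub>M mat_space N"
  unfolding ortho_mat_def by (intro measurable_restrict measurable_ortho_row) auto

lemma nondeg_set_measurable [measurable]: "nondeg_set N \<in> sets (gauss_noise N N)"
proof -
  have m: "(\<lambda>M. ip N (resid_row N M k) (resid_row N M k)) \<in> borel_measurable (gauss_noise N N)" if "k < N" for k
    using that unfolding ip_def measurable_cong_sets[OF sets_gauss_noise refl]
    by (intro borel_measurable_sum borel_measurable_times measurable_ortho_row) auto
  have "{M \<in> space (gauss_noise N N). ip N (resid_row N M k) (resid_row N M k) \<noteq> 0} \<in> sets (gauss_noise N N)" if "k < N" for k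
    using m[OF that] by measurable
  then have "{M \<in> space (gauss_noise N N). \<forall>k\<in>{..<N}. ip N (resid_row N M k) (resid_row N M k) \<noteq> 0} \<in> sets (gauss_noise N N)"
    by (intro sets.sets_Collect_finite_All) auto
  moreover have "nondeg_set N = {M \<in> space (gauss_noise N N). \<forall>k\<in>{..<N}. ip N (resid_row N M k) (resid_row N M k) \<noteq> 0}"
    by (auto simp: nondeg_set_def nondegenerate_def)
  ultimately show ?thesis by simp
qed

lemma std_normal_interval_pos:
  assumes "a < b" shows "emeasure std_normal {a<..<b} \<noteq> 0"
proof
  assume "emeasure std_normal {a<..<b} = 0"
  then have "{a<..<b} \<in> null_sets std_normal" by (simp add: null_sets_def)
  then have "AE x in lborel. x \<in> {a<..<b} \<longrightarrow> ennreal (std_normal_density x) = 0"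
    by (subst (asm) null_sets_density_iff) auto
  then have "AE x in lborel. x \<notin> {a<..<b}"
  proof eventually_elim
    case (elim x)
    have "std_normal_density x > 0" by (simp add: normal_density_pos)
    then show ?case using elim by (auto simp: ennreal_eq_0_iff)
  qed
  then have "emeasure lborel {a<..<b} = 0"
    by (subst (asm) AE_iff_null_sets[symmetric]) auto
  then show False using assms by simp
qed

text \<open>
  The nondegenerate matrices contain a box around the identity matrix.
\<close>

lemma nondeg_set_pos: "emeasure (gauss_noise N N) (nondeg_set N) \<noteq> 0"
proof
  assume z: "emeasure (gauss_noise N N) (nondeg_set N) = 0"
  interpret product_sigma_finite "\<lambda>_. std_normal" by (rule product_sigma_finite_std_normal)
  let ?I = "{..<N} \<times> {..<N}"
  define A :: "nat \<times> nat \<Rightarrow> real set" where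
    "A kl = (let d = (if fst kl = snd kl then 1 else 0) in {d - 1 / (2 * real N)<..<d + 1 / (2 * real N)})" for kl
  have "PiE ?I A \<subseteq> nondeg_set N"
  proof
    fix M assume M: "M \<in> PiE ?I A"
    have "nondegenerate N M"
    proof (rule near_identity_nondegenerate)
      fix k l assume "k < N" "l < N"
      then have "M (k, l) \<in> A (k, l)" using M by (auto simp: PiE_def Pi_def)
      then show "\<bar>M (k, l) - (if k = l then 1 else 0)\<bar> < 1 / (2 * real N)"
        unfolding A_def Let_def by (auto simp: abs_less_iff)
    qed
    moreover have "M \<in> space (gauss_noise N N)"
      using M unfolding space_gauss_noise by (auto simp: space_PiM PiE_def)
    ultimately show "M \<in> nondeg_set N" by (simp add: nondeg_set_def)
  qed
  then have "emeasure (gauss_noise N N) (PiE ?I A) \<le> 0"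
    using emeasure_mono[OF _ nondeg_set_measurable] z by metis
  moreover have "emeasure (gauss_noise N N) (PiE ?I A) = (\<Prod>kl\<in>?I. emeasure std_normal (A kl))"
    unfolding gauss_noise_def by (intro emeasure_PiM) (auto simp: A_def Let_def)
  ultimately obtain kl where kl: "kl \<in> ?I" "emeasure std_normal (A kl) = 0"
    by (auto simp: prod_zero_iff)
  then have "N > 0" by auto
  then show False
    using kl(2) std_normal_interval_pos[of "(if fst kl = snd kl then 1 else 0) - 1 / (2 * real N)" "(if fst kl = snd kl then 1 else 0) + 1 / (2 * real N)"]
    unfolding A_def Let_def by simp
qed

lemma measurable_uniform_gauss: "measurable (uniform_measure (gauss_noise N N) D) M' = measurable (mat_space N) M'"
  by (intro measurable_cong_sets) (simp_all add: sets_gauss_noise)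

lemma prob_space_frame_law: "prob_space (frame_law N)"
  unfolding frame_law_def
proof (rule prob_space.prob_space_distr)
  interpret G: prob_space "gauss_noise N N" by (rule prob_space_gauss_noise)
  show "prob_space (uniform_measure (gauss_noise N N) (nondeg_set N))"
    by (intro prob_space_uniform_measure nondeg_set_pos) simp
  show "ortho_mat N \<in> uniform_measure (gauss_noise N N) (nondeg_set N) \<rightarrow>\<^sub>M mat_space N"
    unfolding measurable_uniform_gauss by (rule measurable_ortho_mat)
qed

lemma sets_frame_law [measurable_cong]: "sets (frame_law N) = sets (mat_space N)"
  by (simp add: frame_law_def)

lemma frame_law_orthonormal:
  "AE u in frame_law N. \<forall>l<N. \<forall>l'<N. (\<Sum>k<N. u (k, l) * u (k, l')) = (if l = l' then 1 else 0)"
proof -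
  interpret G: prob_space "gauss_noise N N" by (rule prob_space_gauss_noise)
  let ?P = "\<lambda>u::nat \<times> nat \<Rightarrow> real. \<forall>l\<in>{..<N}. \<forall>l'\<in>{..<N}. (\<Sum>k<N. u (k, l) * u (k, l')) = (if l = l' then 1 else 0)"
  have "{u \<in> space (mat_space N). ?P u} \<in> sets (mat_space N)"
  proof (intro sets.sets_Collect_finite_All)
    fix l l' assume "l \<in> {..<N}" "l' \<in> {..<N}"
    then have "(\<lambda>u. \<Sum>k<N. u (k, l) * u (k, l')) \<in> borel_measurable (mat_space N)"
      by (intro borel_measurable_sum borel_measurable_times measurable_component_singleton) auto
    then show "{u \<in> space (mat_space N). (\<Sum>k<N. u (k, l) * u (k, l')) = (if l = l' then 1 else 0)} \<in> sets (mat_space N)"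
      by measurable
  qed auto
  moreover have "?P (ortho_mat N M)" if "M \<in> nondeg_set N" for M
  proof (intro ballI)
    fix l l' assume l: "l \<in> {..<N}" "l' \<in> {..<N}"
    have "(\<Sum>k<N. ortho_mat N M (k, l) * ortho_mat N M (k, l')) = (\<Sum>k<N. ortho_row N M k l * ortho_row N M k l')"
      using l by (intro sum.cong) (auto simp: ortho_mat_def)
    also have "\<dots> = (if l = l' then 1 else 0)"
    proof (rule orthonormal_rows_imp_columns)
      fix k j assume kj: "k < N" "j < N"
      have nd: "nondegenerate N M" using that by (simp add: nondeg_set_def)
      show "ip N (ortho_row N M k) (ortho_row N M j) = (if j = k then 1 else 0)"
      proof (cases "j \<le> k")
        case True then show ?thesis using ortho_row_orthonormal[OF nd] kj by blast
      next
        case False then show ?thesis using ortho_row_orthonormal[OF nd, of j k] kj by (auto simp: ip_commute)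
      qed
    qed (use l in auto)
    finally show "(\<Sum>k<N. ortho_mat N M (k, l) * ortho_mat N M (k, l')) = (if l = l' then 1 else 0)" .
  qed
  ultimately have "AE u in frame_law N. ?P u"
    unfolding frame_law_def
    by (subst AE_distr_iff) (auto simp: measurable_uniform_gauss intro!: AE_uniform_measureI)
  then show ?thesis by (simp add: Ball_def)
qed

lemma distr_uniform_measure_invariant:
  assumes C: "C \<in> M \<rightarrow>\<^sub>M M" and inv: "distr M M C = M" and D: "D \<in> sets M"
    and CD: "\<And>x. x \<in> space M \<Longrightarrow> C x \<in> D \<longleftrightarrow> x \<in> D"
  shows "distr (uniform_measure M D) M C = uniform_measure M D"
proof (rule measure_eqI)
  fix A assume "A \<in> sets (distr (uniform_measure M D) M C)"
  then have A: "A \<in> sets M" by simp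
  have sub: "D \<subseteq> space M" using D by (rule sets.sets_into_space)
  have CA: "C -` A \<inter> space M \<in> sets M" using C A by (rule measurable_sets)
  have "emeasure (distr (uniform_measure M D) M C) A = emeasure (uniform_measure M D) (C -` A \<inter> space M)"
    using C A by (subst emeasure_distr) (auto cong: measurable_cong_sets)
  also have "\<dots> = emeasure M (D \<inter> (C -` A \<inter> space M)) / emeasure M D"
    using D CA by simp
  also have "D \<inter> (C -` A \<inter> space M) = C -` (D \<inter> A) \<inter> space M"
    using CD sub by auto
  also have "emeasure M (C -` (D \<inter> A) \<inter> space M) = emeasure (distr M M C) (D \<inter> A)"
    using C A D by (subst emeasure_distr) auto
  finally show "emeasure (distr (uniform_measure M D) M C) A = emeasure (uniform_measure M D) A"
    using A D inv by simp
qed simp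

lemma frame_law_col_rot:
  assumes ij: "i < N" "j < N" "i \<noteq> j" and cs: "c\<^sup>2 + s\<^sup>2 = 1"
  shows "col_rot N i j c s \<in> mat_space N \<rightarrow>\<^sub>M mat_space N"
    and "distr (frame_law N) (mat_space N) (col_rot N i j c s) = frame_law N"
proof -
  let ?C = "col_rot N i j c s" and ?G = "gauss_noise N N"
  have CG: "?C \<in> ?G \<rightarrow>\<^sub>M ?G" using ij cs by (intro gauss_noise_col_rot[THEN conjunct1]) auto
  then show C: "?C \<in> mat_space N \<rightarrow>\<^sub>M mat_space N"
    by (simp add: measurable_cong_sets[OF sets_gauss_noise sets_gauss_noise])
  let ?U = "uniform_measure ?G (nondeg_set N)"
  have U: "distr ?U ?G ?C = ?U"
  proof (rule distr_uniform_measure_invariant[OF CG])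
    show "distr ?G ?G ?C = ?G" using ij cs by (intro gauss_noise_col_rot[THEN conjunct2]) auto
    fix M assume "M \<in> space ?G"
    then show "?C M \<in> nondeg_set N \<longleftrightarrow> M \<in> nondeg_set N"
      using nondegenerate_col_rot[OF ij cs] measurable_space[OF CG] by (simp add: nondeg_set_def)
  qed simp
  have comm: "?C (ortho_mat N M) = ortho_mat N (?C M)" if "M \<in> space ?G" for M
  proof (rule ext)
    fix kl :: "nat \<times> nat"
    show "?C (ortho_mat N M) kl = ortho_mat N (?C M) kl"
      using ij by (cases kl) (auto simp: ortho_mat_def ortho_row_col_rot[OF ij cs], auto simp: col_rot_def vec_rot_def)
  qed
  have "distr (frame_law N) (mat_space N) ?C = distr ?U (mat_space N) (?C \<circ> ortho_mat N)"
    unfolding frame_law_def using C measurable_ortho_mat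
    by (intro distr_distr) (auto simp: measurable_uniform_gauss)
  also have "\<dots> = distr ?U (mat_space N) (ortho_mat N \<circ> ?C)"
    by (intro distr_cong) (auto simp: comm)
  also have "\<dots> = distr (distr ?U ?G ?C) (mat_space N) (ortho_mat N)"
    using C measurable_ortho_mat
    by (intro distr_distr[symmetric]) (auto simp: measurable_uniform_gauss measurable_cong_sets[OF sets_gauss_noise] measurable_cong_sets[OF refl sets_gauss_noise])
  also have "\<dots> = frame_law N" unfolding U frame_law_def ..
  finally show "distr (frame_law N) (mat_space N) ?C = frame_law N" .
qed

definition set_col :: "nat \<Rightarrow> nat \<Rightarrow> (nat \<Rightarrow> real) \<Rightarrow> (nat \<times> nat \<Rightarrow> real) \<Rightarrow> nat \<times> nat \<Rightarrow> real" where
  "set_col N i x u = (\<lambda>(k, l). if k < N \<and> l = i then x k else u (k, l))"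

definition spread_col :: "nat \<Rightarrow> nat \<Rightarrow> (nat \<Rightarrow> real) \<Rightarrow> (nat \<times> nat \<Rightarrow> real) \<Rightarrow> nat \<Rightarrow> real" where
  "spread_col n t \<epsilon> u k = (\<Sum>j\<in>{n..<n + t}. \<epsilon> j * u (k, j)) / sqrt (real t)"

text \<open>
  Column \<open>i\<close> may be replaced by the normalised signed sum of \<open>t\<close> further columns, provided
  that the integrand ignores those columns. The proof brings in the columns one at a time: a
  rotation in the plane of columns \<open>i\<close> and \<open>n + t\<close> mixes \<open>\<epsilon> (n + t)\<close> times the latter into the former with
  weights \<open>(t / (t + 1))\<^sup>1\<^sup>/\<^sup>2\<close> and \<open>(t + 1)\<^sup>-\<^sup>1\<^sup>/\<^sup>2\<close>, and the damage that it does to column \<open>n + t\<close> is invisible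
  to the integrand.
\<close>

lemma frame_law_spread:
  fixes F :: "(nat \<times> nat \<Rightarrow> real) \<Rightarrow> real"
  assumes F: "F \<in> borel_measurable (mat_space N)"
    and indep: "\<And>u u'. (\<And>k l. l \<notin> {n..<n + t} \<Longrightarrow> u (k, l) = u' (k, l)) \<Longrightarrow> F u = F u'"
    and i: "i < n" and t: "t \<ge> 1" "n + t \<le> N" and \<epsilon>: "\<And>j. j \<in> {n..<n + t} \<Longrightarrow> \<epsilon> j = 1 \<or> \<epsilon> j = - 1"
  shows "(\<integral>u. F u \<partial>frame_law N) = (\<integral>u. F (set_col N i (spread_col n t \<epsilon> u) u) \<partial>frame_law N)"
  using F indep t \<epsilon>
proof (induction t arbitrary: F)
  case (Suc t)
  define c where "c = sqrt (real t / real (Suc t))"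
  define s where "s = \<epsilon> (n + t) / sqrt (real (Suc t))"
  have "\<epsilon> (n + t) = 1 \<or> \<epsilon> (n + t) = - 1" using Suc.prems(5)[of "n + t"] by auto
  then have "(\<epsilon> (n + t))\<^sup>2 = 1" by (simp add: power2_eq_1_iff)
  then have "c\<^sup>2 + s\<^sup>2 = real t / real (Suc t) + 1 / real (Suc t)"
    by (simp add: c_def s_def power_divide)
  also have "\<dots> = 1" by (simp add: add_divide_distrib[symmetric])
  finally have cs: "c\<^sup>2 + s\<^sup>2 = 1" .
  have ij: "i < N" "n + t < N" "i \<noteq> n + t" using i Suc.prems(4) by auto
  note rot = frame_law_col_rot[OF ij cs]
  define G where "G u = F (set_col N i (\<lambda>k. c * u (k, i) + s * u (k, n + t)) u)" for u
  have GF: "F (col_rot N i (n + t) c s u) = G u" for u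
    unfolding G_def
    by (rule Suc.prems(2)) (auto simp: set_col_def col_rot_def vec_rot_def)
  have "(\<integral>u. F u \<partial>frame_law N) = (\<integral>u. F u \<partial>distr (frame_law N) (mat_space N) (col_rot N i (n + t) c s))"
    unfolding rot(2) ..
  also have "\<dots> = (\<integral>u. F (col_rot N i (n + t) c s u) \<partial>frame_law N)"
    using rot(1) Suc.prems(1) by (intro integral_distr) (auto simp: measurable_cong_sets[OF sets_frame_law refl])
  finally have 1: "(\<integral>u. F u \<partial>frame_law N) = (\<integral>u. G u \<partial>frame_law N)" unfolding GF .
  show ?case
  proof (cases "t = 0")
    case True
    have "(\<lambda>k. c * u (k, i) + s * u (k, n + t)) = spread_col n (Suc t) \<epsilon> u" for u
      using True by (simp add: c_def s_def spread_col_def fun_eq_iff)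
    then have "G u = F (set_col N i (spread_col n (Suc t) \<epsilon> u) u)" for u
      unfolding G_def by simp
    then show ?thesis unfolding 1 by (intro Bochner_Integration.integral_cong refl)
  next
    case False
    have "(\<integral>u. G u \<partial>frame_law N) = (\<integral>u. G (set_col N i (spread_col n t \<epsilon> u) u) \<partial>frame_law N)"
    proof (rule Suc.IH)
      show "G \<in> borel_measurable (mat_space N)"
        using measurable_compose[OF rot(1) Suc.prems(1)] by (simp add: GF)
      fix u u' :: "nat \<times> nat \<Rightarrow> real" assume e: "\<And>k l. l \<notin> {n..<n + t} \<Longrightarrow> u (k, l) = u' (k, l)"
      show "G u = G u'"
        unfolding G_def using e i by (intro Suc.prems(2)) (auto simp: set_col_def)
    qed (use False Suc.prems(3-5) in auto)
    also have "\<dots> = (\<integral>u. F (set_col N i (spread_col n (Suc t) \<epsilon> u) u) \<partial>frame_law N)"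
    proof (rule Bochner_Integration.integral_cong[OF refl])
      fix u :: "nat \<times> nat \<Rightarrow> real"
      let ?u = "set_col N i (spread_col n t \<epsilon> u) u"
      have "c * spread_col n t \<epsilon> u k + s * u (k, n + t) = spread_col n (Suc t) \<epsilon> u k" for k
      proof -
        have "c * spread_col n t \<epsilon> u k = (\<Sum>j\<in>{n..<n + t}. \<epsilon> j * u (k, j)) / sqrt (real (Suc t))"
          using False by (simp add: c_def spread_col_def real_sqrt_divide)
        then show ?thesis by (simp add: s_def spread_col_def add_divide_distrib)
      qed
      then have "set_col N i (\<lambda>k. c * ?u (k, i) + s * ?u (k, n + t)) ?u = set_col N i (spread_col n (Suc t) \<epsilon> u) u"
        using ij i by (intro ext) (auto simp: set_col_def)
      then show "G ?u = F (set_col N i (spread_col n (Suc t) \<epsilon> u) u)" unfolding G_def by simp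
    qed
    finally show ?thesis unfolding 1 .
  qed
qed simp

section \<open>Mixtures of shifted Gaussian vectors\<close>

text \<open>
  The Cameron--Martin formula in dimension one, from which \<open>std_normal_vec_shift\<close> follows on boxes.
\<close>

lemma std_normal_shift:
  "distr std_normal std_normal (\<lambda>x. b + x) = density std_normal (\<lambda>x. ennreal (exp (b * x - b\<^sup>2 / 2)))"
proof (rule measure_eqI)
  fix A assume "A \<in> sets (distr std_normal std_normal (\<lambda>x. b + x))"
  then have A[measurable]: "A \<in> sets borel" by simp
  have "emeasure (distr std_normal std_normal (\<lambda>x. b + x)) A = (\<integral>\<^sup>+x. indicator A x \<partial>distr std_normal std_normal (\<lambda>x. b + x))"
    by simp
  also have "\<dots> = (\<integral>\<^sup>+x. indicator A (b + x) \<partial>std_normal)"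
    by (rule nn_integral_distr) auto
  also have "\<dots> = (\<integral>\<^sup>+x. ennreal (std_normal_density x) * indicator A (b + x) \<partial>lborel)"
    by (rule nn_integral_density) auto
  also have "\<dots> = (\<integral>\<^sup>+x. (\<lambda>y. ennreal (std_normal_density (y - b)) * indicator A y) (b + 1 * x) \<partial>lborel)"
    by simp
  also have "\<dots> = ennreal (1 / \<bar>1\<bar>) * (\<integral>\<^sup>+y. ennreal (std_normal_density (y - b)) * indicator A y \<partial>lborel)"
    by (rule nn_integral_affine_subst) auto
  also have "\<dots> = (\<integral>\<^sup>+y. ennreal (std_normal_density y) * (ennreal (exp (b * y - b\<^sup>2 / 2)) * indicator A y) \<partial>lborel)"
  proof -
    have "std_normal_density (y - b) = std_normal_density y * exp (b * y - b\<^sup>2 / 2)" for y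
    proof -
      have "- (y - b)\<^sup>2 / 2 = - y\<^sup>2 / 2 + (b * y - b\<^sup>2 / 2)" by (simp add: power2_eq_square field_simps)
      then have "exp (- (y - b)\<^sup>2 / 2) = exp (- y\<^sup>2 / 2) * exp (b * y - b\<^sup>2 / 2)" by (simp only: exp_add)
      then show ?thesis unfolding std_normal_density_def by simp
    qed
    then show ?thesis by (simp add: ennreal_mult mult.assoc)
  qed
  also have "\<dots> = (\<integral>\<^sup>+y. ennreal (exp (b * y - b\<^sup>2 / 2)) * indicator A y \<partial>std_normal)"
    by (rule nn_integral_density[symmetric]) auto
  also have "\<dots> = emeasure (density std_normal (\<lambda>x. ennreal (exp (b * x - b\<^sup>2 / 2)))) A"
    by (rule emeasure_density[symmetric]) auto
  finally show "emeasure (distr std_normal std_normal (\<lambda>x. b + x)) A = emeasure (density std_normal (\<lambda>x. ennreal (exp (b * x - b\<^sup>2 / 2)))) A" .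
qed simp

abbreviation std_normal_vec :: "'i set \<Rightarrow> ('i \<Rightarrow> real) measure" where
  "std_normal_vec I \<equiv> PiM I (\<lambda>_. std_normal)"

definition shift :: "'i set \<Rightarrow> ('i \<Rightarrow> real) \<Rightarrow> ('i \<Rightarrow> real) \<Rightarrow> 'i \<Rightarrow> real" where
  "shift I m e = (\<lambda>i\<in>I. m i + e i)"

text \<open>
  The density of the standard Gaussian vector shifted by \<open>b\<close> with respect to the unshifted one.
\<close>

definition tilt :: "'i set \<Rightarrow> ('i \<Rightarrow> real) \<Rightarrow> ('i \<Rightarrow> real) \<Rightarrow> real" where
  "tilt I b e = exp (\<Sum>i\<in>I. b i * e i - (b i)\<^sup>2 / 2)"

lemma shift_measurable [measurable]: "shift I m \<in> std_normal_vec I \<rightarrow>\<^sub>M std_normal_vec I"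
  unfolding shift_def
proof (rule measurable_restrict)
  fix i assume "i \<in> I"
  then have "(\<lambda>e. e i) \<in> std_normal_vec I \<rightarrow>\<^sub>M std_normal" by (rule measurable_component_singleton)
  then have "(\<lambda>e. e i) \<in> borel_measurable (std_normal_vec I)" by simp
  then show "(\<lambda>e. m i + e i) \<in> std_normal_vec I \<rightarrow>\<^sub>M std_normal" by simp
qed

lemma tilt_measurable [measurable]: "tilt I b \<in> borel_measurable (std_normal_vec I)"
proof -
  have "(\<lambda>e. e i) \<in> borel_measurable (std_normal_vec I)" if "i \<in> I" for i
    using measurable_component_singleton[OF that, of "\<lambda>_. std_normal"] by simp
  then have "(\<lambda>e. exp (\<Sum>i\<in>I. b i * e i - (b i)\<^sup>2 / 2)) \<in> borel_measurable (std_normal_vec I)"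
    by (intro measurable_compose[OF _ borel_measurable_exp] borel_measurable_sum borel_measurable_diff borel_measurable_times) auto
  then show ?thesis unfolding tilt_def[abs_def] .
qed

lemma std_normal_vec_shift:
  assumes I: "finite I"
  shows "distr (std_normal_vec I) (std_normal_vec I) (shift I b) = density (std_normal_vec I) (\<lambda>e. ennreal (tilt I b e))"
proof -
  define N where "N i = density std_normal (\<lambda>x. ennreal (exp (b i * x - (b i)\<^sup>2 / 2)))" for i
  have sN: "sets (N i) = sets borel" for i by (simp add: N_def)
  interpret S: product_sigma_finite "\<lambda>_::'a. std_normal" by (rule product_sigma_finite_std_normal)
  have pN: "prob_space (N i)" for i
    unfolding N_def std_normal_shift[symmetric]
    by (intro prob_space.prob_space_distr prob_space_normal_density) auto
  interpret N: product_sigma_finite N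
    unfolding product_sigma_finite_def using pN by (intro allI prob_space_imp_sigma_finite)
  have sP: "sets (PiM I N) = sets (std_normal_vec I)" by (intro sets_PiM_cong) (simp_all add: sN)
  have "distr (std_normal_vec I) (std_normal_vec I) (shift I b) = PiM I N"
  proof (rule N.PiM_eqI[OF I])
    show "sets (distr (std_normal_vec I) (std_normal_vec I) (shift I b)) = sets (PiM I N)" by (simp add: sP)
    fix A assume "\<And>i. i \<in> I \<Longrightarrow> A i \<in> sets (N i)"
    then have A: "\<And>i. i \<in> I \<Longrightarrow> A i \<in> sets borel" by (simp add: sN)
    have "emeasure (distr (std_normal_vec I) (std_normal_vec I) (shift I b)) (PiE I A) =
      emeasure (std_normal_vec I) (shift I b -` PiE I A \<inter> space (std_normal_vec I))"
      using A I by (intro emeasure_distr shift_measurable) (auto intro!: sets_PiM_I_finite)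
    also have "shift I b -` PiE I A \<inter> space (std_normal_vec I) = PiE I (\<lambda>i. (\<lambda>x. b i + x) -` A i \<inter> space std_normal)"
      by (auto simp: space_PiM shift_def PiE_iff)
    also have "emeasure (std_normal_vec I) \<dots> = (\<Prod>i\<in>I. emeasure std_normal ((\<lambda>x. b i + x) -` A i \<inter> space std_normal))"
    proof (rule S.emeasure_PiM[OF I])
      fix i assume "i \<in> I"
      then have "A i \<in> sets std_normal" using A by simp
      moreover have "(\<lambda>x. b i + x) \<in> std_normal \<rightarrow>\<^sub>M std_normal" by simp
      ultimately show "(\<lambda>x. b i + x) -` A i \<inter> space std_normal \<in> sets std_normal" by (rule measurable_sets[rotated])
    qed
    also have "\<dots> = (\<Prod>i\<in>I. emeasure (N i) (A i))"
    proof (rule prod.cong[OF refl])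
      fix i assume "i \<in> I"
      then show "emeasure std_normal ((\<lambda>x. b i + x) -` A i \<inter> space std_normal) = emeasure (N i) (A i)"
        unfolding N_def std_normal_shift[symmetric] using A by (intro emeasure_distr[symmetric]) auto
    qed
    finally show "emeasure (distr (std_normal_vec I) (std_normal_vec I) (shift I b)) (PiE I A) = (\<Prod>i\<in>I. emeasure (N i) (A i))" .
  qed
  also have "PiM I N = density (std_normal_vec I) (\<lambda>e. ennreal (tilt I b e))"
  proof (rule N.PiM_eqI[OF I, symmetric])
    show "sets (density (std_normal_vec I) (\<lambda>e. ennreal (tilt I b e))) = sets (PiM I N)" by (simp add: sP)
    fix A assume "\<And>i. i \<in> I \<Longrightarrow> A i \<in> sets (N i)"
    then have A: "\<And>i. i \<in> I \<Longrightarrow> A i \<in> sets borel" by (simp add: sN)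
    let ?g = "\<lambda>i x. ennreal (exp (b i * x - (b i)\<^sup>2 / 2)) * indicator (A i) x"
    have "emeasure (density (std_normal_vec I) (\<lambda>e. ennreal (tilt I b e))) (PiE I A) =
        (\<integral>\<^sup>+e. ennreal (tilt I b e) * indicator (PiE I A) e \<partial>std_normal_vec I)"
      using A I by (intro emeasure_density) (auto intro!: sets_PiM_I_finite)
    also have "\<dots> = (\<integral>\<^sup>+e. (\<Prod>i\<in>I. ?g i (e i)) \<partial>std_normal_vec I)"
    proof (rule nn_integral_cong)
      fix e assume e: "e \<in> space (std_normal_vec I)"
      have "ennreal (tilt I b e) = (\<Prod>i\<in>I. ennreal (exp (b i * e i - (b i)\<^sup>2 / 2)))"
        unfolding tilt_def using I by (simp add: exp_sum prod_ennreal)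
      moreover have "indicator (PiE I A) e = (\<Prod>i\<in>I. indicator (A i) (e i) :: ennreal)"
        using e by (intro indicator_PiE_eq_prod I) (simp add: space_PiM PiE_def)
      ultimately show "ennreal (tilt I b e) * indicator (PiE I A) e = (\<Prod>i\<in>I. ?g i (e i))"
        by (simp add: prod.distrib)
    qed
    also have "\<dots> = (\<Prod>i\<in>I. \<integral>\<^sup>+x. ?g i x \<partial>std_normal)"
      using A by (intro S.product_nn_integral_prod[OF I]) auto
    also have "\<dots> = (\<Prod>i\<in>I. emeasure (N i) (A i))"
      unfolding N_def using A by (intro prod.cong refl emeasure_density[symmetric]) auto
    finally show "emeasure (density (std_normal_vec I) (\<lambda>e. ennreal (tilt I b e))) (PiE I A) = (\<Prod>i\<in>I. emeasure (N i) (A i))" .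
  qed
  finally show ?thesis .
qed

lemma prob_space_std_normal_vec: "prob_space (std_normal_vec I)"
  by (intro prob_space_PiM prob_space_normal_density) simp

lemma tilt_integral:
  assumes I: "finite I"
  shows "integrable (std_normal_vec I) (tilt I b)" "(\<integral>e. tilt I b e \<partial>std_normal_vec I) = 1"
proof -
  interpret prob_space "std_normal_vec I" by (rule prob_space_std_normal_vec)
  interpret D: prob_space "distr (std_normal_vec I) (std_normal_vec I) (shift I b)"
    by (intro prob_space_distr shift_measurable)
  have "emeasure (density (std_normal_vec I) (\<lambda>e. ennreal (tilt I b e))) (space (std_normal_vec I)) = 1"
    using D.emeasure_space_1 unfolding std_normal_vec_shift[OF I] by simp
  then have 1: "(\<integral>\<^sup>+e. ennreal (tilt I b e) \<partial>std_normal_vec I) = 1"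
    by (subst (asm) emeasure_density) (auto cong: nn_integral_cong)
  show int: "integrable (std_normal_vec I) (tilt I b)"
    using 1 by (intro integrableI_nonneg) (auto simp: tilt_def)
  have "ennreal (\<integral>e. tilt I b e \<partial>std_normal_vec I) = 1"
    using 1 int by (subst nn_integral_eq_integral[symmetric]) (auto simp: tilt_def)
  then show "(\<integral>e. tilt I b e \<partial>std_normal_vec I) = 1" by (simp add: ennreal_eq_1)
qed

text \<open>
  Completing the square; as each tilt has integral \<open>1\<close>, the inner product of two tilts in \<open>L\<^sup>2\<close> is the
  exponential of the inner product of the shifts.
\<close>

lemma tilt_mult: "tilt I a e * tilt I b e = exp (\<Sum>i\<in>I. a i * b i) * tilt I (\<lambda>i. a i + b i) e"
  unfolding tilt_def exp_add[symmetric] sum.distrib[symmetric]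
  by (intro arg_cong[where f = exp] sum.cong refl) (simp add: power2_eq_square field_simps)

text \<open>
  A signed mixture of shifted Gaussian laws acts on a bounded function with at most the \<open>L\<^sup>2\<close>
  norm of its density relative to any one reference law; the reference is the Gaussian law
  centred at \<open>m\<close>.
\<close>

lemma gaussian_mixture_bound:
  fixes T :: "('i \<Rightarrow> real) \<Rightarrow> real"
  assumes I: "finite I" and T: "T \<in> borel_measurable (std_normal_vec I)" and B: "\<And>x. \<bar>T x\<bar> \<le> B"
    and S: "finite S"
  shows "\<bar>\<Sum>a\<in>S. c a * (\<integral>e. T (shift I (\<lambda>i. m i + b a i) e) \<partial>std_normal_vec I)\<bar>
    \<le> B * sqrt (\<Sum>a\<in>S. \<Sum>a'\<in>S. c a * c a' * exp (\<Sum>i\<in>I. b a i * b a' i))"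
proof -
  let ?G = "std_normal_vec I"
  interpret prob_space ?G by (rule prob_space_std_normal_vec)
  define T' where "T' e = T (shift I m e)" for e
  have T'[measurable]: "T' \<in> borel_measurable ?G"
    unfolding T'_def using measurable_compose[OF shift_measurable T] .
  have B': "\<bar>T' e\<bar> \<le> B" for e unfolding T'_def by (rule B)
  have sh: "T (shift I (\<lambda>i. m i + b a i) e) = T' (shift I (b a) e)" for a e
    unfolding T'_def by (rule arg_cong[where f = T]) (auto simp: shift_def restrict_def)
  define L where "L a = tilt I (b a)" for a
  have Lm[measurable]: "L a \<in> borel_measurable ?G" for a unfolding L_def by simp
  have Li: "integrable ?G (L a)" for a unfolding L_def by (rule tilt_integral[OF I])
  have TL: "integrable ?G (\<lambda>e. T' e * L a e)" for a
  proof (rule Bochner_Integration.integrable_bound[where f = "\<lambda>e. B * L a e"])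
    show "integrable ?G (\<lambda>e. B * L a e)" using Li[of a] by simp
    show "AE e in ?G. norm (T' e * L a e) \<le> norm (B * L a e)"
    proof (rule AE_I2)
      fix e
      have "\<bar>T' e\<bar> \<le> \<bar>B\<bar>" using B'[of e] by linarith
      then show "norm (T' e * L a e) \<le> norm (B * L a e)"
        by (simp add: abs_mult mult_right_mono)
    qed
  qed measurable
  have int: "(\<integral>e. T (shift I (\<lambda>i. m i + b a i) e) \<partial>?G) = (\<integral>e. T' e * L a e \<partial>?G)" for a
  proof -
    have "(\<integral>e. T (shift I (\<lambda>i. m i + b a i) e) \<partial>?G) = (\<integral>e. T' e \<partial>distr ?G ?G (shift I (b a)))"
      unfolding sh by (rule integral_distr[symmetric]) auto
    also have "\<dots> = (\<integral>e. L a e *\<^sub>R T' e \<partial>?G)"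
      unfolding std_normal_vec_shift[OF I] L_def by (rule integral_density) (auto simp: tilt_def)
    finally show ?thesis by (simp add: mult.commute)
  qed
  define F where "F e = (\<Sum>a\<in>S. c a * L a e)" for e
  have Fm[measurable]: "F \<in> borel_measurable ?G" unfolding F_def by measurable
  have Fi: "integrable ?G F" unfolding F_def using Li by auto
  have LL: "integrable ?G (\<lambda>e. L a e * L a' e)" "(\<integral>e. L a e * L a' e \<partial>?G) = exp (\<Sum>i\<in>I. b a i * b a' i)" for a a'
    unfolding L_def tilt_mult using tilt_integral[OF I] by auto
  have F2: "(F e)\<^sup>2 = (\<Sum>a\<in>S. \<Sum>a'\<in>S. (c a * c a') * (L a e * L a' e))" for e
    unfolding F_def power2_eq_square sum_product by (intro sum.cong refl) (simp only: mult_ac)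
  have F2i: "integrable ?G (\<lambda>e. (F e)\<^sup>2)" unfolding F2 using LL by auto
  have F2e: "(\<integral>e. (F e)\<^sup>2 \<partial>?G) = (\<Sum>a\<in>S. \<Sum>a'\<in>S. c a * c a' * exp (\<Sum>i\<in>I. b a i * b a' i))"
    unfolding F2 using LL by (subst Bochner_Integration.integral_sum, force)+ (simp add: LL(2))
  have B0: "B \<ge> 0" using B[of undefined] by linarith
  have "(\<Sum>a\<in>S. c a * (\<integral>e. T (shift I (\<lambda>i. m i + b a i) e) \<partial>?G)) = (\<integral>e. (\<Sum>a\<in>S. c a * (T' e * L a e)) \<partial>?G)"
    unfolding int using TL by (subst Bochner_Integration.integral_sum) auto
  also have "\<dots> = (\<integral>e. T' e * F e \<partial>?G)"
    unfolding F_def sum_distrib_left by (intro Bochner_Integration.integral_cong sum.cong refl) simp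
  finally have "\<bar>\<Sum>a\<in>S. c a * (\<integral>e. T (shift I (\<lambda>i. m i + b a i) e) \<partial>?G)\<bar> = \<bar>\<integral>e. T' e * F e \<partial>?G\<bar>" by simp
  also have "\<dots> \<le> (\<integral>e. \<bar>T' e * F e\<bar> \<partial>?G)" by (rule integral_abs_bound)
  also have "\<dots> \<le> (\<integral>e. B * \<bar>F e\<bar> \<partial>?G)"
  proof (rule integral_mono')
    show "integrable ?G (\<lambda>e. B * \<bar>F e\<bar>)" using Fi by auto
    show "\<bar>T' e * F e\<bar> \<le> B * \<bar>F e\<bar>" for e unfolding abs_mult using B' by (intro mult_right_mono) auto
  qed (use B0 in auto)
  also have "\<dots> = B * expectation (\<lambda>e. \<bar>F e\<bar>)" by simp
  also have "\<dots> \<le> B * sqrt (\<integral>e. (F e)\<^sup>2 \<partial>?G)"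
  proof (rule mult_left_mono[OF _ B0], rule real_le_rsqrt)
    have "variance (\<lambda>e. \<bar>F e\<bar>) = expectation (\<lambda>e. \<bar>F e\<bar>\<^sup>2) - (expectation (\<lambda>e. \<bar>F e\<bar>))\<^sup>2"
      using Fi F2i by (intro variance_eq) auto
    then show "(expectation (\<lambda>e. \<bar>F e\<bar>))\<^sup>2 \<le> (\<integral>e. (F e)\<^sup>2 \<partial>?G)"
      using variance_positive[of "\<lambda>e. \<bar>F e\<bar>"] by simp
  qed
  finally show ?thesis unfolding F2e .
qed

section \<open>Singular values of a matrix given by its singular value decomposition\<close>

lemma char_poly_orthogonal_diag:
  fixes v :: "nat \<times> nat \<Rightarrow> real" and d :: "nat \<Rightarrow> real"
  assumes v: "\<And>l l'. l < q \<Longrightarrow> l' < q \<Longrightarrow> (\<Sum>b<q. v (b, l) * v (b, l')) = (if l = l' then 1 else 0)"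
    and G: "G = Matrix.mat q q (\<lambda>(b, b'). \<Sum>j<q. d j * v (b, j) * v (b', j))"
  shows "char_poly G = (\<Prod>j\<leftarrow>[0..<q]. [:- d j, 1:])"
proof -
  define V where "V = Matrix.mat q q v"
  define D where "D = Matrix.mat q q (\<lambda>(i, j). if i = j then d i else 0)"
  have V: "V \<in> carrier_mat q q" "transpose_mat V \<in> carrier_mat q q" and D: "D \<in> carrier_mat q q"
    by (auto simp: V_def D_def)
  have VV: "transpose_mat V * V = 1\<^sub>m q"
  proof (rule eq_matI)
    fix i j assume "i < dim_row (1\<^sub>m q)" "j < dim_col (1\<^sub>m q)"
    then show "(transpose_mat V * V) $$ (i, j) = 1\<^sub>m q $$ (i, j)"
      using v[of i j] by (auto simp: V_def scalar_prod_def lessThan_atLeast0)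
  qed (auto simp: V_def)
  have VV': "V * transpose_mat V = 1\<^sub>m q" by (rule mat_mult_left_right_inverse[OF V(2,1) VV])
  have DV: "V * D = Matrix.mat q q (\<lambda>(b, j). v (b, j) * d j)"
    by (rule eq_matI) (auto simp: V_def D_def scalar_prod_def if_distrib[of "\<lambda>x. _ * x"] sum.delta cong: if_cong)
  have "G = V * D * transpose_mat V"
    unfolding DV G by (rule eq_matI) (auto simp: V_def scalar_prod_def lessThan_atLeast0 intro!: sum.cong)
  then have "similar_mat_wit G D V (transpose_mat V)"
    unfolding similar_mat_wit_def Let_def using V D VV VV' by (auto simp: G)
  then have "char_poly G = char_poly D" by (intro char_poly_similar) (auto simp: similar_mat_def)
  also have "\<dots> = (\<Prod>a\<leftarrow>diag_mat D. [:- a, 1:])"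
    by (rule char_poly_upper_triangular[OF D]) (auto simp: D_def upper_triangular_def)
  also have "diag_mat D = map d [0..<q]"
    by (auto simp: diag_mat_def D_def)
  finally show ?thesis by (simp add: comp_def)
qed

context
  fixes p q n :: nat and u v :: "nat \<times> nat \<Rightarrow> real" and s :: "nat \<Rightarrow> real" and A :: "real mat"
  assumes n: "n \<le> q"
    and u: "\<And>l l'. l < n \<Longrightarrow> l' < n \<Longrightarrow> (\<Sum>a<p. u (a, l) * u (a, l')) = (if l = l' then 1 else 0)"
    and v: "\<And>l l'. l < q \<Longrightarrow> l' < q \<Longrightarrow> (\<Sum>b<q. v (b, l) * v (b, l')) = (if l = l' then 1 else 0)"
    and s: "\<And>j. j < n \<Longrightarrow> s j \<ge> 0"
    and A: "A = Matrix.mat p q (\<lambda>(a, b). \<Sum>j<n. s j * u (a, j) * v (b, j))"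
begin

text \<open>
  Because the first \<open>n\<close> columns of \<open>u\<close> are orthonormal, \<open>A\<^sup>T A\<close> is diagonalised by \<open>v\<close> with eigenvalues
  \<open>(s j)\<^sup>2\<close> and \<open>0\<close>.
\<close>

lemma mset_sing_vals_svd: "mset (sing_vals A) = image_mset (\<lambda>j. if j < n then s j else 0) (mset_set {..<q})"
proof -
  define d where "d j = (if j < n then (s j)\<^sup>2 else 0)" for j
  have "transpose_mat A * A = Matrix.mat q q (\<lambda>(b, b'). \<Sum>j<q. d j * v (b, j) * v (b', j))"
  proof (rule eq_matI)
    fix b b' assume "b < dim_row (Matrix.mat q q (\<lambda>(b, b'). \<Sum>j<q. d j * v (b, j) * v (b', j)))"
      "b' < dim_col (Matrix.mat q q (\<lambda>(b, b'). \<Sum>j<q. d j * v (b, j) * v (b', j)))"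
    then have b: "b < q" "b' < q" by auto
    have "(transpose_mat A * A) $$ (b, b') = (\<Sum>a<p. (\<Sum>j<n. s j * u (a, j) * v (b, j)) * (\<Sum>j<n. s j * u (a, j) * v (b', j)))"
      using b by (simp add: A scalar_prod_def lessThan_atLeast0)
    also have "\<dots> = (\<Sum>a<p. \<Sum>j<n. \<Sum>j'<n. (s j * v (b, j) * s j' * v (b', j')) * (u (a, j) * u (a, j')))"
      unfolding sum_product by (intro sum.cong refl) (simp only: mult_ac)
    also have "\<dots> = (\<Sum>j<n. \<Sum>j'<n. \<Sum>a<p. (s j * v (b, j) * s j' * v (b', j')) * (u (a, j) * u (a, j')))"
      by (subst sum.swap) (intro sum.cong refl sum.swap)
    also have "\<dots> = (\<Sum>j<n. \<Sum>j'<n. if j = j' then s j * v (b, j) * s j' * v (b', j') else 0)"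
      unfolding sum_distrib_left[symmetric] by (intro sum.cong refl) (simp add: u)
    also have "\<dots> = (\<Sum>j<n. d j * v (b, j) * v (b', j))"
      by (intro sum.cong refl) (simp add: d_def power2_eq_square)
    also have "\<dots> = (\<Sum>j<q. d j * v (b, j) * v (b', j))"
      using n by (intro sum.mono_neutral_left) (auto simp: d_def)
    finally show "(transpose_mat A * A) $$ (b, b') = Matrix.mat q q (\<lambda>(b, b'). \<Sum>j<q. d j * v (b, j) * v (b', j)) $$ (b, b')"
      using b by simp
  qed (auto simp: A)
  from char_poly_orthogonal_diag[OF v this] have "char_poly (transpose_mat A * A) = (\<Prod>j\<leftarrow>[0..<q]. [:- d j, 1:])" by simp
  also have "\<dots> = (\<Prod>j\<in>{..<q}. [:- d j, 1:])"
    by (simp add: prod.distinct_set_conv_list[symmetric] lessThan_atLeast0)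
  also have "proots \<dots> = (\<Sum>j\<in>{..<q}. {#d j#})"
    by (subst proots_prod) auto
  also have "\<dots> = image_mset d (mset_set {..<q})"
    by (induction q) (auto simp: lessThan_Suc)
  finally have "proots (char_poly (transpose_mat A * A)) = image_mset d (mset_set {..<q})" .
  then have "mset (sing_vals A) = image_mset (sqrt \<circ> d) (mset_set {..<q})"
    by (simp add: sing_vals_def multiset.map_comp)
  also have "\<dots> = image_mset (\<lambda>j. if j < n then s j else 0) (mset_set {..<q})"
    by (intro image_mset_cong) (auto simp: d_def s)
  finally show ?thesis .
qed

lemma spectral_sum_svd: "spectral_sum f A = (\<Sum>j<n. f (s j)) + real (q - n) * f 0"
proof -
  have "length (sing_vals A) = size (mset (sing_vals A))" by simp
  also have "\<dots> = q" unfolding mset_sing_vals_svd by simp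
  finally have len: "length (sing_vals A) = q" .
  have "spectral_sum f A = (\<Sum>i\<in>{1..q}. f (sing_vals A ! (i - 1)))"
    by (simp add: spectral_sum_def sing_val_def A)
  also have "\<dots> = (\<Sum>i<q. f (sing_vals A ! i))"
    by (rule sum.reindex_bij_witness[of _ Suc "\<lambda>i. i - 1"]) auto
  also have "\<dots> = sum_list (map f (sing_vals A))"
    by (simp add: sum_list_sum_nth len lessThan_atLeast0)
  also have "\<dots> = sum_mset (image_mset f (mset (sing_vals A)))"
    by (simp add: sum_mset_sum_list[symmetric])
  also have "\<dots> = (\<Sum>j<q. f (if j < n then s j else 0))"
    unfolding mset_sing_vals_svd by (simp add: sum_unfold_sum_mset multiset.map_comp comp_def)
  also have "\<dots> = (\<Sum>j<n. f (s j)) + (\<Sum>j\<in>{n..<q}. f 0)"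
  proof -
    have "{..<q} = {..<n} \<union> {n..<q}" using n by auto
    then show ?thesis by (simp add: sum.union_disjoint ivl_disj_int)
  qed
  finally show ?thesis by simp
qed

lemma op_norm_svd:
  assumes "q > 0" "r \<ge> 0" "\<And>j. j < n \<Longrightarrow> s j \<le> r"
  shows "op_norm A \<le> r"
proof -
  have "length (sing_vals A) = size (mset (sing_vals A))" by simp
  also have "\<dots> = q" unfolding mset_sing_vals_svd by simp
  finally have "op_norm A \<in> set (sing_vals A)"
    using assms(1) by (simp add: op_norm_def sing_val_def)
  also have "set (sing_vals A) = set_mset (mset (sing_vals A))" by simp
  also have "\<dots> = (\<lambda>j. if j < n then s j else 0) ` {..<q}" unfolding mset_sing_vals_svd by simp
  finally show ?thesis using assms by auto
qed

end

section \<open>Moving a single singular value\<close>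

definition svd_mean :: "nat \<Rightarrow> (nat \<times> nat \<Rightarrow> real) \<Rightarrow> (nat \<times> nat \<Rightarrow> real) \<Rightarrow> (nat \<Rightarrow> real) \<Rightarrow> nat \<times> nat \<Rightarrow> real" where
  "svd_mean n u v s = (\<lambda>(a, b). \<Sum>j<n. s j * u (a, j) * v (b, j))"

lemma abs_integral_le_prob:
  fixes h :: "'a \<Rightarrow> real"
  assumes M: "prob_space M" and AE: "AE x in M. \<bar>h x\<bar> \<le> \<eta>" and h: "h \<in> borel_measurable M"
  shows "\<bar>\<integral>x. h x \<partial>M\<bar> \<le> \<eta>"
proof -
  interpret prob_space M by fact
  have int: "integrable M h" using AE h by (intro integrable_const_bound[where B = \<eta>]) auto
  have "\<bar>\<integral>x. h x \<partial>M\<bar> \<le> (\<integral>x. \<bar>h x\<bar> \<partial>M)" by (rule integral_abs_bound)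
  also have "\<dots> \<le> (\<integral>x. \<eta> \<partial>M)" using int AE by (intro integral_mono_AE) auto
  finally show ?thesis by (simp add: prob_space)
qed

lemma spread_col_inner:
  fixes u :: "nat \<times> nat \<Rightarrow> real"
  assumes u: "\<And>l l'. l < N \<Longrightarrow> l' < N \<Longrightarrow> (\<Sum>k<N. u (k, l) * u (k, l')) = (if l = l' then 1 else 0)" and n: "n \<le> N"
  shows "(\<Sum>k<N. spread_col n (N - n) \<epsilon> u k * spread_col n (N - n) \<delta> u k) = sign_corr {n..<N} \<epsilon> \<delta>"
proof -
  let ?J = "{n..<N}" and ?d = "real (N - n)"
  have "(\<Sum>k<N. spread_col n (N - n) \<epsilon> u k * spread_col n (N - n) \<delta> u k) =
      (\<Sum>k<N. \<Sum>j\<in>?J. \<Sum>j'\<in>?J. (\<epsilon> j * \<delta> j' / ?d) * (u (k, j) * u (k, j')))"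
  proof (intro sum.cong refl)
    fix k
    have "spread_col n (N - n) \<epsilon> u k * spread_col n (N - n) \<delta> u k =
        (\<Sum>j\<in>?J. \<epsilon> j * u (k, j)) * (\<Sum>j\<in>?J. \<delta> j * u (k, j)) / ?d"
      using n by (simp add: spread_col_def)
    also have "\<dots> = (\<Sum>j\<in>?J. \<Sum>j'\<in>?J. (\<epsilon> j * \<delta> j' / ?d) * (u (k, j) * u (k, j')))"
      unfolding sum_product sum_divide_distrib by (intro sum.cong refl) simp
    finally show "spread_col n (N - n) \<epsilon> u k * spread_col n (N - n) \<delta> u k =
        (\<Sum>j\<in>?J. \<Sum>j'\<in>?J. (\<epsilon> j * \<delta> j' / ?d) * (u (k, j) * u (k, j')))" .
  qed
  also have "\<dots> = (\<Sum>j\<in>?J. \<Sum>j'\<in>?J. \<Sum>k<N. (\<epsilon> j * \<delta> j' / ?d) * (u (k, j) * u (k, j')))"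
    by (subst sum.swap) (intro sum.cong refl sum.swap)
  also have "\<dots> = (\<Sum>j\<in>?J. \<Sum>j'\<in>?J. if j = j' then \<epsilon> j * \<delta> j' / ?d else 0)"
    unfolding sum_distrib_left[symmetric] by (intro sum.cong refl) (simp add: u)
  also have "\<dots> = (\<Sum>j\<in>?J. \<epsilon> j * \<delta> j / ?d)" by simp
  finally show ?thesis by (simp add: sign_corr_def sum_divide_distrib)
qed

text \<open>
  The mean of the estimator \<open>T0\<close>, written as a function of the entries of the observation, at the
  matrix with singular values \<open>s\<close> and singular vectors in the first \<open>n\<close> columns of \<open>u\<close> and \<open>v\<close>.
\<close>

definition est_mean :: "nat \<Rightarrow> nat \<Rightarrow> nat \<Rightarrow> ((nat \<times> nat \<Rightarrow> real) \<Rightarrow> real) \<Rightarrow>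
    (nat \<times> nat \<Rightarrow> real) \<Rightarrow> (nat \<times> nat \<Rightarrow> real) \<Rightarrow> (nat \<Rightarrow> real) \<Rightarrow> real" where
  "est_mean p q n T0 u v s = (\<integral>e. T0 (shift ({..<p} \<times> {..<q}) (svd_mean n u v s) e) \<partial>gauss_noise p q)"

definition frame_pair_integral ::
    "nat \<Rightarrow> nat \<Rightarrow> ((nat \<times> nat \<Rightarrow> real) \<Rightarrow> (nat \<times> nat \<Rightarrow> real) \<Rightarrow> real) \<Rightarrow> real" where
  "frame_pair_integral p q g = (\<integral>u. \<integral>v. g u v \<partial>frame_law q \<partial>frame_law p)"

definition avg_mean :: "nat \<Rightarrow> nat \<Rightarrow> nat \<Rightarrow> ((nat \<times> nat \<Rightarrow> real) \<Rightarrow> real) \<Rightarrow> (nat \<Rightarrow> real) \<Rightarrow> real" where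
  "avg_mean p q n T0 s = frame_pair_integral p q (\<lambda>u v. est_mean p q n T0 u v s)"

lemma frame_comp: "a < N \<Longrightarrow> j < N \<Longrightarrow> (\<lambda>u. u (a, j)) \<in> borel_measurable (frame_law N)"
  unfolding measurable_cong_sets[OF sets_frame_law refl] by (intro measurable_component_singleton) auto

lemma frame_pair_integral_sum:
  assumes S: "finite S" and g: "\<And>a. a \<in> S \<Longrightarrow> (\<lambda>z. g a (fst z) (snd z)) \<in> borel_measurable (frame_law p \<Otimes>\<^sub>M frame_law q)"
    and bd: "\<And>a u v. a \<in> S \<Longrightarrow> \<bar>g a u v\<bar> \<le> B"
  shows "(\<Sum>a\<in>S. c a * frame_pair_integral p q (g a)) = frame_pair_integral p q (\<lambda>u v. \<Sum>a\<in>S. c a * g a u v)"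
proof -
  interpret P: prob_space "frame_law p" by (rule prob_space_frame_law)
  interpret Q: prob_space "frame_law q" by (rule prob_space_frame_law)
  have iv: "integrable (frame_law q) (g a u)" if "a \<in> S" "u \<in> space (frame_law p)" for a u
  proof (rule Q.integrable_const_bound[where B = B])
    show "g a u \<in> borel_measurable (frame_law q)"
      using measurable_compose[OF measurable_Pair1'[OF that(2)] g[OF that(1)]] by simp
  qed (use bd that in auto)
  have mu: "(\<lambda>u. \<integral>v. g a u v \<partial>frame_law q) \<in> borel_measurable (frame_law p)" if "a \<in> S" for a
    using g[OF that] by (intro Q.borel_measurable_lebesgue_integral) (simp add: case_prod_unfold)
  have iu: "integrable (frame_law p) (\<lambda>u. \<integral>v. g a u v \<partial>frame_law q)" if "a \<in> S" for a
  proof (rule P.integrable_const_bound[where B = B])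
    show "AE u in frame_law p. norm (\<integral>v. g a u v \<partial>frame_law q) \<le> B"
    proof (rule AE_I2)
      fix u assume u: "u \<in> space (frame_law p)"
      show "norm (\<integral>v. g a u v \<partial>frame_law q) \<le> B"
        unfolding real_norm_def using iv[OF that u] bd[OF that]
        by (intro abs_integral_le_prob[OF prob_space_frame_law]) auto
    qed
  qed (rule mu[OF that])
  have "(\<Sum>a\<in>S. c a * frame_pair_integral p q (g a)) = (\<integral>u. (\<Sum>a\<in>S. c a * (\<integral>v. g a u v \<partial>frame_law q)) \<partial>frame_law p)"
    unfolding frame_pair_integral_def using iu by (subst Bochner_Integration.integral_sum) auto
  also have "\<dots> = frame_pair_integral p q (\<lambda>u v. \<Sum>a\<in>S. c a * g a u v)"
    unfolding frame_pair_integral_def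
  proof (rule Bochner_Integration.integral_cong[OF refl])
    fix u assume "u \<in> space (frame_law p)"
    then show "(\<Sum>a\<in>S. c a * (\<integral>v. g a u v \<partial>frame_law q)) = (\<integral>v. (\<Sum>a\<in>S. c a * g a u v) \<partial>frame_law q)"
      using iv by (subst Bochner_Integration.integral_sum) auto
  qed
  finally show ?thesis .
qed

lemma frame_pair_integral_bound:
  assumes g: "(\<lambda>z. g (fst z) (snd z)) \<in> borel_measurable (frame_law p \<Otimes>\<^sub>M frame_law q)"
    and bd: "\<And>u v. (\<And>l l'. l < p \<Longrightarrow> l' < p \<Longrightarrow> (\<Sum>k<p. u (k, l) * u (k, l')) = (if l = l' then 1 else 0)) \<Longrightarrow>
       (\<And>l l'. l < q \<Longrightarrow> l' < q \<Longrightarrow> (\<Sum>k<q. v (k, l) * v (k, l')) = (if l = l' then 1 else 0)) \<Longrightarrow> \<bar>g u v\<bar> \<le> \<eta>"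
  shows "\<bar>frame_pair_integral p q g\<bar> \<le> \<eta>"
  unfolding frame_pair_integral_def
proof (rule abs_integral_le_prob[OF prob_space_frame_law])
  interpret Q: prob_space "frame_law q" by (rule prob_space_frame_law)
  show "(\<lambda>u. \<integral>v. g u v \<partial>frame_law q) \<in> borel_measurable (frame_law p)"
    using g by (intro Q.borel_measurable_lebesgue_integral) (simp add: case_prod_unfold)
  show "AE u in frame_law p. \<bar>\<integral>v. g u v \<partial>frame_law q\<bar> \<le> \<eta>"
    using frame_law_orthonormal[of p]
  proof (rule AE_mp, intro AE_I2 impI)
    fix u assume u: "u \<in> space (frame_law p)"
      and o: "\<forall>l<p. \<forall>l'<p. (\<Sum>k<p. u (k, l) * u (k, l')) = (if l = l' then 1 else 0)"
    show "\<bar>\<integral>v. g u v \<partial>frame_law q\<bar> \<le> \<eta>"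
    proof (rule abs_integral_le_prob[OF prob_space_frame_law])
      show "g u \<in> borel_measurable (frame_law q)"
        using measurable_compose[OF measurable_Pair1'[OF u] g] by simp
      show "AE v in frame_law q. \<bar>g u v\<bar> \<le> \<eta>"
        using frame_law_orthonormal[of q]
        by (rule AE_mp) (intro AE_I2 impI bd, use o in auto)
    qed
  qed
qed

context
  fixes p q n :: nat and T0 :: "(nat \<times> nat \<Rightarrow> real) \<Rightarrow> real" and B :: real
  assumes nq: "n < q" and qp: "q \<le> p"
    and T0: "T0 \<in> borel_measurable (PiM ({..<p} \<times> {..<q}) (\<lambda>_. borel))"
    and B: "\<And>e. \<bar>T0 e\<bar> \<le> B"
begin

lemma est_mean_cong:
  assumes "\<And>a b. a < p \<Longrightarrow> b < q \<Longrightarrow> svd_mean n u v s (a, b) = svd_mean n u' v' s' (a, b)"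
  shows "est_mean p q n T0 u v s = est_mean p q n T0 u' v' s'"
proof -
  have "shift ({..<p} \<times> {..<q}) (svd_mean n u v s) e = shift ({..<p} \<times> {..<q}) (svd_mean n u' v' s') e" for e
    unfolding shift_def using assms by (auto simp: restrict_def)
  then show ?thesis by (simp add: est_mean_def)
qed

lemma est_mean_measurable:
  assumes U: "\<And>a j. a < p \<Longrightarrow> j < n \<Longrightarrow> (\<lambda>\<omega>. U \<omega> (a, j)) \<in> borel_measurable N"
    and V: "\<And>b j. b < q \<Longrightarrow> j < n \<Longrightarrow> (\<lambda>\<omega>. V \<omega> (b, j)) \<in> borel_measurable N"
  shows "(\<lambda>\<omega>. est_mean p q n T0 (U \<omega>) (V \<omega>) s) \<in> borel_measurable N"
proof -
  interpret G: prob_space "gauss_noise p q" by (rule prob_space_gauss_noise)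
  let ?I = "{..<p} \<times> {..<q}"
  have "(\<lambda>z. shift ?I (svd_mean n (U (fst z)) (V (fst z)) s) (snd z)) \<in> N \<Otimes>\<^sub>M gauss_noise p q \<rightarrow>\<^sub>M PiM ?I (\<lambda>_. borel)"
    unfolding shift_def
  proof (rule measurable_restrict)
    fix ab assume ab: "ab \<in> ?I"
    have "(\<lambda>e. e ab) \<in> borel_measurable (gauss_noise p q)"
      unfolding measurable_cong_sets[OF sets_gauss_noise refl] using ab by (rule measurable_component_singleton)
    then have e: "(\<lambda>z. snd z ab) \<in> borel_measurable (N \<Otimes>\<^sub>M gauss_noise p q)"
      by (rule measurable_compose[OF measurable_snd])
    obtain a b where [simp]: "ab = (a, b)" and ab': "a < p" "b < q" using ab by auto
    have "(\<lambda>z. U (fst z) (a, j)) \<in> borel_measurable (N \<Otimes>\<^sub>M gauss_noise p q)"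
      "(\<lambda>z. V (fst z) (b, j)) \<in> borel_measurable (N \<Otimes>\<^sub>M gauss_noise p q)" if "j < n" for j
      using measurable_compose[OF measurable_fst U[OF ab'(1) that]] measurable_compose[OF measurable_fst V[OF ab'(2) that]] by auto
    then have "(\<lambda>z. \<Sum>j<n. s j * U (fst z) (a, j) * V (fst z) (b, j)) \<in> borel_measurable (N \<Otimes>\<^sub>M gauss_noise p q)"
      by (intro borel_measurable_sum borel_measurable_times borel_measurable_const) auto
    then show "(\<lambda>z. svd_mean n (U (fst z)) (V (fst z)) s ab + snd z ab) \<in> borel_measurable (N \<Otimes>\<^sub>M gauss_noise p q)"
      using e by (simp add: svd_mean_def)
  qed
  from measurable_compose[OF this T0]
  have "(\<lambda>(\<omega>, e). T0 (shift ?I (svd_mean n (U \<omega>) (V \<omega>) s) e)) \<in> borel_measurable (N \<Otimes>\<^sub>M gauss_noise p q)"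
    by (simp add: case_prod_unfold)
  then show ?thesis
    unfolding est_mean_def by (rule G.borel_measurable_lebesgue_integral)
qed

lemma T0_gauss: "T0 \<in> borel_measurable (gauss_noise p q)"
  unfolding measurable_cong_sets[OF sets_gauss_noise refl] by (rule T0)

lemma est_mean_bound: "\<bar>est_mean p q n T0 u v s\<bar> \<le> B"
  unfolding est_mean_def
proof (rule abs_integral_le_prob[OF prob_space_gauss_noise])
  show "(\<lambda>e. T0 (shift ({..<p} \<times> {..<q}) (svd_mean n u v s) e)) \<in> borel_measurable (gauss_noise p q)"
    using measurable_compose[OF shift_measurable] T0_gauss unfolding gauss_noise_def by blast
qed (use B in simp)

lemma spread_comp:
  assumes "a < N" "j < N" "n \<le> N"
  shows "(\<lambda>u. set_col N i (spread_col n (N - n) \<epsilon> u) u (a, j)) \<in> borel_measurable (frame_law N)"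
proof -
  have "(\<lambda>u. spread_col n (N - n) \<epsilon> u a) \<in> borel_measurable (frame_law N)"
    unfolding spread_col_def using assms
    by (intro borel_measurable_divide borel_measurable_sum borel_measurable_times borel_measurable_const frame_comp) auto
  then show ?thesis using assms frame_comp[of a N j] by (cases "j = i") (auto simp: set_col_def)
qed

lemma avg_mean_spread:
  assumes i: "i < n" and \<epsilon>: "\<epsilon> \<in> signs {n..<p}" and \<epsilon>': "\<epsilon>' \<in> signs {n..<q}"
  shows "avg_mean p q n T0 s = frame_pair_integral p q (\<lambda>u v. est_mean p q n T0 (set_col p i (spread_col n (p - n) \<epsilon> u) u)
     (set_col q i (spread_col n (q - n) \<epsilon>' v) v) s)"
proof -
  let ?v = "\<lambda>v. set_col q i (spread_col n (q - n) \<epsilon>' v) v"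
  interpret Q: prob_space "frame_law q" by (rule prob_space_frame_law)
  have n: "n < p" "n \<le> p" "n \<le> q" using nq qp by auto
  have 1: "(\<integral>v. est_mean p q n T0 u v s \<partial>frame_law q) = (\<integral>v. est_mean p q n T0 u (?v v) s \<partial>frame_law q)" for u
  proof (rule frame_law_spread)
    have "(\<lambda>v. est_mean p q n T0 u v s) \<in> borel_measurable (frame_law q)"
      using nq by (intro est_mean_measurable frame_comp) auto
    then show "(\<lambda>v. est_mean p q n T0 u v s) \<in> borel_measurable (mat_space q)"
      unfolding measurable_cong_sets[OF sets_frame_law refl] .
    fix v v' :: "nat \<times> nat \<Rightarrow> real" assume "\<And>k l. l \<notin> {n..<n + (q - n)} \<Longrightarrow> v (k, l) = v' (k, l)"
    then show "est_mean p q n T0 u v s = est_mean p q n T0 u v' s"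
      by (intro est_mean_cong) (auto simp: svd_mean_def intro!: sum.cong)
  qed (use i nq signs_abs[OF \<epsilon>'] in auto)
  have "avg_mean p q n T0 s = (\<integral>u. \<integral>v. est_mean p q n T0 u (?v v) s \<partial>frame_law q \<partial>frame_law p)"
    unfolding avg_mean_def frame_pair_integral_def 1 ..
  also have "\<dots> = (\<integral>u. \<integral>v. est_mean p q n T0 (set_col p i (spread_col n (p - n) \<epsilon> u) u) (?v v) s \<partial>frame_law q \<partial>frame_law p)"
  proof (rule frame_law_spread)
    have "(\<lambda>z. est_mean p q n T0 (fst z) (?v (snd z)) s) \<in> borel_measurable (frame_law p \<Otimes>\<^sub>M frame_law q)"
      using n nq
      by (intro est_mean_measurable measurable_compose[OF measurable_fst frame_comp] measurable_compose[OF measurable_snd spread_comp]) auto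
    then have "(\<lambda>u. \<integral>v. est_mean p q n T0 u (?v v) s \<partial>frame_law q) \<in> borel_measurable (frame_law p)"
      by (intro Q.borel_measurable_lebesgue_integral) (simp add: case_prod_unfold)
    then show "(\<lambda>u. \<integral>v. est_mean p q n T0 u (?v v) s \<partial>frame_law q) \<in> borel_measurable (mat_space p)"
      unfolding measurable_cong_sets[OF sets_frame_law refl] .
    fix u u' :: "nat \<times> nat \<Rightarrow> real" assume "\<And>k l. l \<notin> {n..<n + (p - n)} \<Longrightarrow> u (k, l) = u' (k, l)"
    then have "est_mean p q n T0 u (?v v) s = est_mean p q n T0 u' (?v v) s" for v
      by (intro est_mean_cong) (auto simp: svd_mean_def intro!: sum.cong)
    then show "(\<integral>v. est_mean p q n T0 u (?v v) s \<partial>frame_law q) = (\<integral>v. est_mean p q n T0 u' (?v v) s \<partial>frame_law q)" by simp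
  qed (use i n signs_abs[OF \<epsilon>] in auto)
  finally show ?thesis unfolding frame_pair_integral_def .
qed

text \<open>
  The mean of a bounded estimator hardly reacts to the exchange of one singular value. The \<open>i\<close>-th
  singular vectors are first replaced by random signed sums of the unused columns, which leaves the
  average over the frames unchanged. For fixed orthogonal \<open>u\<close> and \<open>v\<close> what remains is a signed mixture
  of Gaussian laws around the matrix built from the other singular values, indexed by the
  singular value and the two sign vectors.
\<close>

lemma coordinate_moment_bound:
  fixes w :: "real \<Rightarrow> real"
  assumes i: "i < n" and X: "finite X" "X \<subseteq> {0..r}" and w: "(\<Sum>x\<in>X. \<bar>w x\<bar>) = 2"
    and orth: "\<And>m. m \<le> k \<Longrightarrow> (\<Sum>x\<in>X. w x * x ^ (2 * m)) = 0"
    and r: "r ^ 4 * (exp 1)\<^sup>2 \<le> \<rho> * (real (p - n) * real (q - n))" and \<rho>: "\<rho> < 1"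
  shows "\<bar>\<Sum>x\<in>X. w x * avg_mean p q n T0 (s(i := x))\<bar> \<le> B * sqrt (4 * \<rho> ^ Suc k / (1 - \<rho>))"
proof -
  let ?J = "{n..<p}" and ?J' = "{n..<q}" and ?I = "{..<p} \<times> {..<q}"
  define S where "S = X \<times> signs ?J \<times> signs ?J'"
  define c where "c a = w (fst a) / (2 ^ card ?J * 2 ^ card ?J')" for a :: "real \<times> (nat \<Rightarrow> real) \<times> (nat \<Rightarrow> real)"
  define su where "su a u = spread_col n (p - n) (fst (snd a)) u"
    for a :: "real \<times> (nat \<Rightarrow> real) \<times> (nat \<Rightarrow> real)" and u :: "nat \<times> nat \<Rightarrow> real"
  define sv where "sv a v = spread_col n (q - n) (snd (snd a)) v"
    for a :: "real \<times> (nat \<Rightarrow> real) \<times> (nat \<Rightarrow> real)" and v :: "nat \<times> nat \<Rightarrow> real"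
  define g where "g a u v = est_mean p q n T0 (set_col p i (su a u) u) (set_col q i (sv a v) v) (s(i := fst a))" for a u v
  have n: "n < p" "n \<le> p" "n \<le> q" using nq qp by auto
  have fS: "finite S" unfolding S_def using X by simp
  have B0: "B \<ge> 0" using B[of undefined] by linarith
  have gm: "(\<lambda>z. g a (fst z) (snd z)) \<in> borel_measurable (frame_law p \<Otimes>\<^sub>M frame_law q)" for a
    unfolding g_def su_def sv_def using n nq
    by (intro est_mean_measurable measurable_compose[OF measurable_fst spread_comp] measurable_compose[OF measurable_snd spread_comp]) auto
  have "(\<Sum>x\<in>X. w x * avg_mean p q n T0 (s(i := x))) = (\<Sum>a\<in>S. c a * avg_mean p q n T0 (s(i := fst a)))"
  proof -
    have "(\<Sum>a\<in>S. c a * avg_mean p q n T0 (s(i := fst a))) =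
      (\<Sum>a\<in>S. (w (fst a) * avg_mean p q n T0 (s(i := fst a))) * (1 / 2 ^ card ?J) * (1 / 2 ^ card ?J'))"
      by (intro sum.cong refl) (simp add: c_def)
    also have "\<dots> = (\<Sum>x\<in>X. w x * avg_mean p q n T0 (s(i := x))) * (\<Sum>\<epsilon>\<in>signs ?J. 1 / 2 ^ card ?J) * (\<Sum>\<epsilon>\<in>signs ?J'. 1 / 2 ^ card ?J')"
      unfolding S_def by (rule sum_triple_factor)
    finally show ?thesis by (simp add: card_signs)
  qed
  also have "\<dots> = (\<Sum>a\<in>S. c a * frame_pair_integral p q (g a))"
  proof (intro sum.cong refl)
    fix a assume "a \<in> S"
    then have "fst (snd a) \<in> signs ?J" "snd (snd a) \<in> signs ?J'"
      unfolding S_def by (simp_all only: mem_Times_iff)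
    from avg_mean_spread[OF i this] show "c a * avg_mean p q n T0 (s(i := fst a)) = c a * frame_pair_integral p q (g a)"
      unfolding g_def[abs_def] su_def sv_def by simp
  qed
  also have "\<dots> = frame_pair_integral p q (\<lambda>u v. \<Sum>a\<in>S. c a * g a u v)"
    using fS gm by (rule frame_pair_integral_sum) (auto simp: g_def intro: est_mean_bound)
  finally have eq: "(\<Sum>x\<in>X. w x * avg_mean p q n T0 (s(i := x))) = frame_pair_integral p q (\<lambda>u v. \<Sum>a\<in>S. c a * g a u v)" .
  show ?thesis unfolding eq
  proof (rule frame_pair_integral_bound)
    show "(\<lambda>z. \<Sum>a\<in>S. c a * g a (fst z) (snd z)) \<in> borel_measurable (frame_law p \<Otimes>\<^sub>M frame_law q)"
      by (intro borel_measurable_sum borel_measurable_times borel_measurable_const gm)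
  next
    fix u v :: "nat \<times> nat \<Rightarrow> real"
    assume u: "\<And>l l'. l < p \<Longrightarrow> l' < p \<Longrightarrow> (\<Sum>k<p. u (k, l) * u (k, l')) = (if l = l' then 1 else 0)"
      and v: "\<And>l l'. l < q \<Longrightarrow> l' < q \<Longrightarrow> (\<Sum>k<q. v (k, l) * v (k, l')) = (if l = l' then 1 else 0)"
    define m where "m = svd_mean n u v (s(i := 0))"
    define b where "b a = (\<lambda>kl. fst a * su a u (fst kl) * sv a v (snd kl))" for a
    have mean: "svd_mean n (set_col p i (su a u) u) (set_col q i (sv a v) v) (s(i := fst a)) (k, l) = m (k, l) + b a (k, l)"
      if "k < p" "l < q" for a k l
    proof -
      have "svd_mean n (set_col p i (su a u) u) (set_col q i (sv a v) v) (s(i := fst a)) (k, l) =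
        (\<Sum>j<n. (s(i := 0)) j * u (k, j) * v (l, j) + (if j = i then b a (k, l) else 0))"
        unfolding svd_mean_def using that by (auto simp: set_col_def b_def intro!: sum.cong)
      also have "\<dots> = m (k, l) + b a (k, l)" using i by (simp add: sum.distrib m_def svd_mean_def)
      finally show ?thesis .
    qed
    have gb: "g a u v = (\<integral>e. T0 (shift ?I (\<lambda>kl. m kl + b a kl) e) \<partial>std_normal_vec ?I)" for a
    proof -
      have "shift ?I (svd_mean n (set_col p i (su a u) u) (set_col q i (sv a v) v) (s(i := fst a))) e = shift ?I (\<lambda>kl. m kl + b a kl) e" for e
        unfolding shift_def
      proof (rule restrict_ext)
        fix kl assume "kl \<in> ?I"
        then obtain k l where "kl = (k, l)" "k < p" "l < q" by auto
        then show "svd_mean n (set_col p i (su a u) u) (set_col q i (sv a v) v) (s(i := fst a)) kl + e kl = m kl + b a kl + e kl"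
          using mean[of k l a] by simp
      qed
      then show ?thesis unfolding g_def est_mean_def gauss_noise_def by simp
    qed
    have bb: "(\<Sum>kl\<in>?I. b a kl * b a' kl) = fst a * fst a' * (sign_corr ?J (fst (snd a)) (fst (snd a')) * sign_corr ?J' (snd (snd a)) (snd (snd a')))" for a a'
    proof -
      have "(\<Sum>kl\<in>?I. b a kl * b a' kl) = (\<Sum>k<p. \<Sum>l<q. (fst a * fst a') * ((su a u k * su a' u k) * (sv a v l * sv a' v l)))"
      proof -
        have "(\<Sum>kl\<in>?I. b a kl * b a' kl) = (\<Sum>k<p. \<Sum>l<q. b a (k, l) * b a' (k, l))"
          by (simp add: sum.cartesian_product)
        also have "\<dots> = (\<Sum>k<p. \<Sum>l<q. (fst a * fst a') * ((su a u k * su a' u k) * (sv a v l * sv a' v l)))"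
          by (intro sum.cong refl) (simp add: b_def)
        finally show ?thesis .
      qed
      also have "\<dots> = fst a * fst a' * ((\<Sum>k<p. su a u k * su a' u k) * (\<Sum>l<q. sv a v l * sv a' v l))"
        unfolding sum_product unfolding sum_distrib_left ..
      finally show ?thesis unfolding su_def sv_def by (simp only: spread_col_inner[OF u n(2)] spread_col_inner[OF v n(3)])
    qed
    have "\<bar>\<Sum>a\<in>S. c a * g a u v\<bar> \<le> B * sqrt (\<Sum>a\<in>S. \<Sum>a'\<in>S. c a * c a' * exp (\<Sum>kl\<in>?I. b a kl * b a' kl))"
      unfolding gb using T0_gauss B fS by (intro gaussian_mixture_bound) (auto simp: gauss_noise_def)
    also have "\<dots> \<le> B * sqrt (4 * \<rho> ^ Suc k / (1 - \<rho>))"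
    proof (intro mult_left_mono real_sqrt_le_mono B0)
      show "(\<Sum>a\<in>S. \<Sum>a'\<in>S. c a * c a' * exp (\<Sum>kl\<in>?I. b a kl * b a' kl)) \<le> 4 * \<rho> ^ Suc k / (1 - \<rho>)"
        unfolding bb unfolding S_def c_def using n nq r
        by (intro exp_overlap_bound[OF _ _ _ _ X w orth _ \<rho>]) auto
    qed
    finally show "\<bar>\<Sum>a\<in>S. c a * g a u v\<bar> \<le> B * sqrt (4 * \<rho> ^ Suc k / (1 - \<rho>))" .
  qed
qed

end

section \<open>The minimax lower bound\<close>

lemma measurable_mat:
  "Matrix.mat p q \<in> PiM ({..<p} \<times> {..<q}) (\<lambda>_. borel) \<rightarrow>\<^sub>M mat_borel p q"
  unfolding mat_borel_def
proof (rule measurable_vimage_algebra2)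
  show "Matrix.mat p q \<in> space (PiM ({..<p} \<times> {..<q}) (\<lambda>_. borel :: real measure)) \<rightarrow> carrier_mat p q"
    by auto
  show "(\<lambda>e. \<lambda>ij\<in>{..<p} \<times> {..<q}. Matrix.mat p q e $$ ij)
     \<in> PiM ({..<p} \<times> {..<q}) (\<lambda>_. borel :: real measure) \<rightarrow>\<^sub>M PiM ({..<p} \<times> {..<q}) (\<lambda>_. borel)"
  proof (rule measurable_restrict)
    fix ij assume ij: "ij \<in> {..<p} \<times> {..<q}"
    then have "(\<lambda>e. Matrix.mat p q e $$ ij) = (\<lambda>e. e ij :: real)" by auto
    then show "(\<lambda>e. Matrix.mat p q e $$ ij) \<in> borel_measurable (PiM ({..<p} \<times> {..<q}) (\<lambda>_. borel :: real measure))"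
      using measurable_component_singleton[OF ij, of "\<lambda>_. borel :: real measure"] by simp
  qed
qed

lemma abs_risk_mat:
  assumes T: "T \<in> borel_measurable (mat_borel p q)"
  shows "abs_risk p q \<theta> T (Matrix.mat p q m) =
    (\<integral>\<^sup>+e. ennreal \<bar>T (Matrix.mat p q (shift ({..<p} \<times> {..<q}) m e)) - \<theta> (Matrix.mat p q m)\<bar> \<partial>gauss_noise p q)"
proof -
  have A: "Matrix.mat p q m \<in> carrier_mat p q" by simp
  have "Matrix.mat p q m + Matrix.mat p q e = Matrix.mat p q (shift ({..<p} \<times> {..<q}) m e)" for e
    by (rule eq_matI) (auto simp: shift_def)
  then show ?thesis
    unfolding abs_risk_def obs_law_def using T
    by (subst nn_integral_distr[OF obs_measurable[OF A]]) auto
qed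

lemma sup_norm_upper:
  assumes "continuous_on {0..r} g" "x \<in> {0..r}"
  shows "\<bar>g x\<bar> \<le> sup_norm g {0..r}"
proof -
  have "compact ((\<lambda>x. \<bar>g x\<bar>) ` {0..r})"
    using assms(1) by (intro compact_continuous_image continuous_intros) auto
  then have "bdd_above ((\<lambda>x. \<bar>g x\<bar>) ` {0..r})" by (intro bounded_imp_bdd_above compact_imp_bounded)
  then show ?thesis unfolding sup_norm_def using assms(2) by (intro cSUP_upper)
qed

lemma approx_err_attained:
  assumes f: "continuous_on {0..r} f" and r: "r \<ge> 0" and h: "h \<in> F"
    and cont: "\<And>h. h \<in> F \<Longrightarrow> continuous_on {0..r} h"
  shows "\<exists>x\<in>{0..r}. approx_err F f {0..r} \<le> \<bar>f x - h x\<bar>"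
proof -
  have nonneg: "sup_norm (\<lambda>x. h x - f x) {0..r} \<ge> 0" if "h \<in> F" for h
    using sup_norm_upper[of r "\<lambda>x. h x - f x" 0] f cont[OF that] r
    by (auto intro!: continuous_intros intro: order_trans[OF abs_ge_zero])
  have "bdd_below ((\<lambda>h. sup_norm (\<lambda>x. h x - f x) {0..r}) ` F)"
    using nonneg by (intro bdd_belowI2[of _ 0])
  then have le: "approx_err F f {0..r} \<le> sup_norm (\<lambda>x. h x - f x) {0..r}"
    unfolding approx_err_def using h by (rule cINF_lower)
  have "continuous_on {0..r} (\<lambda>x. \<bar>h x - f x\<bar>)" using f cont[OF h] by (intro continuous_intros)
  moreover have "{0..r} \<noteq> {}" using r by auto
  ultimately obtain x where x: "x \<in> {0..r}" "\<And>y. y \<in> {0..r} \<Longrightarrow> \<bar>h y - f y\<bar> \<le> \<bar>h x - f x\<bar>"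
    using continuous_attains_sup[of "{0..r}" "\<lambda>x. \<bar>h x - f x\<bar>"] by auto
  have "sup_norm (\<lambda>x. h x - f x) {0..r} \<le> \<bar>h x - f x\<bar>"
    unfolding sup_norm_def using x r by (intro cSUP_least) auto
  then show ?thesis using x(1) le by (intro bexI[of _ x]) (auto simp: abs_minus_commute)
qed

definition even_poly :: "nat \<Rightarrow> (nat \<Rightarrow> real) \<Rightarrow> real poly" where
  "even_poly k a = (\<Sum>m\<le>k. Polynomial.monom (a m) (2 * m))"

lemma poly_even_poly: "poly (even_poly k a) x = (\<Sum>m\<le>k. a m * x ^ (2 * m))"
  by (simp add: even_poly_def poly_sum poly_monom)

lemma even_poly_sym: "poly (even_poly k a) \<in> sym_polys (2 * k)"
proof -
  have "degree (even_poly k a) \<le> 2 * k"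
    unfolding even_poly_def by (intro degree_sum_le) (auto intro: order_trans[OF degree_monom_le])
  moreover have "\<forall>x. poly (even_poly k a) (- x) = poly (even_poly k a) x"
    unfolding poly_even_poly by (simp add: power_mult)
  ultimately show ?thesis unfolding sym_polys_def by blast
qed

lemma even_poly_nonzero:
  fixes a :: "nat \<Rightarrow> real"
  assumes "m \<le> k" "a m \<noteq> 0" and r: "r > 0"
  shows "\<exists>x\<in>{0..r}. (\<Sum>m\<le>k. a m * x ^ (2 * m)) \<noteq> 0"
proof (rule ccontr)
  assume "\<not> ?thesis"
  then have "{0..r} \<subseteq> {x. poly (even_poly k a) x = 0}" by (auto simp: poly_even_poly)
  moreover have "even_poly k a \<noteq> 0"
  proof
    assume "even_poly k a = 0"
    then have "coeff (even_poly k a) (2 * m) = 0" by simp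
    also have "coeff (even_poly k a) (2 * m) = (\<Sum>j\<le>k. if j = m then a j else 0)"
      unfolding even_poly_def coeff_sum by (intro sum.cong refl) (auto simp: coeff_monom)
    also have "\<dots> = a m" using assms(1) by simp
    finally show False using assms(2) by simp
  qed
  ultimately have "finite {0..r}" using poly_roots_finite finite_subset by blast
  then show False using r infinite_Icc[of 0 r] by simp
qed

lemma even_dual_weights:
  assumes f: "continuous_on {0..r} f" and r: "r > 0" and E: "approx_err (sym_polys (2 * k)) f {0..r} > 0"
  obtains X w where "finite X" "X \<subseteq> {0..r}" "(\<Sum>x\<in>X. \<bar>w x\<bar>) = 2"
    "\<And>m. m \<le> k \<Longrightarrow> (\<Sum>x\<in>X. w x * x ^ (2 * m)) = 0"
    "(\<Sum>x\<in>X. w x * f x) \<ge> approx_err (sym_polys (2 * k)) f {0..r}"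
proof (rule dual_weights[OF E, where b = "\<lambda>m x. x ^ (2 * m)" and f = f and I = "{0..r}" and K = k])
  fix a :: "nat \<Rightarrow> real"
  have "\<exists>x\<in>{0..r}. approx_err (sym_polys (2 * k)) f {0..r} \<le> \<bar>f x - poly (even_poly k a) x\<bar>"
    using r by (intro approx_err_attained f even_poly_sym) (auto simp: sym_polys_def intro!: continuous_intros)
  then show "\<exists>x\<in>{0..r}. approx_err (sym_polys (2 * k)) f {0..r} \<le> \<bar>f x - (\<Sum>m\<le>k. a m * x ^ (2 * m))\<bar>"
    unfolding poly_even_poly .
next
  fix a :: "nat \<Rightarrow> real" assume "\<exists>m\<le>k. a m \<noteq> 0"
  then show "\<exists>x\<in>{0..r}. (\<Sum>m\<le>k. a m * x ^ (2 * m)) \<noteq> 0"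
    using even_poly_nonzero[OF _ _ r] by blast
qed (rule that, auto)

text \<open>
  The bias of the clipped estimator is at most \<open>R\<close> at every matrix with singular values from \<open>X\<close>,
  hence also on average over the singular vectors. The function \<open>D\<close> below, the variable part of the target
  minus the averaged mean of the estimator, is therefore constant up to \<open>R\<close>. Exchanging
  one singular value moves its first part by \<open>\<Sum> w f\<close> and its second part by at most the bound of
  \<open>coordinate_moment_bound\<close>, so \<open>hybrid_gap\<close> applies.
\<close>

lemma risk_lower_bound:
  fixes f :: "real \<Rightarrow> real" and p q n k :: nat
  assumes nq: "n < q" and qp: "q \<le> p" and f: "continuous_on {0..r} f" and r: "r > 0"
    and T: "T \<in> borel_measurable (mat_borel p q)"
    and R: "\<And>A. A \<in> carrier_mat p q \<Longrightarrow> op_norm A \<le> r \<Longrightarrow> abs_risk p q (spectral_sum f) T A \<le> ennreal R" "R \<ge> 0"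
    and E: "approx_err (sym_polys (2 * k)) f {0..r} > 0"
    and rho: "r ^ 4 * (exp 1)\<^sup>2 \<le> \<rho> * (real (p - n) * real (q - n))" "\<rho> < 1"
  shows "real n * (approx_err (sym_polys (2 * k)) f {0..r} - real q * sup_norm f {0..r} * sqrt (4 * \<rho> ^ Suc k / (1 - \<rho>))) \<le> 2 * R"
proof -
  define B where "B = real q * sup_norm f {0..r}"
  define \<eta> where "\<eta> = B * sqrt (4 * \<rho> ^ Suc k / (1 - \<rho>))"
  let ?I = "{..<p} \<times> {..<q}"
  \<comment> \<open>All values of the target lie in \<open>[- B, B]\<close>, so clipping the estimator to this interval does not
    increase its error.\<close>
  define T0 where "T0 e = max (- B) (min B (T (Matrix.mat p q e)))" for e
  obtain X w where X: "finite X" "X \<subseteq> {0..r}" and w: "(\<Sum>x\<in>X. \<bar>w x\<bar>) = 2"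
    and orth: "\<And>m. m \<le> k \<Longrightarrow> (\<Sum>x\<in>X. w x * x ^ (2 * m)) = 0"
    and wf: "(\<Sum>x\<in>X. w x * f x) \<ge> approx_err (sym_polys (2 * k)) f {0..r}"
    using even_dual_weights[OF f r E] by blast
  have w0: "(\<Sum>x\<in>X. w x) = 0" using orth[of 0] by simp
  have f_le: "\<bar>f x\<bar> \<le> sup_norm f {0..r}" if "x \<in> {0..r}" for x using sup_norm_upper[OF f that] .
  have f0: "0 \<le> sup_norm f {0..r}" using f_le[of 0] r by (auto intro: order_trans[OF abs_ge_zero])
  have B0: "B \<ge> 0" unfolding B_def using f0 by simp
  have T0B: "\<bar>T0 e\<bar> \<le> B" for e unfolding T0_def using B0 by (auto simp: abs_le_iff)
  have TM: "(\<lambda>e. T (Matrix.mat p q e)) \<in> borel_measurable (PiM ?I (\<lambda>_. borel))"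
    by (rule measurable_compose[OF measurable_mat T])
  then have T0m: "T0 \<in> borel_measurable (PiM ?I (\<lambda>_. borel))"
    unfolding T0_def[abs_def] by (intro borel_measurable_max borel_measurable_min borel_measurable_const)
  let ?\<Phi> = "est_mean p q n T0" and ?\<Psi> = "avg_mean p q n T0"
  define th where "th s = (\<Sum>j<n. f (s j)) + real (q - n) * f 0" for s :: "nat \<Rightarrow> real"
  have th_le: "\<bar>th s\<bar> \<le> B" if s: "\<forall>j<n. s j \<in> X" for s
  proof -
    have "\<bar>\<Sum>j<n. f (s j)\<bar> \<le> (\<Sum>j<n. sup_norm f {0..r})"
      using s X by (intro order_trans[OF sum_abs] sum_mono f_le) auto
    moreover have "\<bar>real (q - n) * f 0\<bar> \<le> real (q - n) * sup_norm f {0..r}"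
      unfolding abs_mult using f_le[of 0] r by (intro mult_mono) auto
    moreover have "real n * sup_norm f {0..r} + real (q - n) * sup_norm f {0..r} = B"
      unfolding B_def using nq by (simp add: distrib_right[symmetric] of_nat_diff)
    ultimately show ?thesis unfolding th_def by simp
  qed
  have bias: "\<bar>?\<Phi> u v s - th s\<bar> \<le> R"
    if s: "\<forall>j<n. s j \<in> X"
      and u: "\<And>l l'. l < p \<Longrightarrow> l' < p \<Longrightarrow> (\<Sum>k<p. u (k, l) * u (k, l')) = (if l = l' then 1 else 0)"
      and v: "\<And>l l'. l < q \<Longrightarrow> l' < q \<Longrightarrow> (\<Sum>k<q. v (k, l) * v (k, l')) = (if l = l' then 1 else 0)" for s u v
  proof -
    interpret G: prob_space "gauss_noise p q" by (rule prob_space_gauss_noise)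
    let ?A = "Matrix.mat p q (svd_mean n u v s)"
    let ?S = "shift ?I (svd_mean n u v s)"
    have sr: "s j \<in> {0..r}" if "j < n" for j using s X that by auto
    have A: "?A = Matrix.mat p q (\<lambda>(a, b). \<Sum>j<n. s j * u (a, j) * v (b, j))" by (simp add: svd_mean_def)
    have th: "spectral_sum f ?A = th s"
      unfolding th_def using nq qp sr by (intro spectral_sum_svd[OF _ _ v _ A] u) auto
    have "op_norm ?A \<le> r"
      using nq qp sr r by (intro op_norm_svd[OF _ _ v _ A] u) auto
    then have risk: "abs_risk p q (spectral_sum f) T ?A \<le> ennreal R" by (intro R) auto
    have Sm: "?S \<in> gauss_noise p q \<rightarrow>\<^sub>M PiM ?I (\<lambda>_. borel)"
      unfolding gauss_noise_def using shift_measurable[of ?I] by (simp cong: measurable_cong_sets sets_PiM_cong)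
    have int: "integrable (gauss_noise p q) (\<lambda>e. T0 (?S e))"
      using T0B measurable_compose[OF Sm T0m] by (intro G.integrable_const_bound[where B = B]) auto
    have "ennreal \<bar>?\<Phi> u v s - th s\<bar> = ennreal (norm (\<integral>e. T0 (?S e) - th s \<partial>gauss_noise p q))"
      using int by (simp add: est_mean_def G.prob_space)
    also have "\<dots> \<le> (\<integral>\<^sup>+e. ennreal (norm (T0 (?S e) - th s)) \<partial>gauss_noise p q)"
      using int by (intro integral_norm_bound_ennreal) auto
    also have "\<dots> \<le> (\<integral>\<^sup>+e. ennreal \<bar>T (Matrix.mat p q (?S e)) - th s\<bar> \<partial>gauss_noise p q)"
    proof (intro nn_integral_mono ennreal_leI)
      fix e
      have "- B \<le> th s" "th s \<le> B" using th_le[OF s] by (auto simp: abs_le_iff)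
      then have "\<bar>max (- B) (min B t) - th s\<bar> \<le> \<bar>t - th s\<bar>" for t
        by (auto simp: max_def min_def abs_if)
      then show "norm (T0 (?S e) - th s) \<le> \<bar>T (Matrix.mat p q (?S e)) - th s\<bar>"
        unfolding T0_def by simp
    qed
    also have "\<dots> \<le> ennreal R" using risk unfolding abs_risk_mat[OF T] th .
    finally show ?thesis using R(2) by simp
  qed
  have avg: "\<bar>?\<Psi> s - th s\<bar> \<le> R" if s: "\<forall>j<n. s j \<in> X" for s
  proof -
    interpret P: prob_space "frame_law p" by (rule prob_space_frame_law)
    interpret Q: prob_space "frame_law q" by (rule prob_space_frame_law)
    \<comment> \<open>The two terms of a difference as summands indexed by truth values.\<close>
    define g where "g b u v = (if b then ?\<Phi> u v s else th s)" for b u v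
    define c :: "bool \<Rightarrow> real" where "c b = (if b then 1 else - 1)" for b
    have m: "(\<lambda>z. ?\<Phi> (fst z) (snd z) s) \<in> borel_measurable (frame_law p \<Otimes>\<^sub>M frame_law q)"
      using nq qp
      by (intro est_mean_measurable[OF nq qp T0m T0B] measurable_compose[OF measurable_fst frame_comp] measurable_compose[OF measurable_snd frame_comp]) auto
    have "(\<Sum>b\<in>{True, False}. c b * frame_pair_integral p q (g b)) = frame_pair_integral p q (\<lambda>u v. \<Sum>b\<in>{True, False}. c b * g b u v)"
    proof (rule frame_pair_integral_sum[where B = B])
      show "(\<lambda>z. g b (fst z) (snd z)) \<in> borel_measurable (frame_law p \<Otimes>\<^sub>M frame_law q)" for b
        unfolding g_def using m by (cases b) auto
      show "\<bar>g b u v\<bar> \<le> B" for b u v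
        unfolding g_def using est_mean_bound[OF nq qp T0m T0B] th_le[OF s] by auto
    qed auto
    then have "?\<Psi> s - th s = frame_pair_integral p q (\<lambda>u v. ?\<Phi> u v s - th s)"
      by (simp add: c_def g_def avg_mean_def frame_pair_integral_def P.prob_space Q.prob_space)
    moreover have "\<bar>frame_pair_integral p q (\<lambda>u v. ?\<Phi> u v s - th s)\<bar> \<le> R"
      using m bias[OF s] by (intro frame_pair_integral_bound) auto
    ultimately show ?thesis by simp
  qed
  define D where "D s = (\<Sum>j<n. f (s j)) - ?\<Psi> s" for s
  have "real n * (approx_err (sym_polys (2 * k)) f {0..r} - \<eta>) \<le> 2 * R"
  proof (rule hybrid_gap[OF X(1) w w0, where B = D and C = "- (real (q - n) * f 0)"])
    fix s assume "\<forall>j<n. s j \<in> X"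
    from avg[OF this] show "\<bar>D s - - (real (q - n) * f 0)\<bar> \<le> R"
      unfolding D_def th_def by (simp add: abs_minus_commute algebra_simps)
  next
    fix i s assume i: "i < n" and s: "\<forall>j<n. s j \<in> X"
    have "(\<Sum>j<n. f ((s(i := x)) j)) = f x + (\<Sum>j\<in>{..<n} - {i}. f (s j))" for x
      using i by (subst sum.remove[of _ i]) auto
    then have "(\<Sum>x\<in>X. w x * D (s(i := x))) =
       (\<Sum>x\<in>X. w x * f x) + (\<Sum>x\<in>X. w x) * (\<Sum>j\<in>{..<n} - {i}. f (s j)) - (\<Sum>x\<in>X. w x * ?\<Psi> (s(i := x)))"
      unfolding D_def by (simp add: right_diff_distrib distrib_left sum_subtractf sum.distrib sum_distrib_right)
    moreover have "\<bar>\<Sum>x\<in>X. w x * ?\<Psi> (s(i := x))\<bar> \<le> \<eta>"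
      unfolding \<eta>_def by (rule coordinate_moment_bound[OF nq qp T0m T0B i X w orth rho])
    ultimately show "(\<Sum>x\<in>X. w x * D (s(i := x))) \<ge> approx_err (sym_polys (2 * k)) f {0..r} - \<eta>"
      using wf w0 by (simp add: abs_le_iff)
  qed
  then show ?thesis by (simp add: \<eta>_def B_def)
qed

theorem theorem4p9:
  shows "\<exists>c::real. c > 0 \<and>
    (\<forall>(p::nat) (q::nat) (f::real \<Rightarrow> real).
       4 \<le> q \<longrightarrow> q \<le> p \<longrightarrow> continuous_on {0..} f \<longrightarrow>
       (let r = 0.125 * (real p * real q) powr (1/4);
            I\<^sub>0 = {0..r};
            k = nat \<lceil>ln (4 * real_of_int \<lceil>real q / 2\<rceil>)\<rceil>
        in minimax_risk p q (spectral_sum f) {A \<in> carrier_mat p q. op_norm A \<le> r}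
             \<ge> ennreal (c * max 0 (real q * approx_err (sym_polys (2 * k)) f I\<^sub>0
                                    - sqrt (real q) * sup_norm f I\<^sub>0))))"
proof (intro exI[of _ "1 / 6"] conjI allI impI)
  fix p q :: nat and f :: "real \<Rightarrow> real"
  assume q: "4 \<le> q" and qp: "q \<le> p" and f: "continuous_on {0..} f"
  define r where "r = 0.125 * (real p * real q) powr (1 / 4)"
  define k where "k = nat \<lceil>ln (4 * real_of_int \<lceil>real q / 2\<rceil>)\<rceil>"
  define E where "E = approx_err (sym_polys (2 * k)) f {0..r}"
  define F where "F = sup_norm f {0..r}"
  define n where "n = q div 2"
  \<comment> \<open>Four times \<open>e\<^sup>2 / 4096\<close>: the factor \<open>4\<close> pays for replacing \<open>p q\<close> by \<open>(p - n) (q - n)\<close>.\<close>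
  define \<rho> :: real where "\<rho> = (exp 1)\<^sup>2 / 1024"
  have pq: "real p > 0" "real q > 0" using q qp by auto
  have r: "r > 0" unfolding r_def using pq by simp
  have f': "continuous_on {0..r} f" using f by (rule continuous_on_subset) auto
  have F0: "F \<ge> 0" using sup_norm_upper[OF f', of 0] r unfolding F_def by (auto intro: order_trans[OF abs_ge_zero])
  have n: "n < q" "real n \<ge> real q / 3" "real n \<le> real q / 2" using q unfolding n_def by (auto simp: real_of_nat_div)
  have e3: "exp 1 \<le> (3::real)" by (rule exp_le)
  have \<rho>: "0 < \<rho>" "\<rho> \<le> 9 / 1024"
  proof -
    have "(exp 1)\<^sup>2 \<le> (3::real)\<^sup>2" using e3 by (intro power_mono) auto
    then show "0 < \<rho>" "\<rho> \<le> 9 / 1024" unfolding \<rho>_def by auto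
  qed
  have rho: "r ^ 4 * (exp 1)\<^sup>2 \<le> \<rho> * (real (p - n) * real (q - n))"
  proof -
    have "((real p * real q) powr (1 / 4)) ^ 4 = real p * real q"
      using pq by (simp add: powr_power)
    then have "r ^ 4 = real p * real q / 4096" unfolding r_def by (simp add: power_mult_distrib power_divide)
    then have "r ^ 4 * (exp 1)\<^sup>2 = \<rho> * ((real p / 2) * (real q / 2))" unfolding \<rho>_def by simp
    also have "\<dots> \<le> \<rho> * (real (p - n) * real (q - n))"
      using n \<rho> pq qp by (intro mult_left_mono mult_mono) (auto simp: of_nat_diff)
    finally show ?thesis .
  qed
  have k: "real k \<ge> ln (2 * real q)"
  proof -
    have "2 * real q \<le> 4 * real_of_int \<lceil>real q / 2\<rceil>" by linarith
    then have "ln (2 * real q) \<le> ln (4 * real_of_int \<lceil>real q / 2\<rceil>)" using pq by (intro ln_mono) auto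
    also have "\<dots> \<le> real k" unfolding k_def by linarith
    finally show ?thesis .
  qed
  have \<rho>k: "\<rho> ^ k \<le> 1 / (2 * real q) ^ 4"
  proof -
    have "\<rho> \<le> exp (- 4)"
    proof -
      have "(exp 1) ^ 6 \<le> (3::real) ^ 6" using e3 by (intro power_mono) auto
      then have "(exp (6::real)) \<le> 1024" by (simp add: exp_of_nat_mult[of 6 1, simplified, symmetric])
      moreover have "(exp 1)\<^sup>2 = exp (6::real) * exp (- 4)"
        by (simp add: exp_add[symmetric] exp_of_nat_mult[of 2 1, simplified, symmetric])
      ultimately show ?thesis unfolding \<rho>_def by simp
    qed
    then have "\<rho> ^ k \<le> exp (- 4) ^ k" using \<rho> by (intro power_mono) auto
    also have "\<dots> = exp (real k * - 4)" by (rule exp_of_nat_mult[symmetric])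
    also have "\<dots> \<le> exp (- (4 * ln (2 * real q)))" using k by simp
    also have "\<dots> = 1 / (2 * real q) ^ 4"
    proof -
      have "exp (4 * ln (2 * real q)) = exp (ln (2 * real q)) ^ 4"
        using exp_of_nat_mult[of 4 "ln (2 * real q)"] by simp
      also have "exp (ln (2 * real q)) = 2 * real q" using pq by simp
      finally have e: "exp (4 * ln (2 * real q)) = (2 * real q) ^ 4" .
      show ?thesis unfolding exp_minus e by (rule inverse_eq_divide)
    qed
    finally show ?thesis .
  qed
  have decay: "sqrt (4 * \<rho> ^ Suc k / (1 - \<rho>)) \<le> 1 / (2 * real q)\<^sup>2"
  proof (rule real_le_lsqrt)
    have "4 * \<rho> / (1 - \<rho>) \<le> 1" using \<rho> by (simp add: field_simps)
    then have "(4 * \<rho> / (1 - \<rho>)) * \<rho> ^ k \<le> 1 * \<rho> ^ k" using \<rho> by (intro mult_right_mono) auto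
    then have "4 * \<rho> ^ Suc k / (1 - \<rho>) \<le> \<rho> ^ k" by simp
    also note \<rho>k
    also have "1 / (2 * real q) ^ 4 = (1 / (2 * real q)\<^sup>2)\<^sup>2" by (simp add: power_divide power_mult[symmetric])
    finally show "4 * \<rho> ^ Suc k / (1 - \<rho>) \<le> (1 / (2 * real q)\<^sup>2)\<^sup>2" .
  qed simp
  have main: "ennreal (1 / 6 * max 0 (real q * E - sqrt (real q) * F)) \<le>
      (SUP A \<in> {A \<in> carrier_mat p q. op_norm A \<le> r}. abs_risk p q (spectral_sum f) T A)"
    if T: "T \<in> borel_measurable (mat_borel p q)" for T
  proof -
    define S where "S = (SUP A \<in> {A \<in> carrier_mat p q. op_norm A \<le> r}. abs_risk p q (spectral_sum f) T A)"
    have "ennreal (1 / 6 * max 0 (real q * E - sqrt (real q) * F)) \<le> S"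
    proof (cases "real q * E - sqrt (real q) * F \<le> 0 \<or> S = \<infinity>")
      case True
      then show ?thesis by (auto simp: max_def)
    next
      case False
      then have fin: "S \<noteq> \<infinity>" and pos: "real q * E - sqrt (real q) * F > 0" by auto
      then obtain R where R: "S = ennreal R" "R \<ge> 0" by (cases S) auto
      have "0 \<le> sqrt (real q) * F" using F0 by simp
      then have "real q * E > 0" using pos by linarith
      then have E0: "E > 0" using pq by (simp add: zero_less_mult_iff)
      have "abs_risk p q (spectral_sum f) T A \<le> ennreal R" if "A \<in> carrier_mat p q" "op_norm A \<le> r" for A
        unfolding R(1)[symmetric] S_def using that by (intro SUP_upper) auto
      from risk_lower_bound[OF n(1) qp f' r T this R(2) E0[unfolded E_def] rho] \<rho>
      have lower: "real n * (E - real q * F * sqrt (4 * \<rho> ^ Suc k / (1 - \<rho>))) \<le> 2 * R"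
        unfolding E_def F_def by simp
      have "real q * F * sqrt (4 * \<rho> ^ Suc k / (1 - \<rho>)) \<le> real q * F * (1 / (2 * real q)\<^sup>2)"
        using decay F0 by (intro mult_left_mono) auto
      also have "\<dots> = F / (4 * real q)" using pq by (simp add: power2_eq_square field_simps)
      also have "\<dots> \<le> sqrt (real q) * F / real q"
      proof -
        have "1 \<le> sqrt (real q)" using q by simp
        then have "F * 1 \<le> F * (4 * sqrt (real q))"
          by (intro mult_left_mono F0) linarith
        then show ?thesis using pq by (simp add: field_simps)
      qed
      finally have \<eta>: "real q * F * sqrt (4 * \<rho> ^ Suc k / (1 - \<rho>)) \<le> sqrt (real q) * F / real q" .
      have "(real q * E - sqrt (real q) * F) / 3 = real q / 3 * (E - sqrt (real q) * F / real q)"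
        using pq by (simp add: field_simps)
      also have "\<dots> \<le> real n * (E - sqrt (real q) * F / real q)"
        using n pos pq by (intro mult_right_mono) (auto simp: field_simps)
      also have "\<dots> \<le> real n * (E - real q * F * sqrt (4 * \<rho> ^ Suc k / (1 - \<rho>)))"
        using \<eta> by (intro mult_left_mono) auto
      also note lower
      finally have "1 / 6 * max 0 (real q * E - sqrt (real q) * F) \<le> R" using pos by simp
      then show ?thesis unfolding R(1) by (intro ennreal_leI)
    qed
    then show ?thesis unfolding S_def .
  qed
  have "ennreal (1 / 6 * max 0 (real q * E - sqrt (real q) * F)) \<le>
     minimax_risk p q (spectral_sum f) {A \<in> carrier_mat p q. op_norm A \<le> r}"
    unfolding minimax_risk_def by (intro INF_greatest main)
  then show "let r = 0.125 * (real p * real q) powr (1/4);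
            I\<^sub>0 = {0..r};
            k = nat \<lceil>ln (4 * real_of_int \<lceil>real q / 2\<rceil>)\<rceil>
        in minimax_risk p q (spectral_sum f) {A \<in> carrier_mat p q. op_norm A \<le> r}
             \<ge> ennreal (1 / 6 * max 0 (real q * approx_err (sym_polys (2 * k)) f I\<^sub>0
                                    - sqrt (real q) * sup_norm f I\<^sub>0))"
    unfolding Let_def E_def F_def r_def k_def .
qed simp

end
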